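(* Suppose the geometry condition holds with parameter $r\ge 1$. Let $\alpha>0$ be fixed and assume that $f_0\in H^\beta(C)$ for some $C>0$ and $0<\beta\le \alpha+r/2$. Let the random function $f$ on the graph be defined by $$c\sim \mathrm{Exp}(1),\qquad f\mid c\sim N\Big(0,\Big(\big((n/c)^{2/r}(L+n^{-2}I)\big)^{\alpha+r/2}\Big)^{-1}\Big).$$ Then there exists a constant $K_1>0$ and for all $K_2>1$ there exist Borel measurable subsets $B_n$ of $\mathbb{R}^n$ such that for every sufficiently large $n$, $$P(\|f-f_0\|_n<\varepsilon_n)\ge e^{-K_1n\varepsilon_n^2},$$ $$P(f\notin B_n)\le e^{-K_2n\varepsilon_n^2},$$ $$\log N(\varepsilon_n,B_n,\|\cdot\|_n)\le n\varepsilon_n^2,$$ where $\varepsilon_n$ is a multiple of $n^{-\beta/(2\beta+r)}$.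
   Context: Graphs: $G=G_n$ is a sequence of connected, simple (no loops, multiple edges or weights), undirected graphs, where $G_n$ has $n$ vertices labelled $1,\dots,n$, and $n$ tends to infinity; the subscript $n$ is suppressed. Let $A_G$ be the adjacency matrix of $G$, $D$ the diagonal matrix of vertex degrees, and $L=D-A_G$ the Laplacian, with eigenvalues $0=\lambda_0<\lambda_1\le\dots\le\lambda_{n-1}$ (dependence on $n$ suppressed). $I$ is the identity matrix; real powers of symmetric positive (semi-)definite matrices are defined spectrally. Geometry condition with parameter $r\ge1$: there exist $i_0\in\mathbb{N}$, $\kappa\in(0,1]$ and $C_1,C_2>0$ such that for all $n$ large enough, $C_1(i/n)^{2/r}\le\lambda_i\le C_2(i/n)^{2/r}$ for all integers $i$ with $i_0\le i\le\kappa n$ and $i\le n-1$. A function $f$ on $G$ is a map $\{1,\dots,n\}\to\mathbb{R}$ and is identified with the vector $(f(1),\dots,f(n))\in\mathbb{R}^n$; strictly speaking, a function on $G$ (such as $f_0$) is a sequence of functions indexed by $n$. Write $\langle f,g\rangle_n=\frac1n\sum_{i=1}^nf(i)g(i)$ and $\|f\|_n^2=\langle f,f\rangle_n$. For $\beta,C>0$ (independent of $n$), $H^\beta(C)=\{f:\langle f,(I+(n^{2/r}L)^\beta)f\rangle_n\le C^2\}$. For $\varepsilon>0$ and a norm $\|\cdot\|$ on a set $B$, $N(\varepsilon,B,\|\cdot\|)$ denotes the minimal number of balls of $\|\cdot\|$-radius $\varepsilon$ needed to cover $B$. $\mathrm{Exp}(1)$ is the standard exponential distribution; $N(0,\Sigma)$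 is the centered Gaussian law on $\mathbb{R}^n$ with covariance matrix $\Sigma$.
   Formalization: With one common ε_n the second and third displays contradict each other for large K_2; here the first two displays use one multiple of n^{-β/(2β+r)} fixed before K_2, and the entropy bound uses a possibly different multiple that may depend on K_2, on both of its sides. *)

theory Defs
  imports
    "HOL-Probability.Probability"
    "Jordan_Normal_Form.Char_Poly"
    "Jordan_Normal_Form.Gauss_Jordan_Elimination"
    "Graph_Theory.Graph_Theory"
begin

text \<open>
  The graph on \<open>n\<close> vertices has vertex set \<open>{..<n}\<close> instead of \<open>{1..n}\<close>, so that vertices are the
  indices of matrices and vectors. A simple undirected graph is a symmetric digraph without loops
  (locale \<open>pair_graph\<close>). Functions on the graph are functions on \<^typ>\<open>nat\<close> of which only the values
  on \<open>{..<n}\<close> matter, and \<open>\<real>\<^sup>n\<close> as a measurable space is \<open>\<Pi>\<^sub>M i\<in>{..<n}. borel\<close>.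
\<close>

definition connected_simple_graph :: "nat \<Rightarrow> nat pair_pre_digraph \<Rightarrow> bool" where
  "connected_simple_graph n G \<longleftrightarrow>
     pair_graph G \<and> pverts G = {..<n} \<and> Digraph_Component.connected (with_proj G)"

definition adjacency_mat :: "nat \<Rightarrow> nat pair_pre_digraph \<Rightarrow> real mat" where
  "adjacency_mat n G = Matrix.mat n n (\<lambda>(i, j). if (i, j) \<in> parcs G then 1 else 0)"

definition degree_mat :: "nat \<Rightarrow> nat pair_pre_digraph \<Rightarrow> real mat" where
  "degree_mat n G = mat_diag n (\<lambda>i. real (out_degree (with_proj G) i))"

definition laplacian :: "nat \<Rightarrow> nat pair_pre_digraph \<Rightarrow> real mat" where
  "laplacian n G = degree_mat n G - adjacency_mat n G"

text \<open>
  The \<open>i\<close>-th smallest eigenvalue, counted with multiplicity and starting from \<open>i = 0\<close>; all roots of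
  the characteristic polynomial of the (symmetric) Laplacian are real.
\<close>

definition laplacian_eigenvalue :: "nat \<Rightarrow> nat pair_pre_digraph \<Rightarrow> nat \<Rightarrow> real" where
  "laplacian_eigenvalue n G i = sorted_list_of_multiset (proots (char_poly (laplacian n G))) ! i"

definition geometry_condition :: "(nat \<Rightarrow> nat pair_pre_digraph) \<Rightarrow> real \<Rightarrow> bool" where
  "geometry_condition G r \<longleftrightarrow>
     (\<exists>i0 :: nat. \<exists>\<kappa> C1 C2 :: real. 0 < \<kappa> \<and> \<kappa> \<le> 1 \<and> 0 < C1 \<and> 0 < C2 \<and>
       (\<forall>\<^sub>F n in sequentially. \<forall>i. i0 \<le> i \<and> real i \<le> \<kappa> * real n \<and> i \<le> n - 1 \<longrightarrow>
          C1 * (real i / real n) powr (2 / r) \<le> laplacian_eigenvalue n (G n) i \<and>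
          laplacian_eigenvalue n (G n) i \<le> C2 * (real i / real n) powr (2 / r)))"

text \<open>
  Real powers of symmetric positive semi-definite matrices: if \<open>A = U diag(d) U\<^sup>T\<close> with \<open>U\<close> orthogonal,
  then \<open>A\<^sup>s = U diag(d\<^sup>s) U\<^sup>T\<close>. The result does not depend on the choice of \<open>U\<close> and \<open>d\<close>.
  Since \<open>0 powr s = 0\<close>, this is the usual power for singular \<open>A\<close> only if \<open>s > 0\<close>.
\<close>

definition is_spectral_powr :: "real mat \<Rightarrow> real \<Rightarrow> real mat \<Rightarrow> bool" where
  "is_spectral_powr A s B \<longleftrightarrow>
     (\<exists>U d. U \<in> carrier_mat (dim_row A) (dim_row A) \<and>
        U * transpose_mat U = 1\<^sub>m (dim_row A) \<and> transpose_mat U * U = 1\<^sub>m (dim_row A) \<and>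
        A = U * mat_diag (dim_row A) d * transpose_mat U \<and>
        B = U * mat_diag (dim_row A) (\<lambda>i. d i powr s) * transpose_mat U)"

definition mat_powr :: "real mat \<Rightarrow> real \<Rightarrow> real mat" where
  "mat_powr A s = (THE B. is_spectral_powr A s B)"

definition mat_apply :: "nat \<Rightarrow> real mat \<Rightarrow> (nat \<Rightarrow> real) \<Rightarrow> nat \<Rightarrow> real" where
  "mat_apply n A f = (\<lambda>i\<in>{..<n}. vec_index (A *\<^sub>v Matrix.vec n f) i)"

definition inner_n :: "nat \<Rightarrow> (nat \<Rightarrow> real) \<Rightarrow> (nat \<Rightarrow> real) \<Rightarrow> real" where
  "inner_n n f g = (\<Sum>i<n. f i * g i) / real n"

definition norm_n :: "nat \<Rightarrow> (nat \<Rightarrow> real) \<Rightarrow> real" where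
  "norm_n n f = sqrt (inner_n n f f)"

definition sobolev_ball ::
    "nat \<Rightarrow> nat pair_pre_digraph \<Rightarrow> real \<Rightarrow> real \<Rightarrow> real \<Rightarrow> (nat \<Rightarrow> real) set" where
  "sobolev_ball n G r \<beta> C =
     {f. inner_n n f
           (mat_apply n (1\<^sub>m n + mat_powr ((real n powr (2 / r)) \<cdot>\<^sub>m laplacian n G) \<beta>) f) \<le> C\<^sup>2}"

definition Rn :: "nat \<Rightarrow> (nat \<Rightarrow> real) measure" where
  "Rn n = Pi\<^sub>M {..<n} (\<lambda>_. borel)"

text \<open>\<open>N(0, S)\<close> as the law of \<open>S\<^sup>1\<^sup>/\<^sup>2 Z\<close> for a standard normal random vector \<open>Z\<close>.\<close>

definition centered_gaussian :: "nat \<Rightarrow> real mat \<Rightarrow> (nat \<Rightarrow> real) measure" where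
  "centered_gaussian n S =
     distr (Pi\<^sub>M {..<n} (\<lambda>_. density lborel (\<lambda>x. ennreal (std_normal_density x)))) (Rn n)
       (mat_apply n (mat_powr S (1 / 2)))"

definition prior_covariance ::
    "nat \<Rightarrow> nat pair_pre_digraph \<Rightarrow> real \<Rightarrow> real \<Rightarrow> real \<Rightarrow> real mat" where
  "prior_covariance n G r \<alpha> c =
     the (mat_inverse (mat_powr
       (((real n / c) powr (2 / r)) \<cdot>\<^sub>m (laplacian n G + (1 / (real n)\<^sup>2) \<cdot>\<^sub>m 1\<^sub>m n)) (\<alpha> + r / 2)))"

text \<open>\<open>K\<close> is the conditional law of \<open>f\<close> given \<open>c\<close>; its values on null sets of the law of \<open>c\<close> are
  irrelevant.\<close>

definition conditional_law ::
    "'w measure \<Rightarrow> 'b measure \<Rightarrow> ('w \<Rightarrow> real) \<Rightarrow> ('w \<Rightarrow> 'b) \<Rightarrow> (real \<Rightarrow> 'b measure) \<Rightarrow> bool" where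
  "conditional_law M N c f K \<longleftrightarrow>
     (\<forall>D\<in>sets borel. \<forall>B\<in>sets N.
        emeasure M {\<omega> \<in> space M. c \<omega> \<in> D \<and> f \<omega> \<in> B} =
        (\<integral>\<^sup>+x. emeasure (K x) B * indicator D x \<partial>distr M borel c))"

text \<open>The hierarchical prior \<open>c \<sim> Exp(1)\<close>, \<open>f | c \<sim> N(0, prior_covariance c)\<close>.\<close>

definition hierarchical_prior ::
    "nat \<Rightarrow> nat pair_pre_digraph \<Rightarrow> real \<Rightarrow> real \<Rightarrow>
      'w measure \<Rightarrow> ('w \<Rightarrow> real) \<Rightarrow> ('w \<Rightarrow> nat \<Rightarrow> real) \<Rightarrow> bool" where
  "hierarchical_prior n G r \<alpha> M c f \<longleftrightarrow>
     c \<in> borel_measurable M \<and> f \<in> M \<rightarrow>\<^sub>M Rn n \<and>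
     distributed M lborel c (exponential_density 1) \<and>
     conditional_law M (Rn n) c f (\<lambda>x. centered_gaussian n (prior_covariance n G r \<alpha> x))"

text \<open>
  Covering number by open balls with arbitrary centres; \<open>\<infinity>\<close> if there is no finite cover. The
  extended logarithm avoids the junk value \<open>ln 0 = 0\<close>.
\<close>

definition ball_n :: "nat \<Rightarrow> (nat \<Rightarrow> real) \<Rightarrow> real \<Rightarrow> (nat \<Rightarrow> real) set" where
  "ball_n n g \<epsilon> = {h \<in> space (Rn n). norm_n n (\<lambda>i. h i - g i) < \<epsilon>}"

definition covering_number :: "nat \<Rightarrow> real \<Rightarrow> (nat \<Rightarrow> real) set \<Rightarrow> enat" where
  "covering_number n \<epsilon> B =
     (INF T\<in>{T. finite T \<and> T \<subseteq> space (Rn n) \<and> B \<subseteq> (\<Union>g\<in>T. ball_n n g \<epsilon>)}. enat (card T))"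

definition ln_enat :: "enat \<Rightarrow> ereal" where
  "ln_enat N = (case N of enat k \<Rightarrow> if k = 0 then - \<infinity> else ereal (ln (real k)) | \<infinity> \<Rightarrow> \<infinity>)"

text \<open>
  "A multiple of \<open>n\<^sup>-\<^sup>\<beta>\<^sup>/\<^sup>(\<^sup>2\<^sup>\<beta>\<^sup>+\<^sup>r\<^sup>)\<close>" is a constant times \<open>rate r \<beta> n\<close>. The bounds on \<open>P(\<parallel>f - f\<^sub>0\<parallel> < \<epsilon>\<^sub>n)\<close> and
  \<open>P(f \<notin> B\<^sub>n)\<close> can use one multiple for all \<open>K\<^sub>2\<close>, but the multiple in the entropy bound must grow
  with \<open>K\<^sub>2\<close>: with a common multiple, the two bounds on \<open>B\<^sub>n\<close> contradict each other for large \<open>K\<^sub>2\<close>.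
\<close>

definition rate :: "real \<Rightarrow> real \<Rightarrow> nat \<Rightarrow> real" where
  "rate r \<beta> n = real n powr (- \<beta> / (2 * \<beta> + r))"

end

theory Submission
  imports Defs "HOL-Real_Asymp.Real_Asymp"
begin

text \<open>
  Write \<open>x\<^sub>j = n powr (2/r) * \<lambda>\<^sub>j\<close>, \<open>p = \<alpha> + r/2\<close>, \<open>q = 2 * p / r > 1\<close> and \<open>J = n powr (r / (2 * \<beta> + r))\<close>,
  so that \<open>n \<epsilon>\<^sub>n\<^sup>2\<close> is a multiple of \<open>J\<close>. By rotation invariance, given \<open>c\<close> the coefficients of \<open>f\<close> in an
  orthonormal eigenbasis of the Laplacian are independent \<open>N(0, s\<^sub>j\<^sup>2)\<close> with
  \<open>s\<^sub>j\<^sup>2 = c powr q * (x\<^sub>j + \<delta>) powr (- p)\<close> and \<open>\<delta> = n powr (2/r - 2) \<le> 1\<close>. Call \<open>j\<close> low if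
  \<open>x\<^sub>j \<le> J powr (2/r)\<close>. The geometry condition enters only through \<open>x\<^sub>j \<ge> \<kappa> * j powr (2/r)\<close>, which bounds
  the number of low \<open>j\<close> by a multiple of \<open>J\<close>, the sum of \<open>s\<^sub>j\<^sup>2\<close> over the other \<open>j\<close> by a multiple of
  \<open>(c/J) powr q * J\<close>, and the sum of \<open>ln (1 + 2 * s\<^sub>j)\<close> over low \<open>j\<close> by a multiple of \<open>J\<close> if \<open>c\<close> is of order \<open>J\<close>.

  For the small ball, restrict to \<open>J < c \<le> 2 * J\<close>, an event of probability at least \<open>exp (- 2 * J)\<close>, and ask
  that each low coefficient is within \<open>1\<close> of that of \<open>f\<^sub>0\<close> and that the sum of squares of the high ones is
  at most twice a bound for its mean. For the other two claims, values \<open>c > T * J\<close> are negligible, and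
  \<open>B\<^sub>n\<close> is the set where the sum of \<open>\<bar>f\<^sub>j\<bar> / s\<^sub>j(T * J)\<close> over low \<open>j\<close> and the sum of \<open>f\<^sub>j\<^sup>2\<close> over high \<open>j\<close> are
  at most \<open>Q * J\<close>. Its complement is controlled by Chernoff's inequality. Rounding the low coefficients
  to integers covers \<open>B\<^sub>n\<close>, and the integer points of a weighted \<open>l\<^sup>1\<close> ball are counted by an exponential
  moment.
\<close>

section \<open>Rotation invariance of the standard Gaussian law\<close>

text \<open>The cut at \<open>J powr (2/r)\<close> is where the prior standard deviation for
  \<open>c\<close> of order \<open>J\<close> passes through order 1: high coefficients have
  \<open>s\<^sub>j\<^sup>2 \<le> (c/J) powr q\<close>, low ones are bounded away from 0. An error of
  1 in each low coefficient costs a multiple of \<open>J\<close>, and \<open>J\<close> balances this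
  against the high part of \<open>f\<^sub>0\<close>, whose sum of squares is at most
  \<open>n * J powr (- 2 * \<beta> / r) * C\<^sup>2 = C\<^sup>2 * J\<close>. Centring the Gaussian
  at \<open>f\<^sub>0\<close> costs the sum of
  \<open>f\<^sub>0\<^sub>j\<^sup>2 / s\<^sub>j\<^sup>2\<close> over low \<open>j\<close>. Here
  \<open>s\<^sub>j\<^sup>-\<^sup>2\<close> grows like the power \<open>p\<close> of
  \<open>x\<^sub>j\<close>, while \<open>f\<^sub>0\<close> is controlled with the power
  \<open>\<beta>\<close>; on low \<open>j\<close> the condition \<open>\<beta> \<le> p\<close>
  brings this cost down to a multiple of \<open>J\<close>. The obstacle is the logarithm: bounding
  each \<open>ln (1 + 2 * s\<^sub>j)\<close> by a multiple of \<open>ln n\<close> would yield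
  \<open>J * ln n\<close>. Where the geometry condition applies, the logarithm is dominated by a
  multiple of \<open>1 + sqrt (J / j)\<close>, whose sum is of order \<open>J\<close>. For the
  boundedly many smaller \<open>j\<close> the shift by \<open>n\<^sup>-\<^sup>2 I\<close> keeps
  \<open>s\<^sub>j\<close> polynomial in \<open>n\<close>, and \<open>ln n \<le> J\<close> for large
  \<open>n\<close>.\<close>

abbreviation std_normal :: "real measure" where
  "std_normal \<equiv> density lborel (\<lambda>x. ennreal (std_normal_density x))"

abbreviation std_normal_PiM :: "nat \<Rightarrow> (nat \<Rightarrow> real) measure" where
  "std_normal_PiM n \<equiv> Pi\<^sub>M {..<n} (\<lambda>_. std_normal)"

text \<open>One-dimensional affine substitutions suffice: for fixed \<open>t\<close> put
  \<open>v = a * t + b * s\<close>, exchange the integrals, then for fixed \<open>v\<close>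
  substitute \<open>s = (t - a * v) / b\<close>. The two factors \<open>\<bar>b\<bar>\<close>
  cancel.\<close>

lemma nn_integral_plane_reflection_lborel:
  fixes g :: "real \<Rightarrow> real \<Rightarrow> ennreal"
  assumes [measurable]: "(\<lambda>(x, y). g x y) \<in> borel_measurable (borel \<Otimes>\<^sub>M borel)"
    and b: "b \<noteq> 0" and ab: "a\<^sup>2 + b\<^sup>2 = 1"
  shows "(\<integral>\<^sup>+t. \<integral>\<^sup>+s. g (a * t + b * s) (b * t - a * s) \<partial>lborel \<partial>lborel)
       = (\<integral>\<^sup>+t. \<integral>\<^sup>+s. g t s \<partial>lborel \<partial>lborel)" (is "?L = ?R")
proof -
  have g3: "(\<lambda>x. g (u x) (v x)) \<in> borel_measurable N"
    if "u \<in> borel_measurable N" "v \<in> borel_measurable N" for u v and N :: "(real \<times> real) measure"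
    using measurable_compose[OF measurable_Pair[OF that] assms(1)] by simp
  have g4: "(\<lambda>x. g (u x) (v x)) \<in> borel_measurable N"
    if "u \<in> borel_measurable N" "v \<in> borel_measurable N" for u v and N :: "real measure"
    using measurable_compose[OF measurable_Pair[OF that] assms(1)] by simp
  have inner: "ennreal \<bar>b\<bar> * (\<integral>\<^sup>+s. g (a * t + b * s) (b * t - a * s) \<partial>lborel)
      = (\<integral>\<^sup>+v. g v ((t - a * v) / b) \<partial>lborel)" for t
  proof -
    have "(t - a * (a * t + b * s)) / b = b * t - a * s" for s
    proof -
      have "t - a * (a * t + b * s) = t * (1 - a\<^sup>2) - a * b * s"
        by (simp add: algebra_simps power2_eq_square)
      also have "1 - a\<^sup>2 = b\<^sup>2" using ab by simp
      finally show ?thesis using b by (simp add: field_simps power2_eq_square)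
    qed
    moreover have "(\<lambda>v. g v ((t - a * v) / b)) \<in> borel_measurable borel"
      by (rule g4) measurable
    ultimately show ?thesis
      using nn_integral_real_affine[of "\<lambda>v. g v ((t - a * v) / b)" b "a * t"] b by simp
  qed
  have outer: "(\<integral>\<^sup>+t. g v ((t - a * v) / b) \<partial>lborel) = ennreal \<bar>b\<bar> * (\<integral>\<^sup>+s. g v s \<partial>lborel)" for v
  proof -
    have m: "(\<lambda>t. g v ((t - a * v) / b)) \<in> borel_measurable borel"
      by (rule g4) measurable
    show ?thesis
      using nn_integral_real_affine[OF m b, of "a * v"] b by simp
  qed
  have "ennreal \<bar>b\<bar> * ?L = (\<integral>\<^sup>+t. ennreal \<bar>b\<bar> * (\<integral>\<^sup>+s. g (a * t + b * s) (b * t - a * s) \<partial>lborel) \<partial>lborel)"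
    by (subst nn_integral_cmult) (auto intro!: lborel.borel_measurable_nn_integral simp: split_beta' intro: g3)
  also have "\<dots> = (\<integral>\<^sup>+t. (\<integral>\<^sup>+v. g v ((t - a * v) / b) \<partial>lborel) \<partial>lborel)"
    by (simp add: inner)
  also have "\<dots> = (\<integral>\<^sup>+v. (\<integral>\<^sup>+t. g v ((t - a * v) / b) \<partial>lborel) \<partial>lborel)"
    by (rule lborel_pair.Fubini') (auto simp: split_beta' intro!: g3)
  also have "\<dots> = (\<integral>\<^sup>+v. ennreal \<bar>b\<bar> * (\<integral>\<^sup>+s. g v s \<partial>lborel) \<partial>lborel)"
    by (simp add: outer)
  also have "\<dots> = ennreal \<bar>b\<bar> * ?R"
    by (subst nn_integral_cmult) (auto intro!: lborel.borel_measurable_nn_integral simp: split_beta' intro: g3)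
  finally show ?thesis
    using b by (simp add: ennreal_mult_cancel_left)
qed

text \<open>The product density depends only on \<open>t\<^sup>2 + s\<^sup>2\<close>, which the
  reflection preserves, so it can be absorbed into the integrand of the Lebesgue version.\<close>

lemma nn_integral_plane_reflection_std_normal:
  fixes h :: "real \<Rightarrow> real \<Rightarrow> ennreal"
  assumes [measurable]: "(\<lambda>(x, y). h x y) \<in> borel_measurable (borel \<Otimes>\<^sub>M borel)"
    and b: "b \<noteq> 0" and ab: "a\<^sup>2 + b\<^sup>2 = 1"
  shows "(\<integral>\<^sup>+t. \<integral>\<^sup>+s. h (a * t + b * s) (b * t - a * s) \<partial>std_normal \<partial>std_normal)
       = (\<integral>\<^sup>+t. \<integral>\<^sup>+s. h t s \<partial>std_normal \<partial>std_normal)"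
proof -
  let ?\<phi> = "\<lambda>x. ennreal (std_normal_density x)"
  have h2: "(\<lambda>x. h (u x) (v x)) \<in> borel_measurable N"
    if "u \<in> borel_measurable N" "v \<in> borel_measurable N" for u v and N :: "(real \<times> real) measure"
    using measurable_compose[OF measurable_Pair[OF that] assms(1)] by simp
  have dens: "(\<integral>\<^sup>+t. \<integral>\<^sup>+s. k t s \<partial>std_normal \<partial>std_normal)
     = (\<integral>\<^sup>+t. \<integral>\<^sup>+s. ?\<phi> t * ?\<phi> s * k t s \<partial>lborel \<partial>lborel)"
    if k: "(\<lambda>(x, y). k x y) \<in> borel_measurable (borel \<Otimes>\<^sub>M borel)" for k :: "real \<Rightarrow> real \<Rightarrow> ennreal"
  proof -
    have k1[measurable]: "(\<lambda>x. k (u x) (v x)) \<in> borel_measurable N"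
      if "u \<in> borel_measurable N" "v \<in> borel_measurable N" for u v and N :: "real measure"
      using measurable_compose[OF measurable_Pair[OF that] k] by simp
    have k2[measurable]: "(\<lambda>x. k (u x) (v x)) \<in> borel_measurable N"
      if "u \<in> borel_measurable N" "v \<in> borel_measurable N" for u v and N :: "(real \<times> real) measure"
      using measurable_compose[OF measurable_Pair[OF that] k] by simp
    have "(\<integral>\<^sup>+t. \<integral>\<^sup>+s. k t s \<partial>std_normal \<partial>std_normal)
       = (\<integral>\<^sup>+t. ?\<phi> t * (\<integral>\<^sup>+s. ?\<phi> s * k t s \<partial>lborel) \<partial>lborel)"
      by (subst nn_integral_density)
         (auto simp: nn_integral_density split_beta' intro!: nn_integral_cong lborel.borel_measurable_nn_integral)
    also have "\<dots> = (\<integral>\<^sup>+t. \<integral>\<^sup>+s. ?\<phi> t * ?\<phi> s * k t s \<partial>lborel \<partial>lborel)"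
      by (intro nn_integral_cong) (simp add: nn_integral_cmult mult.assoc)
    finally show ?thesis .
  qed
  have norm: "(a * t + b * s)\<^sup>2 + (b * t - a * s)\<^sup>2 = t\<^sup>2 + s\<^sup>2" for t s
  proof -
    have "(a * t + b * s)\<^sup>2 + (b * t - a * s)\<^sup>2 = (a\<^sup>2 + b\<^sup>2) * (t\<^sup>2 + s\<^sup>2)"
      by (simp add: algebra_simps power2_eq_square)
    then show ?thesis using ab by simp
  qed
  have \<phi>: "?\<phi> (a * t + b * s) * ?\<phi> (b * t - a * s) = ?\<phi> t * ?\<phi> s" for t s
  proof -
    have "std_normal_density x * std_normal_density y = exp (- (x\<^sup>2 + y\<^sup>2) / 2) / (2 * pi)" for x y
      by (simp add: std_normal_density_def mult_exp_exp add_divide_distrib)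
    then show ?thesis
      using norm[of t s] by (simp add: ennreal_mult[symmetric])
  qed
  have m: "(\<lambda>(x, y). ?\<phi> x * ?\<phi> y * h x y) \<in> borel_measurable (borel \<Otimes>\<^sub>M borel)"
    by measurable
  have "(\<integral>\<^sup>+t. \<integral>\<^sup>+s. h (a * t + b * s) (b * t - a * s) \<partial>std_normal \<partial>std_normal)
     = (\<integral>\<^sup>+t. \<integral>\<^sup>+s. ?\<phi> t * ?\<phi> s * h (a * t + b * s) (b * t - a * s) \<partial>lborel \<partial>lborel)"
    by (rule dens) (auto simp: split_beta' intro!: h2)
  also have "\<dots> = (\<integral>\<^sup>+t. \<integral>\<^sup>+s. ?\<phi> t * ?\<phi> s * h t s \<partial>lborel \<partial>lborel)"
    using nn_integral_plane_reflection_lborel[OF m b ab] by (simp add: \<phi>)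
  also have "\<dots> = (\<integral>\<^sup>+t. \<integral>\<^sup>+s. h t s \<partial>std_normal \<partial>std_normal)"
    by (rule dens[symmetric]) (rule assms(1))
  finally show ?thesis .
qed

section \<open>Coordinate-plane reflections and sign flips of the product law\<close>

interpretation std_normal: prob_space std_normal
  by (rule prob_space_normal_density) simp

interpretation std_normal_PiM: product_prob_space "\<lambda>_. std_normal" I for I :: "nat set"
  by standard

lemma sets_std_normal_PiM: "sets (Pi\<^sub>M I (\<lambda>_. std_normal)) = sets (Pi\<^sub>M I (\<lambda>_. borel))"
  by (rule sets_PiM_cong) auto

text \<open>The matrix with rows \<open>(a, b)\<close> and \<open>(b, - a)\<close>. For
  \<open>a\<^sup>2 + b\<^sup>2 = 1\<close> it is a reflection, not a rotation, and therefore its own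
  inverse.\<close>

definition plane_reflection :: "real \<Rightarrow> real \<Rightarrow> nat \<Rightarrow> nat \<Rightarrow> (nat \<Rightarrow> real) \<Rightarrow> nat \<Rightarrow> real" where
  "plane_reflection a b k m x = x(k := a * x k + b * x m, m := b * x k - a * x m)"

lemma measurable_plane_reflection:
  assumes "k \<in> I" "m \<in> I"
  shows "plane_reflection a b k m \<in> Pi\<^sub>M I (\<lambda>_. borel) \<rightarrow>\<^sub>M Pi\<^sub>M I (\<lambda>_. borel)"
proof (rule measurable_PiM_single')
  fix i assume i: "i \<in> I"
  have "(\<lambda>x. plane_reflection a b k m x i) =
    (if i = m then (\<lambda>x. b * x k - a * x m) else if i = k then (\<lambda>x. a * x k + b * x m) else (\<lambda>x. x i))"
    by (auto simp: plane_reflection_def)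
  also have "\<dots> \<in> borel_measurable (Pi\<^sub>M I (\<lambda>_. borel))"
    using assms i by auto
  finally show "(\<lambda>x. plane_reflection a b k m x i) \<in> borel_measurable (Pi\<^sub>M I (\<lambda>_. borel))" .
qed (use assms in \<open>auto simp: plane_reflection_def space_PiM PiE_def extensional_def\<close>)

lemma nn_integral_plane_reflection:
  assumes I: "finite I" and km: "k \<in> I" "m \<in> I" "k \<noteq> m" and b: "b \<noteq> 0" and ab: "a\<^sup>2 + b\<^sup>2 = 1"
    and F[measurable]: "F \<in> borel_measurable (Pi\<^sub>M I (\<lambda>_. std_normal))"
  shows "(\<integral>\<^sup>+x. F (plane_reflection a b k m x) \<partial>Pi\<^sub>M I (\<lambda>_. std_normal))
       = (\<integral>\<^sup>+x. F x \<partial>Pi\<^sub>M I (\<lambda>_. std_normal))"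
proof -
  define I' where "I' = I - {k, m}"
  have I_eq: "I = insert k (insert m I')" and I': "finite I'" "k \<notin> insert m I'" "m \<notin> I'"
    using I km by (auto simp: I'_def)
  have two: "(\<integral>\<^sup>+x. H x \<partial>Pi\<^sub>M I (\<lambda>_. std_normal))
     = (\<integral>\<^sup>+x. \<integral>\<^sup>+s. \<integral>\<^sup>+t. H (x(m := s, k := t)) \<partial>std_normal \<partial>std_normal \<partial>Pi\<^sub>M I' (\<lambda>_. std_normal))"
    if H: "H \<in> borel_measurable (Pi\<^sub>M I (\<lambda>_. std_normal))" for H :: "_ \<Rightarrow> ennreal"
  proof -
    have H': "H \<in> borel_measurable (Pi\<^sub>M (insert k (insert m I')) (\<lambda>_. std_normal))"
      using H I_eq by simp
    have "(\<lambda>x. \<integral>\<^sup>+t. H (x(k := t)) \<partial>std_normal) \<in> borel_measurable (Pi\<^sub>M (insert m I') (\<lambda>_. std_normal))"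
      using H' by measurable
    then show ?thesis
      unfolding I_eq
      using I' H' by (simp add: std_normal_PiM.product_nn_integral_insert)
  qed
  have R: "plane_reflection a b k m \<in> Pi\<^sub>M I (\<lambda>_. std_normal) \<rightarrow>\<^sub>M Pi\<^sub>M I (\<lambda>_. std_normal)"
    using measurable_plane_reflection[OF km(1,2)]
    by (simp add: measurable_cong_sets[OF sets_std_normal_PiM sets_std_normal_PiM])
  have FR: "(\<lambda>x. F (plane_reflection a b k m x)) \<in> borel_measurable (Pi\<^sub>M I (\<lambda>_. std_normal))"
    using measurable_compose[OF R F] .
  have inner: "(\<integral>\<^sup>+s. \<integral>\<^sup>+t. F (plane_reflection a b k m (x(m := s, k := t))) \<partial>std_normal \<partial>std_normal)
      = (\<integral>\<^sup>+s. \<integral>\<^sup>+t. F (x(m := s, k := t)) \<partial>std_normal \<partial>std_normal)"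
    if x: "x \<in> space (Pi\<^sub>M I' (\<lambda>_. std_normal))" for x
  proof -
    have "(\<lambda>p. x(m := fst p, k := snd p)) \<in> borel \<Otimes>\<^sub>M borel \<rightarrow>\<^sub>M Pi\<^sub>M I (\<lambda>_. borel)"
    proof (rule measurable_PiM_single')
      fix i assume "i \<in> I"
      show "(\<lambda>p. (x(m := fst p, k := snd p)) i) \<in> borel_measurable (borel \<Otimes>\<^sub>M borel)"
        by (cases "i = k"; cases "i = m") auto
    qed (use x in \<open>auto simp: I_eq space_PiM PiE_def extensional_def\<close>)
    then have "(\<lambda>p. x(m := fst p, k := snd p)) \<in> borel \<Otimes>\<^sub>M borel \<rightarrow>\<^sub>M Pi\<^sub>M I (\<lambda>_. std_normal)"
      by (simp add: measurable_cong_sets[OF refl sets_std_normal_PiM])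
    from measurable_compose[OF this F]
    have "(\<lambda>(s, t). F (x(m := s, k := t))) \<in> borel_measurable (borel \<Otimes>\<^sub>M borel)"
      by (simp add: split_beta')
    \<comment> \<open>The outer variable \<open>s\<close> sits in coordinate \<open>m\<close> and
      the inner one in coordinate \<open>k\<close>; with the roles exchanged, the planar map has
      parameter \<open>- a\<close>.\<close>
    from nn_integral_plane_reflection_std_normal[OF this b, of "- a"] ab
    have "(\<integral>\<^sup>+s. \<integral>\<^sup>+t. F (x(m := - a * s + b * t, k := b * s - - a * t)) \<partial>std_normal \<partial>std_normal)
      = (\<integral>\<^sup>+s. \<integral>\<^sup>+t. F (x(m := s, k := t)) \<partial>std_normal \<partial>std_normal)"
      by simp
    moreover have "plane_reflection a b k m (x(m := s, k := t)) = x(m := - a * s + b * t, k := b * s - - a * t)" for s t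
      using km(3) by (auto simp: plane_reflection_def fun_eq_iff)
    ultimately show ?thesis by simp
  qed
  show ?thesis
    unfolding two[OF FR] two[OF F] by (rule nn_integral_cong) (rule inner)
qed

lemma distr_plane_reflection:
  assumes "finite I" "k \<in> I" "m \<in> I" "k \<noteq> m" "b \<noteq> 0" "a\<^sup>2 + b\<^sup>2 = 1"
  shows "distr (Pi\<^sub>M I (\<lambda>_. std_normal)) (Pi\<^sub>M I (\<lambda>_. std_normal)) (plane_reflection a b k m)
       = Pi\<^sub>M I (\<lambda>_. std_normal)"
proof (rule measure_eqI)
  fix A assume "A \<in> sets (distr (Pi\<^sub>M I (\<lambda>_. std_normal)) (Pi\<^sub>M I (\<lambda>_. std_normal)) (plane_reflection a b k m))"
  then have A: "A \<in> sets (Pi\<^sub>M I (\<lambda>_. std_normal))" by simp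
  have R: "plane_reflection a b k m \<in> Pi\<^sub>M I (\<lambda>_. std_normal) \<rightarrow>\<^sub>M Pi\<^sub>M I (\<lambda>_. std_normal)"
    using measurable_plane_reflection[OF assms(2,3)]
    by (simp add: measurable_cong_sets[OF sets_std_normal_PiM sets_std_normal_PiM])
  have "emeasure (distr (Pi\<^sub>M I (\<lambda>_. std_normal)) (Pi\<^sub>M I (\<lambda>_. std_normal)) (plane_reflection a b k m)) A
     = (\<integral>\<^sup>+x. indicator A (plane_reflection a b k m x) \<partial>Pi\<^sub>M I (\<lambda>_. std_normal))"
    using A R by (simp flip: nn_integral_indicator add: nn_integral_distr)
  also have "\<dots> = emeasure (Pi\<^sub>M I (\<lambda>_. std_normal)) A"
    using nn_integral_plane_reflection[OF assms, of "indicator A"] A by simp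
  finally show "emeasure (distr (Pi\<^sub>M I (\<lambda>_. std_normal)) (Pi\<^sub>M I (\<lambda>_. std_normal)) (plane_reflection a b k m)) A
     = emeasure (Pi\<^sub>M I (\<lambda>_. std_normal)) A" .
qed simp

lemma nn_integral_std_normal_uminus:
  assumes [measurable]: "f \<in> borel_measurable borel"
  shows "(\<integral>\<^sup>+x. f (- x) \<partial>std_normal) = (\<integral>\<^sup>+x. f x \<partial>std_normal)"
proof -
  have "(\<integral>\<^sup>+x. f x \<partial>std_normal) = (\<integral>\<^sup>+x. ennreal (std_normal_density x) * f x \<partial>lborel)"
    by (simp add: nn_integral_density)
  also have "\<dots> = (\<integral>\<^sup>+x. ennreal (std_normal_density x) * f (- x) \<partial>lborel)"
    by (subst nn_integral_real_affine[where c = "-1" and t = 0]) (auto simp: std_normal_density_def)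
  also have "\<dots> = (\<integral>\<^sup>+x. f (- x) \<partial>std_normal)"
    by (simp add: nn_integral_density)
  finally show ?thesis by simp
qed

text \<open>In the reduction below a column can end as minus a unit vector, where the plane
  reflection would have \<open>b = 0\<close>. The flip corrects this sign, by the symmetry of the
  one-dimensional normal law.\<close>

lemma distr_sign_flip:
  fixes I :: "nat set"
  assumes I: "finite I" and k: "k \<in> I"
  shows "distr (Pi\<^sub>M I (\<lambda>_. std_normal)) (Pi\<^sub>M I (\<lambda>_. std_normal)) (\<lambda>x. x(k := - x k))
       = Pi\<^sub>M I (\<lambda>_. std_normal)" (is "distr ?P ?P ?f = _")
proof (rule measure_eqI)
  define I' where "I' = I - {k}"
  have I_eq: "I = insert k I'" and I': "finite I'" "k \<notin> I'"
    using I k by (auto simp: I'_def)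
  have f: "?f \<in> ?P \<rightarrow>\<^sub>M ?P"
  proof (rule measurable_PiM_single')
    fix i assume "i \<in> I"
    then show "(\<lambda>x. (?f x) i) \<in> ?P \<rightarrow>\<^sub>M std_normal"
      using k by (cases "i = k") (auto intro: measurable_component_singleton)
  qed (use k in \<open>auto simp: space_PiM PiE_def extensional_def\<close>)
  fix A assume "A \<in> sets (distr ?P ?P ?f)"
  then have A: "A \<in> sets ?P" by simp
  have one: "(\<integral>\<^sup>+x. H x \<partial>?P) = (\<integral>\<^sup>+x. \<integral>\<^sup>+t. H (x(k := t)) \<partial>std_normal \<partial>Pi\<^sub>M I' (\<lambda>_. std_normal))"
    if "H \<in> borel_measurable ?P" for H :: "_ \<Rightarrow> ennreal"
    using that I' unfolding I_eq by (simp add: std_normal_PiM.product_nn_integral_insert)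
  have iA: "indicator A \<in> borel_measurable ?P" using A by simp
  have "emeasure (distr ?P ?P ?f) A = (\<integral>\<^sup>+x. indicator A (?f x) \<partial>?P)"
    using A f by (simp flip: nn_integral_indicator add: nn_integral_distr)
  also have "\<dots> = (\<integral>\<^sup>+x. \<integral>\<^sup>+t. indicator A (x(k := - t)) \<partial>std_normal \<partial>Pi\<^sub>M I' (\<lambda>_. std_normal))"
    using one[OF measurable_compose[OF f iA]] by simp
  also have "\<dots> = (\<integral>\<^sup>+x. \<integral>\<^sup>+t. indicator A (x(k := t)) \<partial>std_normal \<partial>Pi\<^sub>M I' (\<lambda>_. std_normal))"
  proof (rule nn_integral_cong)
    fix x assume x: "x \<in> space (Pi\<^sub>M I' (\<lambda>_. std_normal))"
    have "(\<lambda>t. x(k := t)) \<in> std_normal \<rightarrow>\<^sub>M ?P"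
      unfolding I_eq using x by measurable
    from measurable_compose[OF this iA]
    have "(\<lambda>t. indicator A (x(k := t)) :: ennreal) \<in> borel_measurable borel" by simp
    from nn_integral_std_normal_uminus[OF this]
    show "(\<integral>\<^sup>+t. indicator A (x(k := - t)) \<partial>std_normal) = (\<integral>\<^sup>+t. indicator A (x(k := t)) \<partial>std_normal)" .
  qed
  also have "\<dots> = emeasure ?P A"
    using one[OF iA] A by simp
  finally show "emeasure (distr ?P ?P ?f) A = emeasure ?P A" .
qed simp

lemma plane_reflection_involution:
  assumes "k \<noteq> m" "a\<^sup>2 + b\<^sup>2 = 1"
  shows "plane_reflection a b k m (plane_reflection a b k m x) = x"
proof -
  have "a * (a * s + b * t) + b * (b * s - a * t) = (a\<^sup>2 + b\<^sup>2) * s"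
    "b * (a * s + b * t) - a * (b * s - a * t) = (a\<^sup>2 + b\<^sup>2) * t" for s t
    by (simp_all add: algebra_simps power2_eq_square)
  then show ?thesis
    using assms by (auto simp: plane_reflection_def fun_eq_iff)
qed

lemma sum_plane_reflection_mult:
  fixes v w :: "nat \<Rightarrow> real"
  assumes "finite I" "k \<in> I" "m \<in> I" "k \<noteq> m" and ab: "a\<^sup>2 + b\<^sup>2 = 1"
  shows "(\<Sum>i\<in>I. plane_reflection a b k m v i * plane_reflection a b k m w i) = (\<Sum>i\<in>I. v i * w i)"
proof -
  define I' where "I' = I - {k, m}"
  have I_eq: "I = insert k (insert m I')" and I': "finite I'" "k \<notin> insert m I'" "m \<notin> I'"
    using assms by (auto simp: I'_def)
  have rest: "(\<Sum>i\<in>I'. plane_reflection a b k m v i * plane_reflection a b k m w i) = (\<Sum>i\<in>I'. v i * w i)"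
    using I' by (intro sum.cong) (auto simp: plane_reflection_def)
  have "(a * v k + b * v m) * (a * w k + b * w m) + (b * v k - a * v m) * (b * w k - a * w m)
     = (a\<^sup>2 + b\<^sup>2) * (v k * w k + v m * w m)"
    by (simp add: algebra_simps power2_eq_square)
  then show ?thesis
    unfolding I_eq using I' ab by (simp add: rest) (simp add: plane_reflection_def)
qed

text \<open>The restriction makes the image extensional, as the points of a product space over
  \<open>{..<n}\<close> must be. With \<open>\<lambda>i j. u j i\<close> in place of
  \<open>u\<close> it is the transposed map, which gives the coefficients with respect to the
  columns of \<open>u\<close>.\<close>

definition lin_map :: "nat \<Rightarrow> (nat \<Rightarrow> nat \<Rightarrow> real) \<Rightarrow> (nat \<Rightarrow> real) \<Rightarrow> nat \<Rightarrow> real" where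
  "lin_map n u x = (\<lambda>i\<in>{..<n}. \<Sum>j<n. u i j * x j)"

lemma measurable_lin_map: "lin_map n u \<in> Pi\<^sub>M {..<n} (\<lambda>_. borel) \<rightarrow>\<^sub>M Pi\<^sub>M {..<n} (\<lambda>_. borel)"
proof (rule measurable_PiM_single')
  fix i assume "i \<in> {..<n}"
  then show "(\<lambda>x. lin_map n u x i) \<in> borel_measurable (Pi\<^sub>M {..<n} (\<lambda>_. borel))"
    by (auto simp: lin_map_def intro!: borel_measurable_sum borel_measurable_times)
qed (auto simp: lin_map_def space_PiM)

lemma measurable_lin_map_std_normal: "lin_map n u \<in> std_normal_PiM n \<rightarrow>\<^sub>M std_normal_PiM n"
  using measurable_lin_map by (simp add: measurable_cong_sets[OF sets_std_normal_PiM sets_std_normal_PiM])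

lemma plane_reflection_lin_map:
  assumes "k < n" "m < n" "k \<noteq> m"
  shows "plane_reflection a b k m (lin_map n u x)
       = lin_map n (\<lambda>i j. plane_reflection a b k m (\<lambda>i. u i j) i) x"
  using assms
  by (auto simp: fun_eq_iff plane_reflection_def lin_map_def sum_distrib_left sum.distrib
      sum_subtractf algebra_simps restrict_def)

definition orthonormal_cols :: "nat \<Rightarrow> (nat \<Rightarrow> nat \<Rightarrow> real) \<Rightarrow> bool" where
  "orthonormal_cols n u \<longleftrightarrow> (\<forall>j<n. \<forall>l<n. (\<Sum>i<n. u i j * u i l) = of_bool (j = l))"

lemma distr_lin_map_id:
  assumes "\<And>i j. i < n \<Longrightarrow> j < n \<Longrightarrow> u i j = of_bool (i = j)"
  shows "distr (std_normal_PiM n) (std_normal_PiM n) (lin_map n u) = std_normal_PiM n"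
proof -
  have "lin_map n u x = x" if "x \<in> space (std_normal_PiM n)" for x
  proof
    fix i
    show "lin_map n u x i = x i"
    proof (cases "i < n")
      case True
      then have "(\<Sum>j<n. u i j * x j) = (\<Sum>j<n. if i = j then x j else 0)"
        using assms by (intro sum.cong) auto
      then show ?thesis using True by (simp add: lin_map_def)
    qed (use that in \<open>auto simp: lin_map_def space_PiM PiE_def extensional_def\<close>)
  qed
  then have "distr (std_normal_PiM n) (std_normal_PiM n) (lin_map n u)
      = distr (std_normal_PiM n) (std_normal_PiM n) (\<lambda>x. x)"
    by (intro distr_cong) auto
  then show ?thesis by simp
qed

text \<open>
  An orthogonal matrix is turned into the identity by reflections of coordinate planes, which
  clear one entry below the diagonal each, and by changes of sign.
\<close>

lemma distr_lin_map_orthonormal_step: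
  assumes "orthonormal_cols n u" "k < n"
    and "\<And>i j. i < n \<Longrightarrow> j < k \<Longrightarrow> u i j = of_bool (i = j)"
    and nxt: "\<And>u. orthonormal_cols n u \<Longrightarrow>
      (\<And>i j. i < n \<Longrightarrow> j < Suc k \<Longrightarrow> u i j = of_bool (i = j)) \<Longrightarrow>
      distr (std_normal_PiM n) (std_normal_PiM n) (lin_map n u) = std_normal_PiM n"
  shows "distr (std_normal_PiM n) (std_normal_PiM n) (lin_map n u) = std_normal_PiM n"
  using assms(1,3)
\<comment> \<open>The measure counts the entries of column \<open>k\<close> below the diagonal that
  are still to be cleared.\<close>
proof (induction "card {i. k < i \<and> i < n \<and> u i k \<noteq> 0}" arbitrary: u rule: less_induct)
  case less
  let ?P = "std_normal_PiM n"
  have orth: "(\<Sum>i<n. u i j * u i l) = of_bool (j = l)" if "j < n" "l < n" for j l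
    using less.prems(1) that by (simp add: orthonormal_cols_def)
  \<comment> \<open>Column \<open>k\<close> is orthogonal to the earlier columns, which are unit
    vectors already.\<close>
  have above: "u i k = 0" if "i < k" for i
  proof -
    have "0 = (\<Sum>i'<n. u i' i * u i' k)"
      using orth[of i k] that \<open>k < n\<close> by simp
    also have "\<dots> = (\<Sum>i'<n. if i' = i then u i' k else 0)"
      using less.prems(2) that \<open>k < n\<close> by (intro sum.cong) auto
    finally show ?thesis using that \<open>k < n\<close> by simp
  qed
  show ?case
  proof (cases "\<exists>m. k < m \<and> m < n \<and> u m k \<noteq> 0")
    case True
    then obtain m where m: "k < m" "m < n" "u m k \<noteq> 0" by blast
    \<comment> \<open>\<open>(a, b)\<close> is the direction of \<open>(u k k, u m k)\<close>, so
      the reflection sends this pair to \<open>(\<rho>, 0)\<close>.\<close>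
    define \<rho> where "\<rho> = sqrt ((u k k)\<^sup>2 + (u m k)\<^sup>2)"
    define a where "a = u k k / \<rho>"
    define b where "b = u m k / \<rho>"
    have \<rho>: "\<rho> > 0" "\<rho>\<^sup>2 = (u k k)\<^sup>2 + (u m k)\<^sup>2"
      using m by (auto simp: \<rho>_def add_nonneg_pos)
    have b: "b \<noteq> 0" using m \<rho> by (simp add: b_def)
    have ab: "a\<^sup>2 + b\<^sup>2 = 1"
    proof -
      have "a\<^sup>2 + b\<^sup>2 = ((u k k)\<^sup>2 + (u m k)\<^sup>2) / \<rho>\<^sup>2"
        by (simp add: a_def b_def power_divide add_divide_distrib)
      then show ?thesis using \<rho> by (metis divide_self less_numeral_extra(3) zero_less_power)
    qed
    let ?R = "plane_reflection a b k m"
    define u' where "u' = (\<lambda>i j. ?R (\<lambda>i. u i j) i)"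
    have orth': "orthonormal_cols n u'"
      using less.prems(1) sum_plane_reflection_mult[of "{..<n}" k m a b] m ab \<open>k < n\<close>
      by (simp add: orthonormal_cols_def u'_def)
    have id': "u' i j = of_bool (i = j)" if "i < n" "j < k" for i j
      using less.prems(2)[of _ j] that m \<open>k < n\<close> by (auto simp: u'_def plane_reflection_def)
    have "{i. k < i \<and> i < n \<and> u' i k \<noteq> 0} \<subset> {i. k < i \<and> i < n \<and> u i k \<noteq> 0}"
    proof
      have "u' m k = 0" using \<rho> by (simp add: u'_def plane_reflection_def a_def b_def)
      moreover have "u' i k = u i k" if "i \<noteq> m" "k < i" for i
        using that by (simp add: u'_def plane_reflection_def)
      ultimately show "{i. k < i \<and> i < n \<and> u' i k \<noteq> 0} \<subseteq> {i. k < i \<and> i < n \<and> u i k \<noteq> 0}"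
        using m by fastforce
      show "{i. k < i \<and> i < n \<and> u' i k \<noteq> 0} \<noteq> {i. k < i \<and> i < n \<and> u i k \<noteq> 0}"
        using m \<open>u' m k = 0\<close> by blast
    qed
    then have "card {i. k < i \<and> i < n \<and> u' i k \<noteq> 0} < card {i. k < i \<and> i < n \<and> u i k \<noteq> 0}"
      by (intro psubset_card_mono) auto
    from less.hyps[OF this orth' id']
    have IH: "distr ?P ?P (lin_map n u') = ?P" by simp
    have "lin_map n u = ?R \<circ> lin_map n u'"
      using m \<open>k < n\<close> ab plane_reflection_involution[of k m a b]
      by (auto simp: fun_eq_iff u'_def simp flip: plane_reflection_lin_map)
    moreover have "?R \<in> ?P \<rightarrow>\<^sub>M ?P"
      using measurable_plane_reflection[of k "{..<n}" m a b] m \<open>k < n\<close>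
      by (simp add: measurable_cong_sets[OF sets_std_normal_PiM sets_std_normal_PiM])
    ultimately have "distr ?P ?P (lin_map n u) = distr (distr ?P ?P (lin_map n u')) ?P ?R"
      using measurable_lin_map_std_normal by (simp add: distr_distr)
    also have "\<dots> = ?P"
      unfolding IH using m \<open>k < n\<close> b ab by (intro distr_plane_reflection) auto
    finally show ?thesis .
  next
    case False
    have col: "u i k = 0" if "i < n" "i \<noteq> k" for i
      using False above[of i] that by (meson linorder_neqE_nat)
    have "1 = (\<Sum>i<n. u i k * u i k)"
      using orth[of k k] \<open>k < n\<close> by simp
    also have "\<dots> = (\<Sum>i<n. if i = k then (u k k)\<^sup>2 else 0)"
      using col by (intro sum.cong) (auto simp: power2_eq_square)
    finally have "(u k k)\<^sup>2 = 1" using \<open>k < n\<close> by simp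
    then consider "u k k = 1" | "u k k = - 1" by (auto simp: power2_eq_1_iff)
    then show ?thesis
    proof cases
      case 1
      show ?thesis
        by (rule nxt[OF less.prems(1)]) (use 1 col less.prems(2) in \<open>auto simp: less_Suc_eq\<close>)
    next
      case 2
      define u' where "u' = (\<lambda>i j. if i = k then - u i j else u i j)"
      have "orthonormal_cols n u'"
      proof -
        have "(\<Sum>i<n. u' i j * u' i l) = (\<Sum>i<n. u i j * u i l)" for j l
          by (intro sum.cong) (auto simp: u'_def)
        then show ?thesis using less.prems(1) by (simp add: orthonormal_cols_def)
      qed
      then have IH: "distr ?P ?P (lin_map n u') = ?P"
        by (rule nxt) (use 2 col less.prems(2) \<open>k < n\<close> in \<open>auto simp: u'_def less_Suc_eq\<close>)
      have "lin_map n u = (\<lambda>x. x(k := - x k)) \<circ> lin_map n u'"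
        using \<open>k < n\<close> by (auto simp: fun_eq_iff u'_def lin_map_def sum_negf)
      moreover have "(\<lambda>x. x(k := - x k)) \<in> ?P \<rightarrow>\<^sub>M ?P"
      proof (rule measurable_PiM_single')
        fix i assume "i \<in> {..<n}"
        then show "(\<lambda>x. (x(k := - x k)) i) \<in> ?P \<rightarrow>\<^sub>M std_normal"
          using \<open>k < n\<close> by (cases "i = k") auto
      qed (use \<open>k < n\<close> in \<open>auto simp: space_PiM PiE_def extensional_def\<close>)
      ultimately have "distr ?P ?P (lin_map n u) = distr (distr ?P ?P (lin_map n u')) ?P (\<lambda>x. x(k := - x k))"
        using measurable_lin_map_std_normal by (simp add: distr_distr)
      also have "\<dots> = ?P"
        unfolding IH using \<open>k < n\<close> by (intro distr_sign_flip) auto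
      finally show ?thesis .
    qed
  qed
qed

text \<open>Downward induction on the number \<open>k\<close> of leading columns that are unit
  vectors: for \<open>k = n\<close> the map is the identity, and \<open>k = 0\<close> is no
  condition.\<close>

theorem distr_lin_map_orthonormal:
  assumes "orthonormal_cols n u"
  shows "distr (std_normal_PiM n) (std_normal_PiM n) (lin_map n u) = std_normal_PiM n"
proof -
  have "distr (std_normal_PiM n) (std_normal_PiM n) (lin_map n u) = std_normal_PiM n"
    if "orthonormal_cols n u" "\<And>i j. i < n \<Longrightarrow> j < k \<Longrightarrow> u i j = of_bool (i = j)" "k \<le> n" for k u
    using that(3,1,2)
  proof (induction k arbitrary: u rule: inc_induct)
    case base
    then show ?case by (intro distr_lin_map_id) auto
  next
    case (step k)
    show ?case
      by (rule distr_lin_map_orthonormal_step[OF step.prems(1) \<open>k < n\<close> step.prems(2) step.IH])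
  qed
  from this[of u 0] show ?thesis using assms by simp
qed

section \<open>The spectral theorem for real symmetric matrices\<close>

unbundle no vec_syntax

text \<open>With \<open>U\<close> and \<open>d\<close> as explicit arguments, all matrices built
  from the Laplacian are handled in one fixed eigenbasis \<open>U\<close>, by operating on
  \<open>d\<close> alone.\<close>

definition spectral_decomposition :: "nat \<Rightarrow> real mat \<Rightarrow> real mat \<Rightarrow> (nat \<Rightarrow> real) \<Rightarrow> bool" where
  "spectral_decomposition n A U d \<longleftrightarrow>
     U \<in> carrier_mat n n \<and> U * transpose_mat U = 1\<^sub>m n \<and> transpose_mat U * U = 1\<^sub>m n \<and>
     A = U * mat_diag n d * transpose_mat U"

text \<open>For an eigenvector \<open>v\<close> the Hermitian form \<open>Q\<close> of
  \<open>A\<close> at \<open>v\<close> is its own conjugate by symmetry, and it equals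
  \<open>k\<close> times the positive number \<open>S\<close>.\<close>

lemma eigenvalue_of_real_symmetric_is_real:
  fixes A :: "real mat"
  assumes A: "A \<in> carrier_mat n n" "transpose_mat A = A"
    and "eigenvalue (map_mat complex_of_real A) k"
  shows "k \<in> \<real>"
proof -
  let ?A = "map_mat complex_of_real A"
  obtain v where v: "v \<in> carrier_vec n" "v \<noteq> 0\<^sub>v n" "?A *\<^sub>v v = k \<cdot>\<^sub>v v"
    using assms by (auto simp: eigenvalue_def eigenvector_def)
  have sym: "A $$ (i, j) = A $$ (j, i)" if "i < n" "j < n" for i j
    using A that by (metis carrier_matD(1) carrier_matD(2) index_transpose_mat(1))
  have Av: "(\<Sum>j<n. complex_of_real (A $$ (i, j)) * v $ j) = k * v $ i" if "i < n" for i
  proof -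
    have "(?A *\<^sub>v v) $ i = k * v $ i" using v that by simp
    moreover have "(?A *\<^sub>v v) $ i = (\<Sum>j<n. complex_of_real (A $$ (i, j)) * v $ j)"
      using A(1) v(1) that by (auto simp: scalar_prod_def atLeast0LessThan intro!: sum.cong)
    ultimately show ?thesis by simp
  qed
  define Q where "Q = (\<Sum>i<n. \<Sum>j<n. cnj (v $ i) * (complex_of_real (A $$ (i, j)) * v $ j))"
  define S where "S = (\<Sum>i<n. (cmod (v $ i))\<^sup>2)"
  have "cnj Q = (\<Sum>i<n. \<Sum>j<n. cnj (v $ j) * (complex_of_real (A $$ (i, j)) * v $ i))"
    by (simp add: Q_def mult_ac)
  also have "\<dots> = (\<Sum>j<n. \<Sum>i<n. cnj (v $ j) * (complex_of_real (A $$ (i, j)) * v $ i))"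
    by (rule sum.swap)
  also have "\<dots> = Q"
    unfolding Q_def by (intro sum.cong) (auto simp: sym)
  finally have real: "Q \<in> \<real>" by (simp add: Reals_cnj_iff)
  have "Q = (\<Sum>i<n. cnj (v $ i) * (k * v $ i))"
    by (simp add: Q_def Av flip: sum_distrib_left)
  also have "\<dots> = k * of_real S"
    unfolding S_def by (simp add: sum_distrib_left complex_norm_square mult_ac del: of_real_power)
  finally have Q: "Q = k * of_real S" .
  obtain i where "i < n" "v $ i \<noteq> 0"
    using v by (metis carrier_vecD eq_vecI index_zero_vec(1) index_zero_vec(2))
  then have "S > 0" unfolding S_def
    by (intro sum_pos2[where i = i]) auto
  then have "k = Q / of_real S" by (simp add: Q)
  then show ?thesis using real by simp
qed

text \<open>Over the complex numbers the polynomial splits, its roots are real, and the embedding of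
  real polynomials is injective, so the factorisation descends.\<close>

lemma char_poly_of_real_symmetric_splits:
  fixes A :: "real mat"
  assumes A: "A \<in> carrier_mat n n" "transpose_mat A = A"
  obtains es where "char_poly A = (\<Prod>e\<leftarrow>es. [:- e, 1:])" "length es = n"
proof -
  let ?A = "map_mat complex_of_real A"
  have A': "?A \<in> carrier_mat n n" using A by simp
  obtain as where as: "char_poly ?A = (\<Prod>a\<leftarrow>as. [:- a, 1:])" "length as = n"
    using char_poly_factorized[OF A'] by blast
  have real: "a \<in> \<real>" if "a \<in> set as" for a
  proof -
    have "poly (char_poly ?A) a = 0"
      unfolding as using that by (auto simp: poly_prod_list prod_list_zero_iff)
    then show ?thesis
      using eigenvalue_root_char_poly[OF A'] eigenvalue_of_real_symmetric_is_real[OF A] by blast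
  qed
  interpret h: map_poly_inj_idom_hom complex_of_real ..
  have "map_poly complex_of_real (char_poly A) = char_poly ?A"
    by (rule of_real_hom.char_poly_hom[OF A(1), symmetric])
  also have "\<dots> = (\<Prod>a\<leftarrow>as. map_poly complex_of_real [:- Re a, 1:])"
    unfolding as using real by (intro arg_cong[of _ _ prod_list] map_cong) (auto elim: Reals_cases)
  also have "\<dots> = map_poly complex_of_real (\<Prod>e\<leftarrow>map Re as. [:- e, 1:])"
    by (simp add: h.hom_prod_list o_def)
  finally have "char_poly A = (\<Prod>e\<leftarrow>map Re as. [:- e, 1:])"
    by (rule h.injectivity)
  with as(2) that[of "map Re as"] show thesis by simp
qed

text \<open>The Householder matrix \<open>I - 2 w w^T / s\<close> with \<open>w = v - e_0\<close>
  and \<open>s\<close> the squared norm of \<open>w\<close> exchanges \<open>e_0\<close> and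
  \<open>v\<close>. It degenerates for \<open>v = e_0\<close>, where the identity serves.\<close>

lemma householder_exists:
  fixes v :: "real vec"
  assumes v: "v \<in> carrier_vec n" and unit: "(\<Sum>i<n. (v $ i)\<^sup>2) = 1" and n: "0 < n"
  obtains H where "H \<in> carrier_mat n n" "H * H = 1\<^sub>m n" "transpose_mat H = H" "col H 0 = v"
proof (cases "v $ 0 = 1")
  case True
  have "(\<Sum>i<n. (v $ i)\<^sup>2) = (v $ 0)\<^sup>2 + (\<Sum>i\<in>{..<n} - {0}. (v $ i)\<^sup>2)"
    using n by (subst sum.remove[of _ 0]) auto
  then have "(\<Sum>i\<in>{..<n} - {0}. (v $ i)\<^sup>2) = 0" using unit True by simp
  then have "v $ i = 0" if "i < n" "i \<noteq> 0" for i
    using that by (subst (asm) sum_nonneg_eq_0_iff) auto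
  then have "col (1\<^sub>m n) 0 = v"
    using v n True by (intro eq_vecI) (auto simp: unit_vec_def)
  then show thesis by (intro that[of "1\<^sub>m n"]) auto
next
  case False
  define w where "w = (\<lambda>i. v $ i - of_bool (i = 0))"
  define s where "s = (\<Sum>i<n. (w i)\<^sup>2)"
  have sv: "s = 2 - 2 * v $ 0"
  proof -
    have "s = (\<Sum>i<n. (v $ i)\<^sup>2) + (\<Sum>i<n. of_bool (i = 0)) - 2 * (\<Sum>i<n. v $ i * of_bool (i = 0))"
      unfolding s_def w_def sum_distrib_left sum.distrib[symmetric] sum_subtractf[symmetric]
      by (intro sum.cong) (auto simp: power2_diff)
    also have "(\<Sum>i<n. of_bool (i = 0) :: real) = 1"
      using n by (simp add: of_bool_def)
    also have "(\<Sum>i<n. v $ i * of_bool (i = 0)) = v $ 0"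
      using n by (simp add: of_bool_def if_distrib cong: if_cong)
    finally show ?thesis using unit by simp
  qed
  have s0: "s \<noteq> 0" using False sv by simp
  define h where "h = (\<lambda>i j. of_bool (i = j) - 2 * w i * w j / s)"
  define H where "H = Matrix.mat n n (\<lambda>(i, j). h i j)"
  have hh: "(\<Sum>k<n. h i k * h k j) = of_bool (i = j)" if "i < n" "j < n" for i j
  proof -
    have "h i k * h k j = of_bool (i = k) * of_bool (k = j) - of_bool (i = k) * (2 * w k * w j / s)
       - of_bool (k = j) * (2 * w i * w k / s) + (4 * w i * w j / s\<^sup>2) * (w k)\<^sup>2" for k
      by (simp add: h_def algebra_simps power2_eq_square)
    then have "(\<Sum>k<n. h i k * h k j) = (\<Sum>k<n. of_bool (i = k) * of_bool (k = j))
       - (\<Sum>k<n. of_bool (i = k) * (2 * w k * w j / s))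
       - (\<Sum>k<n. of_bool (k = j) * (2 * w i * w k / s)) + (4 * w i * w j / s\<^sup>2) * s"
      by (simp add: sum.distrib sum_subtractf s_def sum_distrib_left)
    also have "(\<Sum>k<n. of_bool (i = k) * of_bool (k = j) :: real) = (\<Sum>k<n. if k = i then of_bool (i = j) else 0)"
      by (intro sum.cong) auto
    also have "\<dots> = of_bool (i = j)"
      using that by simp
    also have "(\<Sum>k<n. of_bool (i = k) * (2 * w k * w j / s)) = (\<Sum>k<n. if k = i then 2 * w i * w j / s else 0)"
      by (intro sum.cong) auto
    also have "\<dots> = 2 * w i * w j / s"
      using that by simp
    also have "(\<Sum>k<n. of_bool (k = j) * (2 * w i * w k / s)) = (\<Sum>k<n. if k = j then 2 * w i * w j / s else 0)"
      by (intro sum.cong) auto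
    also have "\<dots> = 2 * w i * w j / s"
      using that by simp
    finally show ?thesis using s0 by (simp add: power2_eq_square)
  qed
  have H: "H \<in> carrier_mat n n" by (simp add: H_def)
  show thesis
  proof (rule that[OF H])
    show "H * H = 1\<^sub>m n"
      using hh by (intro eq_matI) (auto simp: H_def scalar_prod_def atLeast0LessThan)
    show "transpose_mat H = H"
      by (intro eq_matI) (auto simp: H_def h_def mult_ac)
    have "h i 0 = v $ i" if "i < n" for i
    proof -
      \<comment> \<open>Hence \<open>2 * w 0 / s = - 1\<close>, and column 0 of \<open>H\<close> is
        \<open>e_0 + w = v\<close>.\<close>
      have "w 0 = - s / 2" by (simp add: w_def sv)
      then show ?thesis using s0 by (simp add: h_def) (simp add: w_def)
    qed
    then show "col H 0 = v"
      using v n by (intro eq_vecI) (auto simp: H_def)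
  qed
qed

lemma unit_eigenvector_exists:
  fixes A :: "real mat"
  assumes A: "A \<in> carrier_mat n n" and "eigenvalue A e"
  obtains v where "v \<in> carrier_vec n" "(\<Sum>i<n. (v $ i)\<^sup>2) = 1" "A *\<^sub>v v = e \<cdot>\<^sub>v v"
proof -
  obtain v where v: "v \<in> carrier_vec n" "v \<noteq> 0\<^sub>v n" "A *\<^sub>v v = e \<cdot>\<^sub>v v"
    using assms by (auto simp: eigenvalue_def eigenvector_def)
  define S where "S = (\<Sum>i<n. (v $ i)\<^sup>2)"
  obtain i where "i < n" "v $ i \<noteq> 0"
    using v by (metis carrier_vecD eq_vecI index_zero_vec(1) index_zero_vec(2))
  then have S: "S > 0" unfolding S_def
    by (intro sum_pos2[where i = i]) auto
  let ?v = "(1 / sqrt S) \<cdot>\<^sub>v v"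
  have "(\<Sum>i<n. (?v $ i)\<^sup>2) = (\<Sum>i<n. (v $ i)\<^sup>2 / S)"
    using v(1) S by (intro sum.cong) (auto simp: power_divide)
  also have "\<dots> = 1"
    using S by (simp add: S_def flip: sum_divide_distrib)
  finally have "(\<Sum>i<n. (?v $ i)\<^sup>2) = 1" .
  moreover have "A *\<^sub>v ?v = e \<cdot>\<^sub>v ?v"
    using A v by (simp add: mult_mat_vec smult_smult_assoc mult.commute)
  ultimately show thesis
    using v S by (intro that[of ?v]) auto
qed

text \<open>Deflation: conjugating by a symmetric orthogonal \<open>H\<close> whose first column is
  a unit eigenvector splits off the entry \<open>e\<close>, and cancelling \<open>[:- e, 1:]\<close>
  leaves the characteristic polynomial of the remaining symmetric block. The list \<open>es\<close>
  prescribes the order of the diagonal, so that the eigenvalues can later be taken sorted.\<close>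

lemma spectral_decomposition_exists:
  fixes A :: "real mat"
  assumes "A \<in> carrier_mat n n" "transpose_mat A = A" "char_poly A = (\<Prod>e\<leftarrow>es. [:- e, 1:])"
    "length es = n"
  shows "\<exists>U. spectral_decomposition n A U (\<lambda>i. es ! i)"
  using assms
proof (induction es arbitrary: n A)
  case Nil
  then show ?case
    by (intro exI[of _ "1\<^sub>m 0"]) (auto simp: spectral_decomposition_def)
next
  case (Cons e es)
  define n1 where "n1 = length es"
  have n: "n = Suc n1" using Cons.prems by (simp add: n1_def)
  note A = Cons.prems(1,2)
  have "poly (char_poly A) e = 0" using Cons.prems by simp
  then have "eigenvalue A e" using eigenvalue_root_char_poly[OF A(1)] by simp
  then obtain v where v: "v \<in> carrier_vec n" "(\<Sum>i<n. (v $ i)\<^sup>2) = 1" "A *\<^sub>v v = e \<cdot>\<^sub>v v"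
    using unit_eigenvector_exists[OF A(1)] by blast
  then obtain H where H: "H \<in> carrier_mat n n" "H * H = 1\<^sub>m n" "transpose_mat H = H" "col H 0 = v"
    using householder_exists[of v n] n by auto
  define A' where "A' = H * A * H"
  have A': "A' \<in> carrier_mat n n" using H A by (simp add: A'_def)
  have sym': "transpose_mat A' = A'"
  proof -
    have "transpose_mat A' = transpose_mat H * (transpose_mat A * transpose_mat H)"
      using H A by (simp add: A'_def transpose_mult[of _ n n _ n])
    then show ?thesis using H A by (simp add: A'_def)
  qed
  have A_eq: "A = H * A' * H"
  proof -
    have "H * A' * H = (H * H) * A * (H * H)"
      unfolding A'_def using H(1) A by (simp add: assoc_mult_mat[of _ n n _ n _ n])
    then show ?thesis using H A by simp
  qed
  have col0: "col A' 0 = e \<cdot>\<^sub>v unit_vec n 0"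
  proof -
    have "col A' 0 = H * A *\<^sub>v v"
      unfolding A'_def using H A n by (subst col_mult2[of _ n n _ n]) auto
    also have "\<dots> = H *\<^sub>v (e \<cdot>\<^sub>v v)"
      using H A v by simp
    also have "\<dots> = e \<cdot>\<^sub>v (H *\<^sub>v col H 0)"
      using H v by (simp add: mult_mat_vec)
    also have "H *\<^sub>v col H 0 = col (H * H) 0"
      using H(1) n by (subst col_mult2[of _ n n _ n]) auto
    also have "\<dots> = unit_vec n 0"
      unfolding H(2) using n by simp
    finally show ?thesis .
  qed
  have c0: "A' $$ (i, 0) = (if i = 0 then e else 0)" if "i < n" for i
  proof -
    have "A' $$ (i, 0) = col A' 0 $ i" using A' n that by simp
    then show ?thesis using n that by (simp add: col0 unit_vec_def)
  qed
  have symi: "A' $$ (i, j) = A' $$ (j, i)" if "i < n" "j < n" for i j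
    using A' sym' that by (metis carrier_matD(1) carrier_matD(2) index_transpose_mat(1))
  have r0: "A' $$ (0, i) = (if i = 0 then e else 0)" if "i < n" for i
    using symi[of 0 i] c0[OF that] n that by simp
  define E where "E = Matrix.mat 1 1 (\<lambda>_. e)"
  define A3 where "A3 = Matrix.mat n1 n1 (\<lambda>(i, j). A' $$ (Suc i, Suc j))"
  have E: "E \<in> carrier_mat 1 1" and A3: "A3 \<in> carrier_mat n1 n1"
    by (simp_all add: E_def A3_def)
  have blocks: "A' = four_block_mat E (0\<^sub>m 1 n1) (0\<^sub>m n1 1) A3"
    using A' n c0 r0 by (intro eq_matI) (auto simp: E_def A3_def)
  have sym3: "transpose_mat A3 = A3"
    using symi n by (intro eq_matI) (auto simp: A3_def)
  have "similar_mat A A'"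
    unfolding similar_mat_def
    using similar_mat_witI[OF H(2,2) A_eq A(1) A' H(1,1)] by blast
  then have "char_poly A = char_poly E * char_poly A3"
    using char_poly_four_block_zeros_col[OF E _ A3, of "0\<^sub>m 1 n1"]
    by (simp add: blocks char_poly_similar)
  moreover have "char_poly E = [:- e, 1:]"
    by (subst char_poly_upper_triangular[OF E]) (auto simp: E_def diag_mat_def)
  ultimately have "[:- e, 1:] * char_poly A3 = [:- e, 1:] * (\<Prod>e\<leftarrow>es. [:- e, 1:])"
    using Cons.prems(3) by simp
  then have "char_poly A3 = (\<Prod>e\<leftarrow>es. [:- e, 1:])"
    by (subst (asm) mult_cancel_left) auto
  from Cons.IH[OF A3 sym3 this] obtain V where V: "spectral_decomposition n1 A3 V ((!) es)"
    by (auto simp: n1_def)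
  then have Vc: "V \<in> carrier_mat n1 n1" "V * transpose_mat V = 1\<^sub>m n1" "transpose_mat V * V = 1\<^sub>m n1"
    and A3_eq: "A3 = V * mat_diag n1 ((!) es) * transpose_mat V"
    by (auto simp: spectral_decomposition_def)
  define F where "F = four_block_mat (1\<^sub>m 1) (0\<^sub>m 1 n1) (0\<^sub>m n1 1) V"
  have F: "F \<in> carrier_mat n n"
    using four_block_carrier_mat[of "1\<^sub>m 1" 1 1 V n1 n1] Vc n by (simp add: F_def)
  have Ft: "transpose_mat F = four_block_mat (1\<^sub>m 1) (0\<^sub>m 1 n1) (0\<^sub>m n1 1) (transpose_mat V)"
    unfolding F_def using Vc by (subst transpose_four_block_mat) auto
  have one: "four_block_mat (1\<^sub>m 1) (0\<^sub>m 1 n1) (0\<^sub>m n1 1) (1\<^sub>m n1) = (1\<^sub>m n :: real mat)"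
    using n by (intro eq_matI) auto
  have FFt: "F * transpose_mat F = 1\<^sub>m n"
    unfolding Ft unfolding F_def
    by (subst mult_four_block_mat[of _ 1 1 _ n1 _ n1 _ _ 1 _ n1]) (use Vc one in auto)
  have FtF: "transpose_mat F * F = 1\<^sub>m n"
    unfolding Ft unfolding F_def
    by (subst mult_four_block_mat[of _ 1 1 _ n1 _ n1 _ _ 1 _ n1]) (use Vc one in auto)
  let ?D = "mat_diag n1 ((!) es)"
  have diag: "mat_diag n ((!) (e # es)) = four_block_mat E (0\<^sub>m 1 n1) (0\<^sub>m n1 1) ?D"
    using n by (intro eq_matI) (auto simp: mat_diag_def E_def nth_Cons')
  have "F * mat_diag n ((!) (e # es)) = four_block_mat E (0\<^sub>m 1 n1) (0\<^sub>m n1 1) (V * ?D)"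
    unfolding diag unfolding F_def
    by (subst mult_four_block_mat[of _ 1 1 _ n1 _ n1 _ _ 1 _ n1])
       (use Vc E in \<open>auto simp: right_mult_zero_mat[of _ n1 n1] left_mult_zero_mat[of _ n1 n1]\<close>)
  then have "F * mat_diag n ((!) (e # es)) * transpose_mat F
      = four_block_mat E (0\<^sub>m 1 n1) (0\<^sub>m n1 1) (V * ?D * transpose_mat V)"
    unfolding Ft
    by (simp only:, subst mult_four_block_mat[of _ 1 1 _ n1 _ n1 _ _ 1 _ n1])
       (use Vc E in \<open>auto simp: right_mult_zero_mat[of _ n1 n1] left_mult_zero_mat[of _ n1 n1]\<close>)
  then have A'F: "A' = F * mat_diag n ((!) (e # es)) * transpose_mat F"
    by (simp add: blocks A3_eq)
  have t: "transpose_mat (H * F) = transpose_mat F * H"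
    using H F by (simp add: transpose_mult[of _ n n _ n])
  have c: "mat_diag n ((!) (e # es)) \<in> carrier_mat n n" "transpose_mat F \<in> carrier_mat n n"
    using F by auto
  have "H * F * transpose_mat (H * F) = H * (F * transpose_mat F) * H"
    unfolding t using H(1) F by (simp add: assoc_mult_mat[of _ n n _ n _ n])
  then have 1: "H * F * transpose_mat (H * F) = 1\<^sub>m n"
    using FFt H by simp
  have "transpose_mat (H * F) * (H * F) = transpose_mat F * (H * H) * F"
    unfolding t using H(1) F by (simp add: assoc_mult_mat[of _ n n _ n _ n])
  then have 2: "transpose_mat (H * F) * (H * F) = 1\<^sub>m n"
    using FtF H F by simp
  have 3: "A = H * F * mat_diag n ((!) (e # es)) * transpose_mat (H * F)"
    unfolding t using A_eq H(1) F c unfolding A'F by (simp add: assoc_mult_mat[of _ n n _ n _ n])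
  show ?case
    using 1 2 3 H F unfolding spectral_decomposition_def by (intro exI[of _ "H * F"]) simp
qed

section \<open>Spectral powers, the Laplacian and the prior\<close>

definition entries :: "real mat \<Rightarrow> nat \<Rightarrow> nat \<Rightarrow> real" where
  "entries U i j = U $$ (i, j)"

lemma spectral_form_carrier:
  fixes U :: "real mat"
  assumes "U \<in> carrier_mat n n"
  shows "U * mat_diag n d * transpose_mat U \<in> carrier_mat n n"
  using assms by (meson mat_diag_dim mult_carrier_mat transpose_carrier_mat)

lemma spectral_form_index:
  fixes U :: "real mat"
  assumes U: "U \<in> carrier_mat n n" and "i < n" "j < n"
  shows "(U * mat_diag n d * transpose_mat U) $$ (i, j) = (\<Sum>k<n. U $$ (i, k) * d k * U $$ (j, k))"
proof -
  have "U * mat_diag n d = Matrix.mat n n (\<lambda>(i, j). U $$ (i, j) * d j)"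
    using U by (rule mat_diag_mult_right)
  then show ?thesis
    using assms by (simp add: scalar_prod_def atLeast0LessThan)
qed

lemma spectral_decomposition_smult:
  assumes "spectral_decomposition n A U d"
  shows "spectral_decomposition n (c \<cdot>\<^sub>m A) U (\<lambda>i. c * d i)"
proof -
  have U: "U \<in> carrier_mat n n" and A: "A = U * mat_diag n d * transpose_mat U"
    using assms by (auto simp: spectral_decomposition_def)
  have "c \<cdot>\<^sub>m A = U * mat_diag n (\<lambda>i. c * d i) * transpose_mat U"
    unfolding A
    by (intro eq_matI)
       (auto simp: carrier_matD[OF spectral_form_carrier[OF U]] spectral_form_index[OF U]
         sum_distrib_left mult_ac simp del: index_mult_mat)
  then show ?thesis using assms by (simp add: spectral_decomposition_def)
qed

lemma spectral_decomposition_add: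
  assumes "spectral_decomposition n A U d" "spectral_decomposition n B U e"
  shows "spectral_decomposition n (A + B) U (\<lambda>i. d i + e i)"
proof -
  have U: "U \<in> carrier_mat n n" and A: "A = U * mat_diag n d * transpose_mat U"
    and B: "B = U * mat_diag n e * transpose_mat U"
    using assms by (auto simp: spectral_decomposition_def)
  have "A + B = U * mat_diag n (\<lambda>i. d i + e i) * transpose_mat U"
    unfolding A B
    by (intro eq_matI)
       (auto simp: carrier_matD[OF spectral_form_carrier[OF U]] spectral_form_index[OF U]
         algebra_simps sum.distrib simp del: index_mult_mat)
  then show ?thesis using assms by (simp add: spectral_decomposition_def)
qed

lemma spectral_decomposition_one:
  assumes "spectral_decomposition n A U d"
  shows "spectral_decomposition n (1\<^sub>m n) U (\<lambda>i. 1)"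
  using assms by (auto simp: spectral_decomposition_def)

lemma spectral_decomposition_mult:
  assumes "spectral_decomposition n A U d" "spectral_decomposition n B U e"
  shows "spectral_decomposition n (A * B) U (\<lambda>i. d i * e i)"
proof -
  have U: "U \<in> carrier_mat n n" and UU: "transpose_mat U * U = 1\<^sub>m n"
    and A: "A = U * mat_diag n d * transpose_mat U" and B: "B = U * mat_diag n e * transpose_mat U"
    using assms by (auto simp: spectral_decomposition_def)
  note assoc = assoc_mult_mat[of _ n n _ n _ n] mult_carrier_mat[of _ n n _ n]
  have "A * B = U * (mat_diag n d * ((transpose_mat U * U) * (mat_diag n e * transpose_mat U)))"
    unfolding A B using U by (simp add: assoc del: mat_diag_diag)
  also have "\<dots> = U * (mat_diag n d * mat_diag n e) * transpose_mat U"
    unfolding UU using U by (simp add: assoc left_mult_one_mat[of _ n n] del: mat_diag_diag)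
  finally show ?thesis using assms by (simp add: spectral_decomposition_def)
qed

text \<open>The matrix with inverted diagonal is a two-sided inverse. This excludes the result
  \<open>None\<close> of \<open>mat_inverse\<close> and, inverses being unique, identifies the
  matrix returned.\<close>

lemma spectral_decomposition_inverse:
  assumes "spectral_decomposition n A U d" "\<And>i. i < n \<Longrightarrow> d i \<noteq> 0"
  shows "spectral_decomposition n (the (mat_inverse A)) U (\<lambda>i. inverse (d i))"
proof -
  have U: "U \<in> carrier_mat n n" using assms by (auto simp: spectral_decomposition_def)
  have A: "A \<in> carrier_mat n n"
    using assms spectral_form_carrier[OF U] by (auto simp: spectral_decomposition_def)
  define B where "B = U * mat_diag n (\<lambda>i. inverse (d i)) * transpose_mat U"
  have B: "spectral_decomposition n B U (\<lambda>i. inverse (d i))"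
    using assms by (auto simp: spectral_decomposition_def B_def)
  have Bc: "B \<in> carrier_mat n n"
    unfolding B_def by (rule spectral_form_carrier[OF U])
  have diag1: "mat_diag n (\<lambda>i. f i * g i) = mat_diag n (\<lambda>i. 1 :: real)"
    if "\<And>i. i < n \<Longrightarrow> f i * g i = 1" for f g
    using that by (auto simp: mat_diag_def)
  have one: "U * mat_diag n (\<lambda>i. 1) * transpose_mat U = 1\<^sub>m n"
    using spectral_decomposition_one[OF assms(1)] by (simp add: spectral_decomposition_def)
  have AB: "A * B = 1\<^sub>m n"
    using spectral_decomposition_mult[OF assms(1) B] diag1[of d "\<lambda>i. inverse (d i)"] assms(2) one
    by (simp add: spectral_decomposition_def)
  have BA: "B * A = 1\<^sub>m n"
    using spectral_decomposition_mult[OF B assms(1)] diag1[of "\<lambda>i. inverse (d i)" d] assms(2) one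
    by (simp add: spectral_decomposition_def)
  have "mat_inverse A \<noteq> None"
  proof
    assume "mat_inverse A = None"
    then have "A \<notin> Units (ring_mat TYPE(real) n ())" by (rule mat_inverse(1)[OF A])
    then show False using A Bc AB BA by (auto simp: Units_def ring_mat_def)
  qed
  then obtain B' where B': "mat_inverse A = Some B'" by blast
  from mat_inverse(2)[OF A B'] have "A * B' = 1\<^sub>m n" "B' \<in> carrier_mat n n" by auto
  then have "B' = B"
    using assoc_mult_mat[OF Bc A, of B' n] left_mult_one_mat[of B' n n] right_mult_one_mat[OF Bc] BA
    by simp
  then show ?thesis using B B' by simp
qed

text \<open>
  The spectral power does not depend on the diagonalisation: for \<open>W = V\<^sup>T U\<close>, the equation
  \<open>W\<^sub>i\<^sub>j d\<^sub>j = e\<^sub>i W\<^sub>i\<^sub>j\<close> forces \<open>d\<^sub>j = e\<^sub>i\<close> wherever \<open>W\<^sub>i\<^sub>j \<noteq> 0\<close>, so that it survives taking powers.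
\<close>

lemma spectral_form_unique:
  assumes U: "spectral_decomposition n A U d" and V: "spectral_decomposition n A V e"
  shows "U * mat_diag n (\<lambda>i. \<phi> (d i)) * transpose_mat U = V * mat_diag n (\<lambda>i. \<phi> (e i)) * transpose_mat V"
proof -
  define W where "W = transpose_mat V * U"
  have Uc: "U \<in> carrier_mat n n" "transpose_mat U \<in> carrier_mat n n" "transpose_mat U * U = 1\<^sub>m n"
    "U * transpose_mat U = 1\<^sub>m n"
    and Vc: "V \<in> carrier_mat n n" "transpose_mat V \<in> carrier_mat n n" "transpose_mat V * V = 1\<^sub>m n"
    "V * transpose_mat V = 1\<^sub>m n"
    and eq: "U * mat_diag n d * transpose_mat U = V * mat_diag n e * transpose_mat V"
    using U V by (auto simp: spectral_decomposition_def)
  note assoc = assoc_mult_mat[of _ n n _ n _ n] mult_carrier_mat[of _ n n _ n]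
  have W: "W \<in> carrier_mat n n" using Uc Vc by (simp add: W_def)
  have "W * mat_diag n d = transpose_mat V * (U * mat_diag n d * transpose_mat U) * U"
    unfolding W_def using Uc(1) Vc(1) by (simp add: assoc Uc(3) right_mult_one_mat[of _ n n])
  also have "\<dots> = (transpose_mat V * V) * mat_diag n e * W"
    unfolding eq W_def using Uc(1) Vc(1) by (simp add: assoc)
  also have "\<dots> = mat_diag n e * W"
    unfolding Vc(3) using W by (simp add: left_mult_one_mat[of _ n n])
  finally have WD: "W * mat_diag n d = mat_diag n e * W" .
  have ij: "W $$ (i, j) * d j = e i * W $$ (i, j)" if "i < n" "j < n" for i j
  proof -
    have "(W * mat_diag n d) $$ (i, j) = (mat_diag n e * W) $$ (i, j)" by (simp only: WD)
    then show ?thesis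
      unfolding mat_diag_mult_left[OF W] mat_diag_mult_right[OF W] using that by simp
  qed
  have "W $$ (i, j) * \<phi> (d j) = \<phi> (e i) * W $$ (i, j)" if "i < n" "j < n" for i j
    using ij[OF that] by (cases "W $$ (i, j) = 0") auto
  then have comm: "W * mat_diag n (\<lambda>i. \<phi> (d i)) = mat_diag n (\<lambda>i. \<phi> (e i)) * W"
    by (auto simp: mat_diag_mult_left[OF W] mat_diag_mult_right[OF W])
  have "V * W = V * transpose_mat V * U"
    unfolding W_def using Uc(1) Vc(1) by (simp add: assoc)
  then have VW: "V * W = U" using Uc(1) by (simp add: Vc(4) left_mult_one_mat[of _ n n])
  have WU: "W * transpose_mat U = transpose_mat V"
    unfolding W_def using Uc(1) Vc(1) by (simp add: assoc Uc(4) right_mult_one_mat[of _ n n])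
  have "U * mat_diag n (\<lambda>i. \<phi> (d i)) * transpose_mat U = V * (W * mat_diag n (\<lambda>i. \<phi> (d i))) * transpose_mat U"
    unfolding assoc_mult_mat[OF Vc(1) W mat_diag_dim, symmetric] VW ..
  also have "\<dots> = V * mat_diag n (\<lambda>i. \<phi> (e i)) * (W * transpose_mat U)"
    unfolding comm using Uc(1) Vc(1) W by (simp add: assoc)
  finally show ?thesis unfolding WU .
qed

text \<open>The definite description in \<open>mat_powr\<close> is well defined: the given
  decomposition is a witness and \<open>spectral_form_unique\<close> gives uniqueness.\<close>

lemma spectral_decomposition_mat_powr:
  assumes "spectral_decomposition n A U d"
  shows "spectral_decomposition n (mat_powr A s) U (\<lambda>i. d i powr s)"
proof -
  have U: "U \<in> carrier_mat n n" using assms by (auto simp: spectral_decomposition_def)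
  have A: "A \<in> carrier_mat n n"
    using assms spectral_form_carrier[OF U] by (auto simp: spectral_decomposition_def)
  have iff: "is_spectral_powr A s B \<longleftrightarrow>
    (\<exists>V e. spectral_decomposition n A V e \<and> B = V * mat_diag n (\<lambda>i. e i powr s) * transpose_mat V)" for B
    using A unfolding is_spectral_powr_def spectral_decomposition_def by auto
  have "mat_powr A s = U * mat_diag n (\<lambda>i. d i powr s) * transpose_mat U"
    unfolding mat_powr_def iff
    by (rule the_equality) (use assms spectral_form_unique[OF _ assms, where \<phi> = "\<lambda>x. x powr s"] in blast)+
  then show ?thesis using assms by (simp add: spectral_decomposition_def)
qed

section \<open>Coefficients in an eigenbasis and the Gaussian law in these coordinates\<close>

lemma spectral_decomposition_orthonormal:
  assumes "spectral_decomposition n A U d"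
  shows "orthonormal_cols n (entries U)" "orthonormal_cols n (\<lambda>i j. entries U j i)"
proof -
  have U: "U \<in> carrier_mat n n" "transpose_mat U * U = 1\<^sub>m n" "U * transpose_mat U = 1\<^sub>m n"
    using assms by (auto simp: spectral_decomposition_def)
  have "(\<Sum>i<n. U $$ (i, j) * U $$ (i, l)) = of_bool (j = l)" if "j < n" "l < n" for j l
  proof -
    have "(\<Sum>i<n. U $$ (i, j) * U $$ (i, l)) = (transpose_mat U * U) $$ (j, l)"
      using U(1) that by (simp add: scalar_prod_def atLeast0LessThan)
    also have "\<dots> = of_bool (j = l)" unfolding U(2) using that by simp
    finally show ?thesis .
  qed
  then show "orthonormal_cols n (entries U)" by (simp add: orthonormal_cols_def entries_def)
  have "(\<Sum>i<n. U $$ (j, i) * U $$ (l, i)) = of_bool (j = l)" if "j < n" "l < n" for j l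
  proof -
    have "(\<Sum>i<n. U $$ (j, i) * U $$ (l, i)) = (U * transpose_mat U) $$ (j, l)"
      using U(1) that by (simp add: scalar_prod_def atLeast0LessThan)
    also have "\<dots> = of_bool (j = l)" unfolding U(3) using that by simp
    finally show ?thesis .
  qed
  then show "orthonormal_cols n (\<lambda>i j. entries U j i)" by (simp add: orthonormal_cols_def entries_def)
qed

lemma mat_apply_spectral_decomposition:
  assumes "spectral_decomposition n A U d"
  shows "mat_apply n A h = lin_map n (entries U) (\<lambda>k. d k * lin_map n (\<lambda>i j. entries U j i) h k)"
proof
  fix i
  have U: "U \<in> carrier_mat n n" and A: "A = U * mat_diag n d * transpose_mat U"
    using assms by (auto simp: spectral_decomposition_def)
  show "mat_apply n A h i = lin_map n (entries U) (\<lambda>k. d k * lin_map n (\<lambda>i j. entries U j i) h k) i"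
  proof (cases "i < n")
    case True
    have "A \<in> carrier_mat n n" unfolding A by (rule spectral_form_carrier[OF U])
    then have "mat_apply n A h i = (\<Sum>j<n. A $$ (i, j) * h j)"
      using True by (simp add: mat_apply_def scalar_prod_def atLeast0LessThan)
    also have "\<dots> = (\<Sum>j<n. \<Sum>k<n. U $$ (i, k) * d k * U $$ (j, k) * h j)"
      using True by (intro sum.cong) (auto simp: A spectral_form_index[OF U] sum_distrib_right)
    also have "\<dots> = (\<Sum>k<n. \<Sum>j<n. U $$ (i, k) * d k * U $$ (j, k) * h j)"
      by (rule sum.swap)
    also have "\<dots> = (\<Sum>k<n. U $$ (i, k) * (d k * (\<Sum>j<n. U $$ (j, k) * h j)))"
      by (simp add: sum_distrib_left mult.assoc)
    finally show ?thesis using True by (simp add: lin_map_def entries_def)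
  qed (simp add: mat_apply_def lin_map_def)
qed

lemma lin_map_inner:
  assumes "orthonormal_cols n u"
  shows "(\<Sum>i<n. lin_map n u x i * lin_map n u y i) = (\<Sum>j<n. x j * y j)"
proof -
  have orth: "(\<Sum>i<n. u i j * u i l) = of_bool (j = l)" if "j < n" "l < n" for j l
    using assms that by (simp add: orthonormal_cols_def)
  have "(\<Sum>i<n. lin_map n u x i * lin_map n u y i)
      = (\<Sum>i<n. \<Sum>j<n. \<Sum>l<n. (x j * y l) * (u i j * u i l))"
    by (simp add: lin_map_def sum_product mult_ac)
  also have "\<dots> = (\<Sum>j<n. \<Sum>i<n. \<Sum>l<n. (x j * y l) * (u i j * u i l))"
    by (rule sum.swap)
  also have "\<dots> = (\<Sum>j<n. \<Sum>l<n. \<Sum>i<n. (x j * y l) * (u i j * u i l))"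
    by (rule sum.cong[OF refl]) (rule sum.swap)
  also have "\<dots> = (\<Sum>j<n. \<Sum>l<n. if l = j then x j * y j else 0)"
    using orth by (intro sum.cong) (auto simp flip: sum_distrib_left)
  also have "\<dots> = (\<Sum>j<n. x j * y j)" by simp
  finally show ?thesis .
qed

lemma lin_map_transpose_lin_map:
  assumes "orthonormal_cols n u" "j < n"
  shows "lin_map n (\<lambda>i j. u j i) (lin_map n u x) j = x j"
proof -
  have orth: "(\<Sum>i<n. u i j * u i l) = of_bool (j = l)" if "l < n" for l
    using assms that by (simp add: orthonormal_cols_def)
  have "lin_map n (\<lambda>i j. u j i) (lin_map n u x) j = (\<Sum>i<n. \<Sum>l<n. x l * (u i j * u i l))"
    using assms(2) by (simp add: lin_map_def sum_distrib_left mult_ac)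
  also have "\<dots> = (\<Sum>l<n. \<Sum>i<n. x l * (u i j * u i l))" by (rule sum.swap)
  also have "\<dots> = (\<Sum>l<n. if l = j then x j else 0)"
    using orth by (intro sum.cong) (auto simp flip: sum_distrib_left)
  finally show ?thesis using assms(2) by simp
qed

lemma lin_map_diff: "i < n \<Longrightarrow> lin_map n u (\<lambda>j. x j - y j) i = lin_map n u x i - lin_map n u y i"
  by (simp add: lin_map_def algebra_simps sum_subtractf)

lemma lin_map_cong: "(\<And>j. j < n \<Longrightarrow> x j = y j) \<Longrightarrow> lin_map n u x = lin_map n u y"
  unfolding lin_map_def by (intro restrict_ext sum.cong) auto

lemma centered_gaussian_spectral:
  assumes "spectral_decomposition n S U v"
  shows "centered_gaussian n S
    = distr (std_normal_PiM n) (Rn n) (\<lambda>z. lin_map n (entries U) (\<lambda>k. v k powr (1 / 2) * z k))"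
proof -
  let ?P = "std_normal_PiM n"
  let ?u = "entries U" and ?ut = "\<lambda>i j. entries U j i"
  let ?F = "\<lambda>z. lin_map n ?u (\<lambda>k. v k powr (1 / 2) * z k)"
  have "?F = lin_map n (\<lambda>i j. ?u i j * v j powr (1 / 2))"
    by (auto simp: fun_eq_iff lin_map_def mult.assoc)
  then have F: "?F \<in> ?P \<rightarrow>\<^sub>M Rn n"
    using measurable_lin_map
    by (simp add: Rn_def measurable_cong_sets[OF sets_std_normal_PiM refl])
  have "mat_apply n (mat_powr S (1 / 2)) = ?F \<circ> lin_map n ?ut"
    using mat_apply_spectral_decomposition[OF spectral_decomposition_mat_powr[OF assms]]
    by (simp add: fun_eq_iff)
  then have "centered_gaussian n S = distr ?P (Rn n) (?F \<circ> lin_map n ?ut)"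
    by (simp add: centered_gaussian_def)
  also have "\<dots> = distr (distr ?P ?P (lin_map n ?ut)) (Rn n) ?F"
    using F measurable_lin_map_std_normal by (simp add: distr_distr)
  also have "distr ?P ?P (lin_map n ?ut) = ?P"
    by (rule distr_lin_map_orthonormal) (rule spectral_decomposition_orthonormal[OF assms])
  finally show ?thesis .
qed

section \<open>The graph Laplacian: entries, Dirichlet form and sorted spectrum\<close>

lemma laplacian_carrier: "laplacian n G \<in> carrier_mat n n"
  unfolding laplacian_def adjacency_mat_def by (rule minus_carrier_mat) simp

lemma laplacian_index:
  assumes "connected_simple_graph n G" "i < n" "j < n"
  shows "laplacian n G $$ (i, j)
    = of_bool (i = j) * (\<Sum>k<n. of_bool ((i, k) \<in> parcs G)) - of_bool ((i, j) \<in> parcs G)"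
proof -
  interpret pair_graph G using assms by (simp add: connected_simple_graph_def)
  have verts: "pverts G = {..<n}" using assms by (simp add: connected_simple_graph_def)
  have "out_arcs (with_proj G) i = Pair i ` {k. k < n \<and> (i, k) \<in> parcs G}"
    using arc_snd_in_verts verts by (force simp: out_arcs_def)
  then have "out_degree (with_proj G) i = card {k. k < n \<and> (i, k) \<in> parcs G}"
    by (simp add: out_degree_def card_image inj_on_def)
  also have "{k. k < n \<and> (i, k) \<in> parcs G} = {..<n} \<inter> {k. (i, k) \<in> parcs G}" by auto
  finally have "real (out_degree (with_proj G) i) = (\<Sum>k<n. of_bool ((i, k) \<in> parcs G))"
    by (simp add: of_bool_def sum.If_cases)
  then show ?thesis
    using assms(2,3) by (auto simp: laplacian_def degree_mat_def adjacency_mat_def mat_diag_def)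
qed

lemma parcs_sym:
  assumes "connected_simple_graph n G"
  shows "(i, j) \<in> parcs G \<longleftrightarrow> (j, i) \<in> parcs G"
proof -
  interpret pair_graph G using assms by (simp add: connected_simple_graph_def)
  show ?thesis using pair_sym_arcs by (auto simp: symmetric_conv)
qed

lemma laplacian_symmetric:
  assumes "connected_simple_graph n G"
  shows "transpose_mat (laplacian n G) = laplacian n G"
  using laplacian_carrier[of n G] laplacian_index[OF assms] parcs_sym[OF assms]
  by (intro eq_matI) auto

text \<open>This is the Dirichlet form of the graph. Every edge occurs as two ordered pairs, hence
  the factor 2. Its sign shows that the eigenvalues are nonnegative.\<close>

lemma laplacian_quadratic_form:
  assumes "connected_simple_graph n G"
  shows "2 * (\<Sum>i<n. \<Sum>j<n. laplacian n G $$ (i, j) * x i * x j)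
    = (\<Sum>i<n. \<Sum>j<n. of_bool ((i, j) \<in> parcs G) * (x i - x j)\<^sup>2)"
proof -
  define a :: "nat \<Rightarrow> nat \<Rightarrow> real" where "a = (\<lambda>i j. of_bool ((i, j) \<in> parcs G))"
  have sym: "a i j = a j i" for i j using parcs_sym[OF assms] by (auto simp: a_def)
  have "(\<Sum>i<n. \<Sum>j<n. laplacian n G $$ (i, j) * x i * x j)
      = (\<Sum>i<n. \<Sum>j<n. (if j = i then (\<Sum>k<n. a i k) * (x i)\<^sup>2 else 0) - a i j * x i * x j)"
    by (intro sum.cong) (auto simp: laplacian_index[OF assms] a_def power2_eq_square algebra_simps)
  also have "\<dots> = (\<Sum>i<n. \<Sum>j<n. a i j * (x i)\<^sup>2) - (\<Sum>i<n. \<Sum>j<n. a i j * x i * x j)"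
    by (simp add: sum_subtractf sum_distrib_right)
  finally have 1: "(\<Sum>i<n. \<Sum>j<n. laplacian n G $$ (i, j) * x i * x j)
      = (\<Sum>i<n. \<Sum>j<n. a i j * (x i)\<^sup>2) - (\<Sum>i<n. \<Sum>j<n. a i j * x i * x j)" .
  have "(\<Sum>i<n. \<Sum>j<n. a i j * (x j)\<^sup>2) = (\<Sum>i<n. \<Sum>j<n. a j i * (x i)\<^sup>2)"
    by (rule sum.swap)
  then have 2: "(\<Sum>i<n. \<Sum>j<n. a i j * (x j)\<^sup>2) = (\<Sum>i<n. \<Sum>j<n. a i j * (x i)\<^sup>2)"
    by (simp add: sym)
  have "(\<Sum>i<n. \<Sum>j<n. a i j * (x i - x j)\<^sup>2) = (\<Sum>i<n. \<Sum>j<n. a i j * (x i)\<^sup>2)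
      + (\<Sum>i<n. \<Sum>j<n. a i j * (x j)\<^sup>2) - 2 * (\<Sum>i<n. \<Sum>j<n. a i j * x i * x j)"
    by (simp add: power2_diff algebra_simps sum.distrib sum_subtractf sum_distrib_left)
  then have "2 * (\<Sum>i<n. \<Sum>j<n. laplacian n G $$ (i, j) * x i * x j)
      = (\<Sum>i<n. \<Sum>j<n. a i j * (x i - x j)\<^sup>2)"
    unfolding 1 2 by simp
  then show ?thesis by (simp only: a_def)
qed

lemma spectral_decomposition_laplacian:
  assumes "connected_simple_graph n G"
  obtains U where "spectral_decomposition n (laplacian n G) U (laplacian_eigenvalue n G)"
    and "\<And>i j. i \<le> j \<Longrightarrow> j < n \<Longrightarrow> laplacian_eigenvalue n G i \<le> laplacian_eigenvalue n G j"
    and "\<And>i. i < n \<Longrightarrow> 0 \<le> laplacian_eigenvalue n G i"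
proof -
  let ?L = "laplacian n G"
  obtain es where es: "char_poly ?L = (\<Prod>e\<leftarrow>es. [:- e, 1:])" "length es = n"
    using char_poly_of_real_symmetric_splits[OF laplacian_carrier laplacian_symmetric[OF assms]] by blast
  have "proots (\<Prod>p\<leftarrow>map (\<lambda>e. [:- e, 1:]) es. p) = (\<Sum>p\<leftarrow>map (\<lambda>e. [:- e, 1:]) es. proots p)"
    by (rule proots_prod_list) auto
  also have "\<dots> = mset es"
    by (induction es) simp_all
  finally have "proots (\<Prod>e\<leftarrow>es. [:- e, 1:]) = mset es"
    by (simp only: map_ident)
  then have "proots (char_poly ?L) = mset es"
    unfolding es(1) .
  then have roots: "sorted_list_of_multiset (proots (char_poly ?L)) = sort es"
    by simp
  \<comment> \<open>A product over a list depends only on its multiset, so the roots may be listed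
    in increasing order before diagonalising.\<close>
  have "(\<Prod>e\<leftarrow>es. [:- e, 1:]) = (\<Prod>e\<leftarrow>sort es. [:- e, 1:])"
    unfolding prod_mset_prod_list[symmetric] mset_map mset_sort ..
  then obtain U where U: "spectral_decomposition n ?L U ((!) (sort es))"
    using spectral_decomposition_exists[OF laplacian_carrier laplacian_symmetric[OF assms], of "sort es"] es
    by auto
  have ev: "laplacian_eigenvalue n G = (!) (sort es)"
    by (simp add: laplacian_eigenvalue_def roots fun_eq_iff)
  show thesis
  proof
    show *: "spectral_decomposition n ?L U (laplacian_eigenvalue n G)"
      unfolding ev by (rule U)
    show "laplacian_eigenvalue n G i \<le> laplacian_eigenvalue n G j" if "i \<le> j" "j < n" for i j
      unfolding ev using that es(2) by (intro sorted_nth_mono) auto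
    show "0 \<le> laplacian_eigenvalue n G k" if k: "k < n" for k
    proof -
      let ?u = "entries U"
      let ?d = "laplacian_eigenvalue n G"
      have Uc: "U \<in> carrier_mat n n" and L: "?L = U * mat_diag n ?d * transpose_mat U"
        using * by (auto simp: spectral_decomposition_def)
      have orth: "(\<Sum>i<n. ?u i j * ?u i l) = of_bool (j = l)" if "j < n" "l < n" for j l
        using spectral_decomposition_orthonormal(1)[OF *] that by (simp add: orthonormal_cols_def)
      \<comment> \<open>The quadratic form at the \<open>k\<close>-th eigenvector is the
        \<open>k\<close>-th eigenvalue, which thus inherits the sign of the Dirichlet form.\<close>
      have "(\<Sum>i<n. \<Sum>j<n. ?L $$ (i, j) * ?u i k * ?u j k)
          = (\<Sum>i<n. \<Sum>j<n. \<Sum>l<n. ?d l * (?u i l * ?u i k) * (?u j l * ?u j k))"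
        by (intro sum.cong refl) (auto simp: L spectral_form_index[OF Uc] entries_def sum_distrib_left
            sum_distrib_right mult_ac simp del: index_mult_mat)
      also have "\<dots> = (\<Sum>i<n. \<Sum>l<n. \<Sum>j<n. ?d l * (?u i l * ?u i k) * (?u j l * ?u j k))"
        by (rule sum.cong[OF refl]) (rule sum.swap)
      also have "\<dots> = (\<Sum>i<n. \<Sum>l<n. if l = k then ?d k * (?u i k * ?u i k) else 0)"
        using orth k by (intro sum.cong refl) (auto simp flip: sum_distrib_left)
      also have "\<dots> = ?d k"
        using orth k by (simp flip: sum_distrib_left)
      finally have "2 * ?d k = (\<Sum>i<n. \<Sum>j<n. of_bool ((i, j) \<in> parcs G) * (?u i k - ?u j k)\<^sup>2)"
        using laplacian_quadratic_form[OF assms, of "\<lambda>i. ?u i k"] by simp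
      also have "\<dots> \<ge> 0" by (intro sum_nonneg) auto
      finally show ?thesis by simp
    qed
  qed
qed

section \<open>Exponential moments and small balls of Gaussian product laws\<close>

lemma nn_integral_normal_density:
  assumes "0 < \<sigma>"
  shows "(\<integral>\<^sup>+x. ennreal (normal_density \<mu> \<sigma> x) \<partial>lborel) = 1"
proof -
  interpret prob_space "density lborel (\<lambda>x. ennreal (normal_density \<mu> \<sigma> x))"
    by (rule prob_space_normal_density[OF assms])
  show ?thesis using emeasure_space_1 by (simp add: emeasure_density)
qed

lemma emeasure_std_normal_UNIV: "emeasure std_normal UNIV = 1"
  using std_normal.emeasure_space_1 by simp

text \<open>\<open>exp \<bar>x\<bar>\<close> is at most the sum of \<open>exp x\<close> and
  \<open>exp (- x)\<close>; completing the square turns each into \<open>exp (1 / 2)\<close> times a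
  shifted normal density. The exponent 2 is a convenient round bound for
  \<open>2 * exp (1 / 2)\<close>.\<close>

lemma nn_integral_std_normal_exp_abs: "(\<integral>\<^sup>+x. ennreal (exp \<bar>x\<bar>) \<partial>std_normal) \<le> ennreal (exp 2)"
proof -
  have shift: "std_normal_density x * exp (\<mu> * x) = exp (\<mu>\<^sup>2 / 2) * normal_density \<mu> 1 x" for x \<mu> :: real
  proof -
    have "exp (- x\<^sup>2 / 2) * exp (\<mu> * x) = exp (\<mu>\<^sup>2 / 2) * exp (- (x - \<mu>)\<^sup>2 / 2)"
      by (simp add: power2_diff field_simps flip: exp_add)
    then show ?thesis by (simp add: normal_density_def)
  qed
  have "(\<integral>\<^sup>+x. ennreal (exp \<bar>x\<bar>) \<partial>std_normal)
      = (\<integral>\<^sup>+x. ennreal (std_normal_density x * exp \<bar>x\<bar>) \<partial>lborel)"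
    by (simp add: nn_integral_density ennreal_mult)
  also have "\<dots> \<le> (\<integral>\<^sup>+x. ennreal (exp (1 / 2)) * (ennreal (normal_density 1 1 x) + ennreal (normal_density (- 1) 1 x)) \<partial>lborel)"
  proof (rule nn_integral_mono)
    fix x :: real
    have "exp \<bar>x\<bar> \<le> exp (1 * x) + exp (- 1 * x)" by (simp add: abs_if)
    then have "std_normal_density x * exp \<bar>x\<bar> \<le> std_normal_density x * (exp (1 * x) + exp (- 1 * x))"
      by (intro mult_left_mono) auto
    also have "\<dots> = exp (1 / 2) * (normal_density 1 1 x + normal_density (- 1) 1 x)"
      unfolding distrib_left shift by simp
    finally show "ennreal (std_normal_density x * exp \<bar>x\<bar>)
      \<le> ennreal (exp (1 / 2)) * (ennreal (normal_density 1 1 x) + ennreal (normal_density (- 1) 1 x))"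
      by (simp add: ennreal_leI flip: ennreal_plus ennreal_mult)
  qed
  also have "\<dots> = ennreal (exp (1 / 2)) * 2"
    by (simp add: nn_integral_cmult nn_integral_add nn_integral_normal_density)
  also have "\<dots> = ennreal (2 * exp (1 / 2))"
    by (simp add: ennreal_mult mult.commute)
  also have "\<dots> \<le> ennreal (exp 2)"
  proof (rule ennreal_leI)
    have "(2 :: real) \<le> exp 1" using exp_ge_add_one_self[of "1 :: real"] by simp
    then have "2 * exp (1 / 2) \<le> exp 1 * exp (1 :: real)"
      by (intro mult_mono) auto
    then show "2 * exp (1 / 2) \<le> exp (2 :: real)" by (simp flip: exp_add)
  qed
  finally show ?thesis .
qed

text \<open>The integral is the standard deviation \<open>\<sigma> = 1 / sqrt (1 - 2 * t)\<close> of
  a rescaled normal density. The inequality \<open>1 \<le> (1 + 4 * t) * (1 - 2 * t)\<close>, valid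
  for \<open>0 \<le> t \<le> 1 / 4\<close>, gives
  \<open>\<sigma>\<^sup>2 \<le> exp (4 * t)\<close>.\<close>

lemma nn_integral_std_normal_exp_square:
  fixes t :: real
  assumes "0 \<le> t" "t \<le> 1 / 4"
  shows "(\<integral>\<^sup>+x. ennreal (exp (t * x\<^sup>2)) \<partial>std_normal) \<le> ennreal (exp (2 * t))"
proof -
  define \<sigma> where "\<sigma> = 1 / sqrt (1 - 2 * t)"
  have \<sigma>: "\<sigma> > 0" "\<sigma>\<^sup>2 = 1 / (1 - 2 * t)"
    using assms by (auto simp: \<sigma>_def power_divide)
  have eq: "std_normal_density x * exp (t * x\<^sup>2) = \<sigma> * normal_density 0 \<sigma> x" for x
  proof -
    have "\<sigma> * normal_density 0 \<sigma> x = \<sigma> / (sqrt (2 * pi) * \<sigma>) * exp (- x\<^sup>2 * (1 - 2 * t) / 2)"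
    proof -
      have "sqrt (2 * pi * \<sigma>\<^sup>2) = sqrt (2 * pi) * \<sigma>"
        using \<sigma>(1) by (simp add: real_sqrt_mult)
      moreover have "- (x - 0)\<^sup>2 / (2 * \<sigma>\<^sup>2) = - x\<^sup>2 * (1 - 2 * t) / 2"
        by (simp add: \<sigma>(2))
      ultimately show ?thesis unfolding normal_density_def by simp
    qed
    also have "\<dots> = 1 / sqrt (2 * pi) * exp (- x\<^sup>2 / 2 + t * x\<^sup>2)"
      using \<sigma>(1) by (simp add: field_simps)
    also have "\<dots> = std_normal_density x * exp (t * x\<^sup>2)"
      unfolding std_normal_density_def exp_add by simp
    finally show ?thesis by simp
  qed
  have "(\<integral>\<^sup>+x. ennreal (exp (t * x\<^sup>2)) \<partial>std_normal)
      = (\<integral>\<^sup>+x. ennreal \<sigma> * ennreal (normal_density 0 \<sigma> x) \<partial>lborel)"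
    using \<sigma>(1) by (simp add: nn_integral_density eq flip: ennreal_mult)
  also have "\<dots> = ennreal \<sigma>"
    using \<sigma>(1) by (simp add: nn_integral_cmult nn_integral_normal_density)
  also have "\<sigma> \<le> exp (2 * t)"
  proof (rule power2_le_imp_le)
    have "1 \<le> (1 + 4 * t) * (1 - 2 * t)"
    proof -
      have "0 \<le> 2 * t * (1 - 4 * t)" using assms by simp
      then show ?thesis by (simp add: algebra_simps)
    qed
    also have "\<dots> \<le> exp (4 * t) * (1 - 2 * t)"
      using assms exp_ge_add_one_self[of "4 * t"] by (intro mult_right_mono) auto
    finally have "1 / (1 - 2 * t) \<le> exp (4 * t)"
      using assms by (simp add: field_simps)
    then show "\<sigma>\<^sup>2 \<le> (exp (2 * t))\<^sup>2"
      by (simp add: \<sigma>(2) flip: exp_double)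
  qed simp
  finally show ?thesis by (simp add: ennreal_leI)
qed

lemma nn_integral_std_normal_square: "(\<integral>\<^sup>+x. ennreal (x\<^sup>2) \<partial>std_normal) = 1"
proof -
  have *: "has_bochner_integral lborel (\<lambda>x. std_normal_density x * x\<^sup>2) 1"
    using std_normal_moment_even[of 1] by simp
  have "(\<integral>\<^sup>+x. ennreal (x\<^sup>2) \<partial>std_normal) = (\<integral>\<^sup>+x. ennreal (std_normal_density x * x\<^sup>2) \<partial>lborel)"
    by (simp add: nn_integral_density ennreal_mult)
  also have "\<dots> = ennreal 1"
    using * by (subst nn_integral_eq_integral) (auto simp: has_bochner_integral_iff)
  finally show ?thesis by simp
qed

text \<open>The interval has length \<open>2 / s\<close>, and on it
  \<open>z\<^sup>2 / 2 \<le> (g\<^sup>2 + 1) / s\<^sup>2\<close>, which bounds the density from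
  below. The normalising constant is absorbed by \<open>sqrt (2 * pi) \<le> 4\<close>, so that
  \<open>2 / (s * sqrt (2 * pi))\<close> is at least \<open>1 / (1 + 2 * s)\<close>.\<close>

lemma emeasure_std_normal_interval_ge:
  fixes s g :: real
  assumes s: "0 < s"
  shows "ennreal (exp (- (ln (1 + 2 * s) + (g\<^sup>2 + 1) / s\<^sup>2))) \<le> emeasure std_normal {z. \<bar>s * z - g\<bar> \<le> 1}"
proof -
  let ?I = "{(g - 1) / s..(g + 1) / s}"
  let ?c = "1 / sqrt (2 * pi) * exp (- (g\<^sup>2 + 1) / s\<^sup>2)"
  have I: "{z. \<bar>s * z - g\<bar> \<le> 1} = ?I"
    using s by (auto simp: abs_le_iff field_simps)
  have lower: "?c \<le> std_normal_density z" if "z \<in> ?I" for z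
  proof -
    have "\<bar>s * z - g\<bar> \<le> 1" using that I by blast
    then have "(s * z - g)\<^sup>2 \<le> 1" by (simp add: abs_square_le_1)
    moreover have "(s * z)\<^sup>2 \<le> 2 * (s * z - g)\<^sup>2 + 2 * g\<^sup>2"
      using zero_le_power2[of "s * z - 2 * g"] by (simp add: power2_eq_square algebra_simps)
    ultimately have "s\<^sup>2 * z\<^sup>2 \<le> 2 * (g\<^sup>2 + 1)" by (simp add: power_mult_distrib)
    then have "z\<^sup>2 / 2 \<le> (g\<^sup>2 + 1) / s\<^sup>2" using s by (simp add: field_simps)
    then have "- (g\<^sup>2 + 1) / s\<^sup>2 \<le> - z\<^sup>2 / 2"
      by (simp only: minus_divide_left[symmetric] neg_le_iff_le)
    then have "exp (- (g\<^sup>2 + 1) / s\<^sup>2) \<le> exp (- z\<^sup>2 / 2)" by (simp only: exp_le_cancel_iff)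
    then show ?thesis
      unfolding std_normal_density_def by (intro mult_left_mono) simp_all
  qed
  have "sqrt (2 * pi) \<le> 4"
    using pi_less_4 by (intro real_le_lsqrt) auto
  then have "1 / (1 + 2 * s) \<le> 2 / s * (1 / sqrt (2 * pi))"
  proof -
    assume "sqrt (2 * pi) \<le> 4"
    then have "s * sqrt (2 * pi) \<le> s * 4" using s by (intro mult_left_mono) auto
    then have "s * sqrt (2 * pi) \<le> 2 * (1 + 2 * s)" by (rule order_trans) simp
    then show ?thesis using s by (simp add: field_simps)
  qed
  then have "1 / (1 + 2 * s) * exp (- ((g\<^sup>2 + 1) / s\<^sup>2)) \<le> 2 / s * (1 / sqrt (2 * pi)) * exp (- ((g\<^sup>2 + 1) / s\<^sup>2))"
    by (rule mult_right_mono) simp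
  moreover have "exp (- (ln (1 + 2 * s) + (g\<^sup>2 + 1) / s\<^sup>2)) = 1 / (1 + 2 * s) * exp (- ((g\<^sup>2 + 1) / s\<^sup>2))"
    unfolding minus_add_distrib exp_add using s by (simp add: exp_minus inverse_eq_divide)
  ultimately have "exp (- (ln (1 + 2 * s) + (g\<^sup>2 + 1) / s\<^sup>2)) \<le> 2 / s * ?c"
    by (simp only: minus_divide_left mult.assoc)
  then have "ennreal (exp (- (ln (1 + 2 * s) + (g\<^sup>2 + 1) / s\<^sup>2))) \<le> ennreal (?c * (2 / s))"
    by (simp add: ennreal_leI mult.commute)
  also have "\<dots> = ennreal ?c * emeasure lborel ?I"
  proof -
    have "emeasure lborel ?I = ennreal (2 / s)"
      using s by (simp add: divide_right_mono flip: diff_divide_distrib)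
    then show ?thesis using s by (simp only:) (rule ennreal_mult, auto)
  qed
  also have "\<dots> = (\<integral>\<^sup>+z. ennreal ?c * indicator ?I z \<partial>lborel)"
    by (simp add: nn_integral_cmult_indicator)
  also have "\<dots> \<le> (\<integral>\<^sup>+z. ennreal (std_normal_density z) * indicator ?I z \<partial>lborel)"
    using lower by (intro nn_integral_mono) (auto simp: indicator_def intro: ennreal_leI)
  also have "\<dots> = emeasure std_normal ?I"
    by (simp add: emeasure_density)
  finally show ?thesis by (simp add: I)
qed

text \<open>Markov's inequality for the exponential of the sum, whose integral factorises over the
  coordinates; those outside \<open>H\<close> contribute 1. A Chernoff parameter is supplied by
  scaling \<open>f\<close> and \<open>a\<close>.\<close>

lemma std_normal_PiM_chernoff:
  fixes f :: "nat \<Rightarrow> real \<Rightarrow> real"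
  assumes H: "H \<subseteq> {..<n}" and [measurable]: "\<And>j. j \<in> H \<Longrightarrow> f j \<in> borel_measurable borel"
    and m: "\<And>j. j \<in> H \<Longrightarrow> (\<integral>\<^sup>+x. ennreal (exp (f j x)) \<partial>std_normal) \<le> ennreal (exp (m j))"
  shows "emeasure (std_normal_PiM n) {z \<in> space (std_normal_PiM n). a < (\<Sum>j\<in>H. f j (z j))}
    \<le> ennreal (exp (- a + (\<Sum>j\<in>H. m j)))"
proof -
  let ?P = "std_normal_PiM n"
  have fin: "finite H" using H finite_subset by blast
  have meas: "(\<lambda>z. \<Sum>j\<in>H. f j (z j)) \<in> borel_measurable ?P"
  proof (rule borel_measurable_sum)
    fix j assume j: "j \<in> H"
    have "(\<lambda>z. z j) \<in> ?P \<rightarrow>\<^sub>M std_normal" using H j by (intro measurable_component_singleton) auto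
    then show "(\<lambda>z. f j (z j)) \<in> borel_measurable ?P"
      using j by (auto intro: measurable_compose)
  qed
  let ?h = "\<lambda>j x. if j \<in> H then ennreal (exp (f j x)) else 1"
  have "emeasure ?P {z \<in> space ?P. a < (\<Sum>j\<in>H. f j (z j))}
      = (\<integral>\<^sup>+z. indicator {z \<in> space ?P. a < (\<Sum>j\<in>H. f j (z j))} z \<partial>?P)"
    using meas by (intro nn_integral_indicator[symmetric] borel_measurable_less) auto
  also have "\<dots> \<le> (\<integral>\<^sup>+z. ennreal (exp (- a)) * (\<Prod>j<n. ?h j (z j)) \<partial>?P)"
  proof (rule nn_integral_mono)
    fix z
    have "(\<Prod>j<n. ?h j (z j)) = (\<Prod>j\<in>H. ennreal (exp (f j (z j))))"
      using H by (simp add: prod.If_cases Int_absorb1)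
    also have "\<dots> = ennreal (exp (\<Sum>j\<in>H. f j (z j)))"
      using fin by (simp add: prod_ennreal exp_sum)
    finally have "ennreal (exp (- a)) * (\<Prod>j<n. ?h j (z j)) = ennreal (exp ((\<Sum>j\<in>H. f j (z j)) - a))"
      by (simp add: mult_exp_exp flip: ennreal_mult)
    then show "indicator {z \<in> space ?P. a < (\<Sum>j\<in>H. f j (z j))} z
      \<le> ennreal (exp (- a)) * (\<Prod>j<n. ?h j (z j))"
      by (auto simp: indicator_def)
  qed
  also have "\<dots> = ennreal (exp (- a)) * (\<integral>\<^sup>+z. (\<Prod>j<n. ?h j (z j)) \<partial>?P)"
  proof (rule nn_integral_cmult)
    show "(\<lambda>z. \<Prod>j<n. ?h j (z j)) \<in> borel_measurable ?P"
    proof (rule borel_measurable_prod_ennreal)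
      fix j assume j: "j \<in> {..<n}"
      have "?h j \<in> borel_measurable std_normal" by (cases "j \<in> H") auto
      then show "(\<lambda>z. ?h j (z j)) \<in> borel_measurable ?P"
        using j by (intro measurable_compose[OF measurable_component_singleton])
    qed
  qed
  also have "(\<integral>\<^sup>+z. (\<Prod>j<n. ?h j (z j)) \<partial>?P) = (\<Prod>j<n. \<integral>\<^sup>+x. ?h j x \<partial>std_normal)"
  proof (rule std_normal_PiM.product_nn_integral_prod)
    fix j show "?h j \<in> borel_measurable std_normal" by (cases "j \<in> H") auto
  qed simp
  also have "\<dots> \<le> (\<Prod>j<n. if j \<in> H then ennreal (exp (m j)) else 1)"
    using m by (intro prod_mono_ennreal) (auto simp: emeasure_std_normal_UNIV)
  also have "\<dots> = ennreal (exp (\<Sum>j\<in>H. m j))"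
    using H fin by (simp add: prod.If_cases Int_absorb1 prod_ennreal exp_sum)
  finally show ?thesis
    by (simp add: mult_left_mono mult_exp_exp flip: ennreal_mult)
qed

text \<open>
  The event for the coordinates in \<open>A\<close> is independent of the remaining coordinates, so that Markov's
  inequality for these holds on this event as well and costs a factor of at most \<open>1/2\<close>.
\<close>

lemma std_normal_PiM_small_ball:
  fixes s g :: "nat \<Rightarrow> real"
  assumes A: "A \<subseteq> {..<n}" and s: "\<And>j. j \<in> A \<Longrightarrow> 0 < s j"
    and S: "(\<Sum>j\<in>{..<n} - A. (s j)\<^sup>2) \<le> S" "0 < S"
  shows "ennreal (exp (- (\<Sum>j\<in>A. ln (1 + 2 * s j) + ((g j)\<^sup>2 + 1) / (s j)\<^sup>2)) / 2)
    \<le> emeasure (std_normal_PiM n) {z \<in> space (std_normal_PiM n).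
        (\<forall>j\<in>A. \<bar>s j * z j - g j\<bar> \<le> 1) \<and> (\<Sum>j\<in>{..<n} - A. (s j * z j)\<^sup>2) \<le> 2 * S}"
proof -
  let ?P = "std_normal_PiM n"
  let ?B = "{..<n} - A"
  let ?I = "\<lambda>j. {z. \<bar>s j * z - g j\<bar> \<le> 1}"
  have fin: "finite A" using A finite_subset by blast
  have comp: "(\<lambda>z. z j) \<in> borel_measurable ?P" if "j < n" for j
    using measurable_component_singleton[of j "{..<n}" "\<lambda>_. std_normal"] that by simp
  \<comment> \<open>Factors 1 outside \<open>A\<close> turn the indicator of the event for
    \<open>A\<close> into a product over all coordinates, which can be integrated coordinate by
    coordinate.\<close>
  let ?a = "\<lambda>j x. if j \<in> A then indicator (?I j) x else (1 :: ennreal)"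
  define ind where "ind = (\<lambda>z. \<Prod>j<n. ?a j (z j))"
  define p where "p = (\<Prod>j\<in>A. emeasure std_normal (?I j))"
  have m_a: "?a j \<in> borel_measurable borel" for j
    by (cases "j \<in> A") auto
  have m_ind: "ind \<in> borel_measurable ?P"
    unfolding ind_def
    by (intro borel_measurable_prod_ennreal) (auto intro!: measurable_compose[OF comp m_a])
  have ind01: "ind z = (if \<forall>j\<in>A. z j \<in> ?I j then 1 else 0)" for z
  proof -
    have "ind z = (\<Prod>j\<in>A. indicator (?I j) (z j))"
      using A by (simp add: ind_def prod.If_cases Int_absorb1)
    then show ?thesis
      using fin by (auto simp: indicator_def split: if_splits)
  qed
  have int_ind: "(\<integral>\<^sup>+z. ind z \<partial>?P) = p"
  proof -
    have "(\<integral>\<^sup>+z. ind z \<partial>?P) = (\<Prod>j<n. \<integral>\<^sup>+x. ?a j x \<partial>std_normal)"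
      unfolding ind_def using m_a by (intro std_normal_PiM.product_nn_integral_prod) auto
    also have "\<dots> = (\<Prod>j<n. if j \<in> A then emeasure std_normal (?I j) else 1)"
      by (intro prod.cong) (auto simp: emeasure_std_normal_UNIV)
    also have "\<dots> = p"
      using A by (simp add: p_def prod.If_cases Int_absorb1)
    finally show ?thesis .
  qed
  \<comment> \<open>The factor 1 at \<open>k\<close> is exchanged for the square, whose mean is 1 as
    well.\<close>
  have int_sq: "(\<integral>\<^sup>+z. ind z * ennreal ((z k)\<^sup>2) \<partial>?P) = p" if k: "k \<in> ?B" for k
  proof -
    let ?b = "\<lambda>j x. if j = k then ennreal (x\<^sup>2) else ?a j x"
    have "ind z * ennreal ((z k)\<^sup>2) = (\<Prod>j<n. ?b j (z j))" for z
    proof -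
      have "ind z = (\<Prod>j\<in>{..<n} - {k}. ?a j (z j))"
        using k by (simp add: ind_def prod.remove[of "{..<n}" k])
      then show ?thesis
        using k by (simp add: prod.remove[of "{..<n}" k] mult.commute)
    qed
    then have "(\<integral>\<^sup>+z. ind z * ennreal ((z k)\<^sup>2) \<partial>?P) = (\<integral>\<^sup>+z. (\<Prod>j<n. ?b j (z j)) \<partial>?P)" by simp
    also have "\<dots> = (\<Prod>j<n. \<integral>\<^sup>+x. ?b j x \<partial>std_normal)"
    proof (rule std_normal_PiM.product_nn_integral_prod)
      fix j show "?b j \<in> borel_measurable std_normal"
        using m_a[of j] by (cases "j = k") auto
    qed simp
    also have "\<dots> = (\<Prod>j<n. if j \<in> A then emeasure std_normal (?I j) else 1)"
    proof (intro prod.cong refl)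
      fix j
      show "(\<integral>\<^sup>+x. ?b j x \<partial>std_normal) = (if j \<in> A then emeasure std_normal (?I j) else 1)"
        using k by (cases "j = k"; cases "j \<in> A")
          (simp_all add: emeasure_std_normal_UNIV nn_integral_std_normal_square)
    qed
    also have "\<dots> = p"
      using A by (simp add: p_def prod.If_cases Int_absorb1)
    finally show ?thesis .
  qed
  let ?E = "{z \<in> space ?P. (\<forall>j\<in>A. \<bar>s j * z j - g j\<bar> \<le> 1) \<and> (\<Sum>j\<in>?B. (s j * z j)\<^sup>2) \<le> 2 * S}"
  let ?q = "\<lambda>z. \<Sum>j\<in>?B. (s j * z j)\<^sup>2"
  have m_q: "?q \<in> borel_measurable ?P"
    by (intro borel_measurable_sum) (auto intro!: borel_measurable_power borel_measurable_times comp)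
  have E: "?E \<in> sets ?P"
  proof -
    have "?E = {z \<in> space ?P. ind z = 1} \<inter> {z \<in> space ?P. ?q z \<le> 2 * S}"
      by (auto simp: ind01)
    also have "\<dots> \<in> sets ?P"
      using m_ind m_q by measurable
    finally show ?thesis .
  qed
  \<comment> \<open>On the event for \<open>A\<close>, either \<open>z\<close> lies in
    \<open>?E\<close> or \<open>?q z / (2 * S)\<close> is at least 1. Since \<open>S\<close> bounds
    the mean of \<open>?q\<close>, the second term integrates to at most
    \<open>p / 2\<close>.\<close>
  have "p \<le> (\<integral>\<^sup>+z. indicator ?E z + ennreal (1 / (2 * S)) * (\<Sum>k\<in>?B. ennreal ((s k)\<^sup>2) * (ind z * ennreal ((z k)\<^sup>2))) \<partial>?P)"
    unfolding int_ind[symmetric]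
  proof (rule nn_integral_mono)
    fix z assume z: "z \<in> space ?P"
    have "(\<Sum>k\<in>?B. ennreal ((s k)\<^sup>2) * (ind z * ennreal ((z k)\<^sup>2)))
        = ind z * ennreal (?q z)"
      by (simp add: sum_distrib_left sum_ennreal[symmetric] power_mult_distrib ennreal_mult mult_ac del: sum_ennreal)
    moreover have "1 \<le> ennreal (1 / (2 * S)) * ennreal (?q z)" if "\<not> ?q z \<le> 2 * S"
      using that S(2) by (simp add: sum_nonneg flip: ennreal_mult)
    ultimately show "ind z \<le> indicator ?E z + ennreal (1 / (2 * S)) * (\<Sum>k\<in>?B. ennreal ((s k)\<^sup>2) * (ind z * ennreal ((z k)\<^sup>2)))"
      using z by (auto simp: ind01 indicator_def)
  qed
  also have "\<dots> = emeasure ?P ?E + ennreal (1 / (2 * S)) * (\<Sum>k\<in>?B. ennreal ((s k)\<^sup>2) * p)"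
  proof -
    have "(\<integral>\<^sup>+z. (\<Sum>k\<in>?B. ennreal ((s k)\<^sup>2) * (ind z * ennreal ((z k)\<^sup>2))) \<partial>?P) = (\<Sum>k\<in>?B. ennreal ((s k)\<^sup>2) * p)"
      using m_ind int_sq
      by (subst nn_integral_sum) (auto intro!: sum.cong borel_measurable_times_ennreal comp
          simp: nn_integral_cmult)
    moreover have "(\<lambda>z. \<Sum>k\<in>?B. ennreal ((s k)\<^sup>2) * (ind z * ennreal ((z k)\<^sup>2))) \<in> borel_measurable ?P"
      using m_ind by (auto intro!: borel_measurable_sum borel_measurable_times_ennreal comp)
    ultimately show ?thesis
      using E by (simp add: nn_integral_add nn_integral_cmult)
  qed
  also have "(\<Sum>k\<in>?B. ennreal ((s k)\<^sup>2) * p) = ennreal (\<Sum>k\<in>?B. (s k)\<^sup>2) * p"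
    by (simp add: sum_ennreal[symmetric] sum_distrib_right del: sum_ennreal)
  also have "ennreal (1 / (2 * S)) * (ennreal (\<Sum>k\<in>?B. (s k)\<^sup>2) * p) \<le> ennreal (1 / 2) * p"
  proof -
    have "ennreal (1 / (2 * S)) * ennreal (\<Sum>k\<in>?B. (s k)\<^sup>2) \<le> ennreal (1 / 2)"
    proof -
      have "1 / (2 * S) * (\<Sum>k\<in>?B. (s k)\<^sup>2) \<le> 1 / 2"
        using S by (simp add: field_simps)
      moreover have "ennreal (1 / (2 * S) * (\<Sum>k\<in>?B. (s k)\<^sup>2)) = ennreal (1 / (2 * S)) * ennreal (\<Sum>k\<in>?B. (s k)\<^sup>2)"
        using S(2) by (intro ennreal_mult sum_nonneg) auto
      ultimately show ?thesis by (metis ennreal_leI)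
    qed
    then show ?thesis by (metis mult.assoc mult_right_mono zero_le)
  qed
  finally have "p \<le> emeasure ?P ?E + ennreal (1 / 2) * p" by (simp add: add_left_mono)
  moreover have "p \<le> 1"
  proof -
    have "p \<le> (\<Prod>j\<in>A. 1)"
      unfolding p_def by (intro prod_mono_ennreal std_normal.emeasure_le_1)
    then show ?thesis by simp
  qed
  ultimately have half: "ennreal (1 / 2) * p \<le> emeasure ?P ?E"
  proof -
    assume le: "p \<le> emeasure ?P ?E + ennreal (1 / 2) * p" and "p \<le> 1"
    \<comment> \<open>Finiteness of \<open>p\<close> permits subtracting \<open>p / 2\<close> from
      both sides.\<close>
    then have "p \<noteq> \<top>" by (auto simp: top_unique)
    then obtain p' where p': "p = ennreal p'" "0 \<le> p'" by (cases p) auto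
    have h: "ennreal (1 / 2) * p = ennreal (1 / 2 * p')"
      unfolding p' using p'(2) by (intro ennreal_mult[symmetric]) auto
    show ?thesis
    proof (cases "emeasure ?P ?E")
      case (real e)
      have "ennreal p' \<le> ennreal (e + 1 / 2 * p')"
        using le unfolding h unfolding real(2) p' using real(1) p'(2) by (subst ennreal_plus) auto
      then have "p' \<le> e + 1 / 2 * p'"
        using real(1) p'(2) by (subst (asm) ennreal_le_iff) auto
      then show ?thesis unfolding h real(2) by (intro ennreal_leI) simp
    qed simp
  qed
  have "exp (- (\<Sum>j\<in>A. ln (1 + 2 * s j) + ((g j)\<^sup>2 + 1) / (s j)\<^sup>2)) = (\<Prod>j\<in>A. exp (- (ln (1 + 2 * s j) + ((g j)\<^sup>2 + 1) / (s j)\<^sup>2)))"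
    using fin by (simp add: exp_sum flip: sum_negf)
  then have "ennreal (exp (- (\<Sum>j\<in>A. ln (1 + 2 * s j) + ((g j)\<^sup>2 + 1) / (s j)\<^sup>2)))
      = (\<Prod>j\<in>A. ennreal (exp (- (ln (1 + 2 * s j) + ((g j)\<^sup>2 + 1) / (s j)\<^sup>2))))"
    by (simp only: prod_ennreal exp_ge_zero)
  also have "\<dots> \<le> p"
    unfolding p_def by (intro prod_mono_ennreal emeasure_std_normal_interval_ge s)
  finally have "ennreal (exp (- (\<Sum>j\<in>A. ln (1 + 2 * s j) + ((g j)\<^sup>2 + 1) / (s j)\<^sup>2))) \<le> p" .
  then have "ennreal (1 / 2) * ennreal (exp (- (\<Sum>j\<in>A. ln (1 + 2 * s j) + ((g j)\<^sup>2 + 1) / (s j)\<^sup>2))) \<le> ennreal (1 / 2) * p"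
    by (rule mult_left_mono) simp
  also note half
  also have "ennreal (1 / 2) * ennreal (exp (- (\<Sum>j\<in>A. ln (1 + 2 * s j) + ((g j)\<^sup>2 + 1) / (s j)\<^sup>2)))
      = ennreal (exp (- (\<Sum>j\<in>A. ln (1 + 2 * s j) + ((g j)\<^sup>2 + 1) / (s j)\<^sup>2)) / 2)"
    by (subst ennreal_mult[symmetric]) auto
  finally show ?thesis .
qed

section \<open>Entropy of the sieve\<close>

text \<open>A two-sided geometric series with ratio \<open>q = exp (- 1 / \<sigma>)\<close>. From
  \<open>exp (1 / \<sigma>) \<ge> 1 + 1 / \<sigma>\<close> follows
  \<open>q \<le> \<sigma> * (1 - q)\<close>, and the factor \<open>1 - q ^ m\<close> strengthens the
  claim enough for induction.\<close>

lemma sum_exp_int_interval_le: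
  fixes \<sigma> :: real
  assumes \<sigma>: "0 < \<sigma>"
  shows "(\<Sum>i\<in>{- int m..int m}. exp (- \<bar>real_of_int i\<bar> / \<sigma>)) \<le> 1 + 2 * \<sigma>"
proof -
  define q where "q = exp (- 1 / \<sigma>)"
  have q: "0 < q" by (simp add: q_def)
  have "q * (1 + 1 / \<sigma>) \<le> q * exp (1 / \<sigma>)"
    using q exp_ge_add_one_self[of "1 / \<sigma>"] by (intro mult_left_mono) auto
  also have "\<dots> = 1" by (simp add: q_def flip: exp_add)
  finally have q\<sigma>: "q \<le> \<sigma> * (1 - q)" using \<sigma> by (simp add: field_simps)
  define f where "f = (\<lambda>i. exp (- \<bar>real_of_int i\<bar> / \<sigma>))"
  have "sum f {- int m..int m} \<le> 1 + 2 * \<sigma> * (1 - q ^ m)"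
  proof (induction m)
    case (Suc m)
    have eq: "{- int (Suc m)..int (Suc m)} = insert (- int (Suc m)) (insert (int (Suc m)) {- int m..int m})"
      by auto
    have pow: "exp (- real (Suc m) / \<sigma>) = q ^ Suc m"
      unfolding q_def exp_of_nat_mult[symmetric] using \<sigma> by (simp add: field_simps)
    have "f (- int (Suc m)) = q ^ Suc m" "f (int (Suc m)) = q ^ Suc m"
      unfolding f_def pow[symmetric] by (simp_all only: of_int_minus abs_minus_cancel of_int_of_nat_eq abs_of_nat)
    then have "sum f {- int (Suc m)..int (Suc m)} = 2 * (q ^ m * q) + sum f {- int m..int m}"
      unfolding eq by (subst sum.insert, simp, simp, subst sum.insert) auto
    also have "\<dots> \<le> 2 * (q ^ m * q) + (1 + 2 * \<sigma> * (1 - q ^ m))"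
      using Suc.IH by simp
    also have "q ^ m * q \<le> q ^ m * (\<sigma> * (1 - q))"
      using q q\<sigma> by (intro mult_left_mono) auto
    finally show ?case by (simp add: algebra_simps)
  qed (simp add: f_def)
  also have "\<dots> \<le> 1 + 2 * \<sigma>" using \<sigma> q by simp
  finally show ?thesis by (simp add: f_def)
qed

text \<open>
  Markov's inequality for the counting measure, with the exponential weight
  \<open>exp (R - (\<Sum>j\<in>A. \<bar>k j\<bar> / \<sigma> j)) \<ge> 1\<close>.
\<close>

lemma card_lattice_points_le:
  fixes \<sigma> :: "nat \<Rightarrow> real" and R :: real
  assumes A: "finite A" and \<sigma>: "\<And>j. j \<in> A \<Longrightarrow> 0 < \<sigma> j"
  defines "Z \<equiv> {k \<in> A \<rightarrow>\<^sub>E (UNIV :: int set). (\<Sum>j\<in>A. \<bar>real_of_int (k j)\<bar> / \<sigma> j) \<le> R}"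
  shows "finite Z" "real (card Z) \<le> exp (R + (\<Sum>j\<in>A. ln (1 + 2 * \<sigma> j)))"
proof -
  \<comment> \<open>For a point of \<open>Z\<close> each \<open>\<bar>k j\<bar>\<close> is at most
    \<open>\<sigma> j * R\<close>, so \<open>Z\<close> lies in a finite box, over which the sum of
    the weights factorises.\<close>
  define m where "m = (\<lambda>j. nat \<lceil>\<sigma> j * R\<rceil>)"
  let ?Q = "PiE A (\<lambda>j. {- int (m j)..int (m j)})"
  have sub: "Z \<subseteq> ?Q"
  proof
    fix k assume k: "k \<in> Z"
    have "k j \<in> {- int (m j)..int (m j)}" if j: "j \<in> A" for j
    proof -
      have "\<bar>real_of_int (k j)\<bar> / \<sigma> j \<le> (\<Sum>j\<in>A. \<bar>real_of_int (k j)\<bar> / \<sigma> j)"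
        using j A by (intro member_le_sum) (auto intro!: divide_nonneg_pos \<sigma>)
      also have "\<dots> \<le> R" using k by (simp add: Z_def)
      finally have "\<bar>real_of_int (k j)\<bar> \<le> \<sigma> j * R" using \<sigma>[OF j] by (simp add: field_simps)
      then show ?thesis unfolding m_def by (simp add: abs_le_iff) linarith
    qed
    then show "k \<in> ?Q" using k by (auto simp: Z_def PiE_def)
  qed
  have finQ: "finite ?Q" using A by (intro finite_PiE) auto
  show fin: "finite Z" using sub finQ by (rule finite_subset)
  have "real (card Z) = (\<Sum>k\<in>Z. 1)" by simp
  also have "\<dots> \<le> (\<Sum>k\<in>Z. exp (R - (\<Sum>j\<in>A. \<bar>real_of_int (k j)\<bar> / \<sigma> j)))"
    by (intro sum_mono) (auto simp: Z_def)
  also have "\<dots> \<le> (\<Sum>k\<in>?Q. exp (R - (\<Sum>j\<in>A. \<bar>real_of_int (k j)\<bar> / \<sigma> j)))"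
    using sub finQ by (intro sum_mono2) auto
  also have "\<dots> = exp R * (\<Sum>k\<in>?Q. \<Prod>j\<in>A. exp (- \<bar>real_of_int (k j)\<bar> / \<sigma> j))"
    using A by (simp add: sum_distrib_left exp_diff exp_minus inverse_eq_divide prod_dividef exp_sum)
  also have "(\<Sum>k\<in>?Q. \<Prod>j\<in>A. exp (- \<bar>real_of_int (k j)\<bar> / \<sigma> j))
      = (\<Prod>j\<in>A. \<Sum>i\<in>{- int (m j)..int (m j)}. exp (- \<bar>real_of_int i\<bar> / \<sigma> j))"
    using A by (intro prod_sum_PiE[symmetric]) auto
  also have "\<dots> \<le> (\<Prod>j\<in>A. 1 + 2 * \<sigma> j)"
    by (intro prod_mono conjI sum_nonneg sum_exp_int_interval_le \<sigma>) auto
  also have "\<dots> = exp (\<Sum>j\<in>A. ln (1 + 2 * \<sigma> j))"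
    using A \<sigma> by (subst exp_sum) (auto intro!: prod.cong simp: add_pos_pos)
  finally show "real (card Z) \<le> exp (R + (\<Sum>j\<in>A. ln (1 + 2 * \<sigma> j)))"
    by (simp add: exp_add)
qed

text \<open>Rounding towards zero does not increase absolute values, so the rounded coefficients
  still satisfy the weighted \<open>l^1\<close> bound; rounding to the nearest integer could violate
  it.\<close>

lemma round_to_zero:
  fixes y :: real
  obtains k :: int where "\<bar>real_of_int k\<bar> \<le> \<bar>y\<bar>" "(y - real_of_int k)\<^sup>2 \<le> 1"
proof (cases "0 \<le> y")
  case True
  then show thesis
    by (intro that[of "\<lfloor>y\<rfloor>"]) (auto simp: abs_square_le_1 abs_le_iff le_floor_iff, linarith+)
next
  case False
  then show thesis
    by (intro that[of "\<lceil>y\<rceil>"]) (auto simp: abs_square_le_1 abs_le_iff, linarith+)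
qed

lemma lin_map_lin_map_transpose:
  assumes "orthonormal_cols n (\<lambda>i j. u j i)" "h \<in> space (Rn n)"
  shows "lin_map n u (lin_map n (\<lambda>i j. u j i) h) = h"
proof
  fix i
  show "lin_map n u (lin_map n (\<lambda>i j. u j i) h) i = h i"
  proof (cases "i < n")
    case True
    then show ?thesis using lin_map_transpose_lin_map[OF assms(1), of i h] by simp
  next
    case False
    then show ?thesis
      using assms(2) by (auto simp: lin_map_def Rn_def space_PiM PiE_def extensional_def)
  qed
qed

lemma norm_n_square:
  "(norm_n n h)\<^sup>2 = (\<Sum>i<n. (h i)\<^sup>2) / real n"
  by (simp add: norm_n_def inner_n_def sum_nonneg power2_eq_square)

lemma norm_n_lin_map_diff:
  assumes "orthonormal_cols n u"
  shows "(norm_n n (\<lambda>i. lin_map n u x i - lin_map n u y i))\<^sup>2 = (\<Sum>j<n. (x j - y j)\<^sup>2) / real n"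
proof -
  have "(\<Sum>i<n. (lin_map n u x i - lin_map n u y i)\<^sup>2)
      = (\<Sum>i<n. lin_map n u (\<lambda>j. x j - y j) i * lin_map n u (\<lambda>j. x j - y j) i)"
    by (intro sum.cong) (auto simp: lin_map_diff power2_eq_square)
  also have "\<dots> = (\<Sum>j<n. (x j - y j)\<^sup>2)"
    using lin_map_inner[OF assms] by (simp add: power2_eq_square)
  finally show ?thesis by (simp add: norm_n_square)
qed

lemma lin_map_in_space: "lin_map n u x \<in> space (Rn n)"
  by (auto simp: lin_map_def Rn_def space_PiM)

lemma ln_enat_le:
  assumes "N \<le> enat k" "real k \<le> exp x"
  shows "ln_enat N \<le> ereal x"
proof (cases N)
  case (enat l)
  then have "l \<le> k" using assms by simp
  show ?thesis
  proof (cases "l = 0")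
    case False
    have "real l \<le> exp x" using \<open>l \<le> k\<close> assms(2) by simp
    then have "ln (real l) \<le> ln (exp x)" using False by (subst ln_le_cancel_iff) auto
    then show ?thesis using enat False by (simp add: ln_enat_def)
  qed (simp add: ln_enat_def enat)
qed (use assms in simp)

text \<open>The weighted \<open>l^1\<close> constraint suits both estimates: under the prior it is a
  tail event for a sum of \<open>\<bar>z j\<bar>\<close>, with finite exponential moments, and for
  lattice points the same exponential weight gives a product of geometric series.\<close>

definition sieve :: "nat \<Rightarrow> (nat \<Rightarrow> nat \<Rightarrow> real) \<Rightarrow> nat set \<Rightarrow> (nat \<Rightarrow> real) \<Rightarrow> real \<Rightarrow> (nat \<Rightarrow> real) set" where
  "sieve n u A \<sigma> R = {h \<in> space (Rn n).
     (\<Sum>j\<in>A. \<bar>lin_map n (\<lambda>i j. u j i) h j\<bar> / \<sigma> j) \<le> R \<and>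
     (\<Sum>j\<in>{..<n} - A. (lin_map n (\<lambda>i j. u j i) h j)\<^sup>2) \<le> R}"

lemma sieve_measurable:
  assumes "A \<subseteq> {..<n}"
  shows "sieve n u A \<sigma> R \<in> sets (Rn n)"
proof -
  have [measurable]: "(\<lambda>h. lin_map n (\<lambda>i j. u j i) h j) \<in> borel_measurable (Rn n)" if "j < n" for j
    unfolding Rn_def
    using measurable_compose[OF measurable_lin_map measurable_component_singleton[of j "{..<n}" "\<lambda>_. borel"]] that
    by simp
  have m1: "(\<lambda>h. \<Sum>j\<in>A. \<bar>lin_map n (\<lambda>i j. u j i) h j\<bar> / \<sigma> j) \<in> borel_measurable (Rn n)"
    using assms by (intro borel_measurable_sum) auto
  have m2: "(\<lambda>h. \<Sum>j\<in>{..<n} - A. (lin_map n (\<lambda>i j. u j i) h j)\<^sup>2) \<in> borel_measurable (Rn n)"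
    by (intro borel_measurable_sum) auto
  show ?thesis unfolding sieve_def using m1 m2 by measurable
qed

text \<open>The centres have integer low coefficients and vanishing high ones. The squared error is
  then at most 1 per low coordinate plus \<open>R\<close> from the high ones, whence the condition
  on \<open>\<epsilon>\<close>; it is strict because the balls are open.\<close>

lemma sieve_entropy:
  assumes u: "orthonormal_cols n u" "orthonormal_cols n (\<lambda>i j. u j i)"
    and A: "A \<subseteq> {..<n}" and \<sigma>: "\<And>j. j \<in> A \<Longrightarrow> 0 < \<sigma> j"
    and n: "0 < n" and \<epsilon>: "0 < \<epsilon>" "real (card A) + R < real n * \<epsilon>\<^sup>2"
  shows "ln_enat (covering_number n \<epsilon> (sieve n u A \<sigma> R)) \<le> ereal (R + (\<Sum>j\<in>A. ln (1 + 2 * \<sigma> j)))"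
proof -
  let ?ut = "\<lambda>i j. u j i"
  have fin: "finite A" using A finite_subset by blast
  define Z where "Z = {k \<in> A \<rightarrow>\<^sub>E (UNIV :: int set). (\<Sum>j\<in>A. \<bar>real_of_int (k j)\<bar> / \<sigma> j) \<le> R}"
  have Z: "finite Z" "real (card Z) \<le> exp (R + (\<Sum>j\<in>A. ln (1 + 2 * \<sigma> j)))"
    using card_lattice_points_le[OF fin, of \<sigma> R] \<sigma> unfolding Z_def by blast+
  let ?x = "\<lambda>k j. if j \<in> A then real_of_int (k j) else 0"
  let ?T = "(\<lambda>k. lin_map n u (?x k)) ` Z"
  have "sieve n u A \<sigma> R \<subseteq> (\<Union>g\<in>?T. ball_n n g \<epsilon>)"
  proof
    fix h assume h: "h \<in> sieve n u A \<sigma> R"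
    define y where "y = lin_map n ?ut h"
    have hs: "h \<in> space (Rn n)" and y1: "(\<Sum>j\<in>A. \<bar>y j\<bar> / \<sigma> j) \<le> R" and y2: "(\<Sum>j\<in>{..<n} - A. (y j)\<^sup>2) \<le> R"
      using h by (auto simp: sieve_def y_def)
    have hy: "h = lin_map n u y"
      unfolding y_def by (rule lin_map_lin_map_transpose[OF u(2) hs, symmetric])
    have "\<forall>j. \<exists>k :: int. \<bar>real_of_int k\<bar> \<le> \<bar>y j\<bar> \<and> (y j - real_of_int k)\<^sup>2 \<le> 1"
      by (meson round_to_zero)
    then obtain k0 :: "nat \<Rightarrow> int" where k0: "\<And>j. \<bar>real_of_int (k0 j)\<bar> \<le> \<bar>y j\<bar>" "\<And>j. (y j - real_of_int (k0 j))\<^sup>2 \<le> 1"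
      by metis
    define k where "k = restrict k0 A"
    have "(\<Sum>j\<in>A. \<bar>real_of_int (k j)\<bar> / \<sigma> j) \<le> (\<Sum>j\<in>A. \<bar>y j\<bar> / \<sigma> j)"
      using k0 \<sigma> by (intro sum_mono divide_right_mono) (auto simp: k_def intro: less_imp_le)
    then have kZ: "k \<in> Z" using y1 by (auto simp: Z_def k_def)
    have "(\<Sum>j<n. (y j - ?x k j)\<^sup>2) = (\<Sum>j\<in>A. (y j - real_of_int (k j))\<^sup>2) + (\<Sum>j\<in>{..<n} - A. (y j)\<^sup>2)"
      by (subst sum.subset_diff[OF A]) auto
    also have "(\<Sum>j\<in>A. (y j - real_of_int (k j))\<^sup>2) \<le> (\<Sum>j\<in>A. 1)"
      using k0 by (intro sum_mono) (auto simp: k_def)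
    finally have "(\<Sum>j<n. (y j - ?x k j)\<^sup>2) < real n * \<epsilon>\<^sup>2"
      using y2 \<epsilon> by simp
    then have "(norm_n n (\<lambda>i. h i - lin_map n u (?x k) i))\<^sup>2 < \<epsilon>\<^sup>2"
      unfolding hy norm_n_lin_map_diff[OF u(1)] using n by (simp add: field_simps)
    then have "norm_n n (\<lambda>i. h i - lin_map n u (?x k) i) < \<epsilon>"
      using \<epsilon>(1) by (simp add: power_less_imp_less_base)
    then have "h \<in> ball_n n (lin_map n u (?x k)) \<epsilon>"
      using hs by (simp add: ball_n_def)
    then show "h \<in> (\<Union>g\<in>?T. ball_n n g \<epsilon>)" using kZ by blast
  qed
  then have "covering_number n \<epsilon> (sieve n u A \<sigma> R) \<le> enat (card ?T)"
    unfolding covering_number_def using Z(1) lin_map_in_space by (intro INF_lower) blast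
  also have "\<dots> \<le> enat (card Z)"
    using card_image_le[OF Z(1)] by simp
  finally show ?thesis using Z(2) by (rule ln_enat_le)
qed

section \<open>Sums over a polynomially growing spectrum\<close>

text \<open>Telescoping: the mean value theorem compares \<open>j powr (- q)\<close> with a
  difference of consecutive values of \<open>x powr (1 - q) / (q - 1)\<close>. The factor
  \<open>2 powr q\<close> comes from \<open>\<xi> < j + 1 \<le> 2 * j\<close>.\<close>

lemma sum_powr_tail_le:
  fixes q :: real
  assumes q: "1 < q" and m: "1 \<le> m" "m \<le> n"
  shows "(\<Sum>j=m..<n. real j powr (- q)) \<le> 2 powr q / (q - 1) * real m powr (1 - q)"
proof -
  define K where "K = 2 powr q / (q - 1)"
  have K: "K > 0" using q by (simp add: K_def)
  have incr: "real j powr (- q) \<le> K * (real j powr (1 - q) - real (Suc j) powr (1 - q))" if j: "1 \<le> j" for j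
  proof -
    have "\<exists>\<xi>::real. real j < \<xi> \<and> \<xi> < real (Suc j) \<and> real (Suc j) powr (1 - q) - real j powr (1 - q)
        = (real (Suc j) - real j) * ((1 - q) * \<xi> powr (1 - q - 1))"
      using j by (intro MVT2) (auto intro!: derivative_eq_intros)
    then obtain \<xi> where \<xi>: "real j < \<xi>" "\<xi> < real (Suc j)"
      and eq: "real j powr (1 - q) - real (Suc j) powr (1 - q) = (q - 1) * \<xi> powr (- q)"
      by (auto simp: algebra_simps)
    have "(2 * real j) powr (- q) \<le> \<xi> powr (- q)"
      using q \<xi> j by (intro powr_mono2') auto
    then have "2 powr (- q) * real j powr (- q) \<le> \<xi> powr (- q)"
      by (simp add: powr_mult)
    then have "K * (q - 1) * (2 powr (- q) * real j powr (- q)) \<le> K * (q - 1) * \<xi> powr (- q)"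
      using K q by (intro mult_left_mono) auto
    moreover have "K * (q - 1) * 2 powr (- q) = 1"
      using q by (simp add: K_def flip: powr_add)
    ultimately show ?thesis unfolding eq by (metis mult.assoc mult_1)
  qed
  have "(\<Sum>j=m..<n. real j powr (- q)) \<le> K * (real m powr (1 - q) - real n powr (1 - q))"
    using m(2)
  proof (induction n rule: dec_induct)
    case (step n)
    then show ?case using \<open>1 \<le> m\<close> incr[of n] by (simp add: algebra_simps)
  qed simp
  also have "\<dots> \<le> K * real m powr (1 - q)"
    using K by (intro mult_left_mono) auto
  finally show ?thesis by (simp add: K_def)
qed

lemma sum_inverse_sqrt_le: "(\<Sum>j=1..m. 1 / sqrt (real j)) \<le> 2 * sqrt (real m)"
proof (induction m)
  case (Suc m)
  have "1 / sqrt (real (Suc m)) \<le> 2 * (sqrt (real (Suc m)) - sqrt (real m))"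
  proof -
    have "1 = (sqrt (real (Suc m)) - sqrt (real m)) * (sqrt (real (Suc m)) + sqrt (real m))"
      by (simp add: algebra_simps)
    also have "\<dots> \<le> (sqrt (real (Suc m)) - sqrt (real m)) * (2 * sqrt (real (Suc m)))"
      by (intro mult_left_mono) auto
    finally show ?thesis by (simp add: field_simps)
  qed
  then show ?case using Suc by simp
qed simp

text \<open>For \<open>y > 1\<close> the bound is \<open>ln 2 + ln y\<close> with
  \<open>ln y = ln (y powr \<theta>) / \<theta>\<close>. A small \<open>\<theta>\<close> will turn a
  power of \<open>J / j\<close> into one whose sum over \<open>j\<close> is of order
  \<open>J\<close>.\<close>

lemma ln_one_plus_le_powr:
  fixes y \<theta> :: real
  assumes "0 < y" "0 < \<theta>"
  shows "ln (1 + y) \<le> 1 + y powr \<theta> / \<theta>"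
proof (cases "y \<le> 1")
  case True
  then have "ln (1 + y) \<le> 1" using assms ln_add_one_self_le_self[of y] by simp
  then show ?thesis using assms by (simp add: add_increasing2)
next
  case False
  then have "ln (1 + y) \<le> ln (2 * y)" by simp
  also have "\<dots> = ln 2 + ln y" using assms by (simp add: ln_mult)
  also have "ln 2 \<le> (1 :: real)" using ln_le_minus_one[of "2 :: real"] by simp
  also have "ln y = ln (y powr \<theta>) / \<theta>" using assms by (simp add: ln_powr)
  also have "\<dots> \<le> y powr \<theta> / \<theta>"
    using assms by (intro divide_right_mono ln_bound) auto
  finally show ?thesis by simp
qed

text \<open>Separates the analysis of the scaled eigenvalues from matrices and graphs. For
  \<open>j < i0\<close> only nonnegativity of \<open>x j\<close> is known; the lower bound on
  \<open>\<delta>\<close> keeps their prior variances polynomial in \<open>n\<close>.\<close>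

locale polynomial_spectrum =
  fixes n i0 :: nat and r p \<kappa> J \<delta> :: real and x :: "nat \<Rightarrow> real"
  assumes r: "0 < r" and p: "r < 2 * p" and \<kappa>: "0 < \<kappa>" and J: "1 \<le> J" "J \<le> real n"
    and \<delta>: "0 < \<delta>" "\<delta> \<le> 1" "1 / (real n)\<^sup>2 \<le> \<delta>"
    and x_nonneg: "\<And>j. j < n \<Longrightarrow> 0 \<le> x j"
    and x_ge: "\<And>j. i0 \<le> j \<Longrightarrow> j < n \<Longrightarrow> \<kappa> * real j powr (2 / r) \<le> x j"
    and i0: "1 \<le> i0"
begin

text \<open>The exponent for which \<open>(scale c j)\<^sup>2\<close> is at most a multiple of
  \<open>(c / j) powr q\<close>. For \<open>p = \<alpha> + r / 2\<close> it is
  \<open>1 + 2 * \<alpha> / r\<close>, so a positive \<open>\<alpha>\<close> makes the tail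
  summable.\<close>

definition q :: real where "q = 2 * p / r"

definition scale :: "real \<Rightarrow> nat \<Rightarrow> real" where
  "scale c j = c powr (q / 2) * (x j + \<delta>) powr (- p / 2)"

definition low :: "nat set" where
  "low = {j. j < n \<and> x j \<le> J powr (2 / r)}"

lemma q: "1 < q" using r p by (simp add: q_def)

lemma p_pos: "0 < p" using r p by simp

lemma n_pos: "1 \<le> real n" using J by simp

lemma low_subset: "low \<subseteq> {..<n}" by (auto simp: low_def)

lemma finite_low: "finite low" using low_subset finite_subset by blast

lemma x\<delta>_pos: "j < n \<Longrightarrow> 0 < x j + \<delta>"
  using x_nonneg \<delta>(1) by (simp add: add_nonneg_pos)

lemma scale_pos: "0 < c \<Longrightarrow> j < n \<Longrightarrow> 0 < scale c j"
  using x\<delta>_pos[of j] by (auto simp: scale_def intro!: mult_pos_pos)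

lemma scale_mono: "0 \<le> c \<Longrightarrow> c \<le> c' \<Longrightarrow> scale c j \<le> scale c' j"
  unfolding scale_def using q by (intro mult_right_mono powr_mono2) auto

lemma scale_square: "0 < c \<Longrightarrow> j < n \<Longrightarrow> (scale c j)\<^sup>2 = c powr q * (x j + \<delta>) powr (- p)"
  by (simp add: scale_def power_mult_distrib powr_powr flip: powr_numeral)

lemma scale_square_high:
  assumes "0 < c" "j < n" "j \<notin> low"
  shows "(scale c j)\<^sup>2 \<le> (c / J) powr q"
proof -
  have "(x j + \<delta>) powr (- p) \<le> (J powr (2 / r)) powr (- p)"
    using assms p_pos \<delta> J by (intro powr_mono2') (auto simp: low_def)
  also have "\<dots> = J powr (- q)" by (simp add: powr_powr q_def)
  finally have "c powr q * (x j + \<delta>) powr (- p) \<le> c powr q * J powr (- q)"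
    by (intro mult_left_mono) auto
  then show ?thesis
    using assms J by (simp add: scale_square powr_divide powr_minus_divide)
qed

lemma scale_square_polynomial:
  assumes "0 < c" "i0 \<le> j" "j < n"
  shows "(scale c j)\<^sup>2 \<le> c powr q * \<kappa> powr (- p) * real j powr (- q)"
proof -
  have j: "1 \<le> j" using i0 assms by simp
  have "(x j + \<delta>) powr (- p) \<le> (\<kappa> * real j powr (2 / r)) powr (- p)"
    using x_ge[OF assms(2,3)] p_pos \<delta> \<kappa> j by (intro powr_mono2') auto
  also have "\<dots> = \<kappa> powr (- p) * real j powr (- q)"
    using \<kappa> by (simp add: powr_mult powr_powr q_def)
  finally have "c powr q * (x j + \<delta>) powr (- p) \<le> c powr q * (\<kappa> powr (- p) * real j powr (- q))"
    by (intro mult_left_mono) auto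
  then show ?thesis using assms by (simp add: scale_square)
qed

text \<open>The sum is split at \<open>m\<close>, of order \<open>J\<close>. Below \<open>m\<close>
  every term is at most \<open>(c / J) powr q\<close> by the definition of \<open>low\<close>; from
  \<open>m\<close> on the polynomial bound applies, and the tail is of order
  \<open>m powr (1 - q) \<le> J powr (1 - q)\<close>.\<close>

lemma sum_scale_square_high:
  assumes c: "0 < c"
  shows "(\<Sum>j\<in>{..<n} - low. (scale c j)\<^sup>2)
    \<le> (real i0 + 2 + \<kappa> powr (- p) * (2 powr q / (q - 1))) * (c / J) powr q * J"
proof -
  define m where "m = nat \<lceil>J\<rceil> + i0"
  have m: "i0 \<le> m" "J \<le> real m" "1 \<le> m" using J i0 by (auto simp: m_def) linarith
  have mJ: "real m \<le> (real i0 + 2) * J"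
  proof -
    have "real m \<le> J + 1 + real i0" using J by (simp add: m_def)
    also have "real i0 \<le> real i0 * J" using J by (simp add: mult_le_cancel_left1)
    finally show ?thesis using J by (simp add: algebra_simps)
  qed
  let ?f = "\<lambda>j. (scale c j)\<^sup>2"
  have "(\<Sum>j\<in>{..<n} - low. ?f j) \<le> (\<Sum>j\<in>{..<m} \<inter> ({..<n} - low). ?f j) + (\<Sum>j=m..<n. ?f j)"
  proof -
    have "{..<n} - low \<subseteq> ({..<m} \<inter> ({..<n} - low)) \<union> {m..<n}" by auto
    then have "(\<Sum>j\<in>{..<n} - low. ?f j) \<le> (\<Sum>j\<in>({..<m} \<inter> ({..<n} - low)) \<union> {m..<n}. ?f j)"
      by (intro sum_mono2) auto
    also have "\<dots> = (\<Sum>j\<in>{..<m} \<inter> ({..<n} - low). ?f j) + (\<Sum>j=m..<n. ?f j)"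
      by (intro sum.union_disjoint) auto
    finally show ?thesis .
  qed
  also have "(\<Sum>j\<in>{..<m} \<inter> ({..<n} - low). ?f j) \<le> (\<Sum>j\<in>{..<m} \<inter> ({..<n} - low). (c / J) powr q)"
    using c by (intro sum_mono scale_square_high) auto
  also have "\<dots> \<le> (\<Sum>j<m. (c / J) powr q)"
    by (intro sum_mono2) auto
  also have "\<dots> \<le> (real i0 + 2) * (c / J) powr q * J"
    using mult_right_mono[OF mJ, of "(c / J) powr q"] by (simp add: mult_ac)
  also have "(\<Sum>j=m..<n. ?f j) \<le> \<kappa> powr (- p) * (2 powr q / (q - 1)) * (c / J) powr q * J"
  proof (cases "m \<le> n")
    case True
    have "(\<Sum>j=m..<n. ?f j) \<le> (\<Sum>j=m..<n. c powr q * \<kappa> powr (- p) * real j powr (- q))"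
      using c m by (intro sum_mono scale_square_polynomial) auto
    also have "\<dots> = c powr q * \<kappa> powr (- p) * (\<Sum>j=m..<n. real j powr (- q))"
      by (simp add: sum_distrib_left)
    also have "\<dots> \<le> c powr q * \<kappa> powr (- p) * (2 powr q / (q - 1) * real m powr (1 - q))"
      using q m True by (intro mult_left_mono sum_powr_tail_le) auto
    also have "\<dots> \<le> c powr q * \<kappa> powr (- p) * (2 powr q / (q - 1) * J powr (1 - q))"
      using q m J by (intro mult_left_mono powr_mono2') auto
    also have "J powr (1 - q) = J * J powr (- q)"
      using J by (simp add: powr_mult_base)
    also have "c powr q * \<kappa> powr (- p) * (2 powr q / (q - 1) * (J * J powr (- q)))
        = \<kappa> powr (- p) * (2 powr q / (q - 1)) * (c powr q * J powr (- q)) * J"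
      by (simp only: mult_ac)
    also have "c powr q * J powr (- q) = (c / J) powr q"
      using c J by (simp add: powr_divide powr_minus_divide)
    finally show ?thesis .
  qed (use q c J in simp)
  finally show ?thesis by (simp add: algebra_simps)
qed

lemma low_index_le:
  assumes "j \<in> low" "i0 \<le> j"
  shows "real j \<le> \<kappa> powr (- r / 2) * J"
proof -
  have j: "1 \<le> j" "j < n" using assms i0 low_subset by auto
  have "\<kappa> * real j powr (2 / r) \<le> J powr (2 / r)"
    using x_ge[OF assms(2) j(2)] assms(1) by (simp add: low_def)
  then have "(\<kappa> * real j powr (2 / r)) powr (r / 2) \<le> (J powr (2 / r)) powr (r / 2)"
    using r \<kappa> by (intro powr_mono2) auto
  then have "\<kappa> powr (r / 2) * real j \<le> J"
    using r \<kappa> J j by (simp add: powr_mult powr_powr)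
  then have "\<kappa> powr (- r / 2) * (\<kappa> powr (r / 2) * real j) \<le> \<kappa> powr (- r / 2) * J"
    by (intro mult_left_mono) auto
  then show ?thesis
    using \<kappa> by (simp add: mult.assoc[symmetric] flip: powr_add)
qed

lemma card_low_le: "real (card low) \<le> (real i0 + 1 + \<kappa> powr (- r / 2)) * J"
proof -
  let ?M = "nat \<lfloor>\<kappa> powr (- r / 2) * J\<rfloor>"
  have "low \<subseteq> {..<i0} \<union> {..?M}"
    using low_index_le by (force simp: le_nat_floor)
  then have "card low \<le> card ({..<i0} \<union> {..?M})" by (intro card_mono) auto
  also have "\<dots> \<le> card {..<i0} + card {..?M}" by (rule card_Un_le)
  finally have "real (card low) \<le> real i0 + 1 + real ?M" by simp
  also have "real ?M \<le> \<kappa> powr (- r / 2) * J" using J by (intro of_nat_floor) auto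
  also have "real i0 + 1 \<le> (real i0 + 1) * J" using J by (simp add: mult_le_cancel_left1)
  finally show ?thesis by (simp add: algebra_simps)
qed

text \<open>For \<open>j < i0\<close> only a polynomial bound in \<open>n\<close> on the scale is
  available, so each logarithm costs up to \<open>L * J\<close> by \<open>ln n \<le> J\<close>. For
  the other low \<open>j\<close>, taking \<open>\<theta> = 1 / q\<close> in
  \<open>ln_one_plus_le_powr\<close> turns \<open>(J / j) powr (q / 2)\<close> into
  \<open>sqrt (J / j)\<close>, and the sum of this over \<open>j\<close> up to a multiple of
  \<open>J\<close> is of order \<open>J\<close>, without a logarithmic factor.\<close>

lemma sum_ln_scale_low:
  assumes T: "0 < T" and lnn: "ln (real n) \<le> J"
  shows "(\<Sum>j\<in>low. ln (1 + 2 * scale (T * J) j))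
    \<le> (real i0 * (ln (1 + 2 * T powr (q / 2)) + (q / 2 + p)) + (real i0 + 1 + \<kappa> powr (- r / 2))
        + 2 * q * (2 * T powr (q / 2) * \<kappa> powr (- p / 2)) powr (1 / q) * \<kappa> powr (- r / 4)) * J"
proof -
  let ?M = "nat \<lfloor>\<kappa> powr (- r / 2) * J\<rfloor>"
  define L where "L = ln (1 + 2 * T powr (q / 2)) + (q / 2 + p)"
  define b where "b = (2 * T powr (q / 2) * \<kappa> powr (- p / 2)) powr (1 / q)"
  have TJ: "0 < T * J" using T J by simp
  have small: "ln (1 + 2 * scale (T * J) j) \<le> L * J" if j: "j < n" for j
  proof -
    have "scale (T * J) j \<le> (T * real n) powr (q / 2) * (1 / (real n)\<^sup>2) powr (- p / 2)"
      unfolding scale_def using q p_pos T J \<delta> x_nonneg[OF j] n_pos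
      by (intro mult_mono powr_mono2 powr_mono2') auto
    also have "\<dots> = T powr (q / 2) * real n powr (q / 2 + p)"
    proof -
      have "(1 / (real n)\<^sup>2) powr (- p / 2) = real n powr p"
        using n_pos by (simp add: powr_divide powr_minus_divide powr_powr flip: powr_numeral)
      then show ?thesis using T n_pos by (simp add: powr_mult powr_add)
    qed
    finally have "1 + 2 * scale (T * J) j \<le> real n powr (q / 2 + p) + 2 * (T powr (q / 2) * real n powr (q / 2 + p))"
      using n_pos q p_pos by (intro add_mono ge_one_powr_ge_zero) auto
    also have "\<dots> = (1 + 2 * T powr (q / 2)) * real n powr (q / 2 + p)"
      by (simp add: algebra_simps)
    finally have "ln (1 + 2 * scale (T * J) j) \<le> ln ((1 + 2 * T powr (q / 2)) * real n powr (q / 2 + p))"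
      using scale_pos[OF TJ j] by (subst ln_le_cancel_iff) (auto simp: add_pos_pos n_pos intro!: mult_pos_pos)
    also have "\<dots> = ln (1 + 2 * T powr (q / 2)) + (q / 2 + p) * ln (real n)"
    proof -
      have "0 < 1 + 2 * T powr (q / 2)" by (intro add_pos_nonneg) auto
      then show ?thesis using n_pos by (subst ln_mult) (auto simp: ln_powr)
    qed
    also have "\<dots> \<le> ln (1 + 2 * T powr (q / 2)) * J + (q / 2 + p) * J"
    proof -
      have "ln (1 + 2 * T powr (q / 2)) * 1 \<le> ln (1 + 2 * T powr (q / 2)) * J"
        using J by (intro mult_left_mono ln_ge_zero) auto
      moreover have "(q / 2 + p) * ln (real n) \<le> (q / 2 + p) * J"
        using lnn q p_pos by (intro mult_left_mono) auto
      ultimately show ?thesis by simp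
    qed
    finally show ?thesis by (simp add: L_def algebra_simps)
  qed
  have large: "ln (1 + 2 * scale (T * J) j) \<le> 1 + q * b * sqrt J * (1 / sqrt (real j))"
    if j: "j \<in> low" "i0 \<le> j" for j
  proof -
    have jn: "j < n" "1 \<le> j" using j i0 low_subset by auto
    have "(scale (T * J) j)\<^sup>2 \<le> (T * J) powr q * \<kappa> powr (- p) * real j powr (- q)"
      by (rule scale_square_polynomial[OF TJ j(2) jn(1)])
    also have "\<dots> = (T powr (q / 2) * \<kappa> powr (- p / 2) * (J / real j) powr (q / 2))\<^sup>2"
      using T J \<kappa> jn
      by (simp add: power_mult_distrib powr_mult powr_divide powr_minus_divide powr_powr flip: powr_numeral)
    finally have "scale (T * J) j \<le> T powr (q / 2) * \<kappa> powr (- p / 2) * (J / real j) powr (q / 2)"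
      by (rule power2_le_imp_le) simp
    then have "(2 * scale (T * J) j) powr (1 / q) \<le> (2 * T powr (q / 2) * \<kappa> powr (- p / 2) * (J / real j) powr (q / 2)) powr (1 / q)"
      using q scale_pos[OF TJ jn(1)] by (intro powr_mono2) auto
    also have "\<dots> = b * ((J / real j) powr (q / 2)) powr (1 / q)"
      by (simp add: b_def powr_mult)
    also have "((J / real j) powr (q / 2)) powr (1 / q) = sqrt J * (1 / sqrt (real j))"
      using q J by (simp add: powr_powr powr_half_sqrt real_sqrt_divide)
    finally have "q * (2 * scale (T * J) j) powr (1 / q) \<le> q * (b * (sqrt J * (1 / sqrt (real j))))"
      using q by (intro mult_left_mono) auto
    then have "(2 * scale (T * J) j) powr (1 / q) / (1 / q) \<le> q * b * sqrt J * (1 / sqrt (real j))"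
      by (simp add: mult_ac)
    then show ?thesis
      using ln_one_plus_le_powr[of "2 * scale (T * J) j" "1 / q"] q scale_pos[OF TJ jn(1)] by simp
  qed
  have L: "0 \<le> L * J" using J q p_pos T by (auto simp: L_def intro!: mult_nonneg_nonneg add_nonneg_nonneg)
  have "(\<Sum>j\<in>low. ln (1 + 2 * scale (T * J) j))
    \<le> (\<Sum>j\<in>low. of_bool (j < i0) * (L * J) + of_bool (i0 \<le> j) * (1 + q * b * sqrt J * (1 / sqrt (real j))))"
    using small large low_subset by (intro sum_mono) (auto simp: not_le not_less)
  also have "\<dots> = (\<Sum>j\<in>low. of_bool (j < i0) * (L * J)) + (\<Sum>j\<in>low. of_bool (i0 \<le> j))
      + (\<Sum>j\<in>low. of_bool (i0 \<le> j) * (q * b * sqrt J * (1 / sqrt (real j))))"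
    by (simp add: sum.distrib distrib_left)
  also have "(\<Sum>j\<in>low. of_bool (j < i0) * (L * J)) \<le> real i0 * L * J"
  proof -
    have "(\<Sum>j\<in>low. of_bool (j < i0) * (L * J)) = (\<Sum>j\<in>low \<inter> {..<i0}. L * J)"
      using finite_low by (intro sum.mono_neutral_cong_right) auto
    also have "\<dots> \<le> (\<Sum>j<i0. L * J)" using L by (intro sum_mono2) auto
    finally show ?thesis by simp
  qed
  also have "(\<Sum>j\<in>low. of_bool (i0 \<le> j)) \<le> (\<Sum>j\<in>low. 1 :: real)"
    by (intro sum_mono) auto
  also have "\<dots> \<le> (real i0 + 1 + \<kappa> powr (- r / 2)) * J" using card_low_le by simp
  also have "(\<Sum>j\<in>low. of_bool (i0 \<le> j) * (q * b * sqrt J * (1 / sqrt (real j))))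
      \<le> 2 * q * b * \<kappa> powr (- r / 4) * J"
  proof -
    have nonneg: "0 \<le> q * b * sqrt J" using q J by (simp add: b_def)
    have "(\<Sum>j\<in>low. of_bool (i0 \<le> j) * (q * b * sqrt J * (1 / sqrt (real j))))
        = (\<Sum>j\<in>low \<inter> {i0..}. q * b * sqrt J * (1 / sqrt (real j)))"
      using finite_low by (intro sum.mono_neutral_cong_right) auto
    also have "\<dots> \<le> (\<Sum>j=1..?M. q * b * sqrt J * (1 / sqrt (real j)))"
    proof (intro sum_mono2)
      show "low \<inter> {i0..} \<subseteq> {1..?M}"
        using low_index_le i0 by (auto simp: le_nat_floor)
    qed (use nonneg in auto)
    also have "\<dots> = q * b * sqrt J * (\<Sum>j=1..?M. 1 / sqrt (real j))"
      by (simp add: sum_distrib_left)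
    also have "\<dots> \<le> q * b * sqrt J * (2 * sqrt (real ?M))"
      using nonneg by (intro mult_left_mono sum_inverse_sqrt_le)
    also have "\<dots> \<le> q * b * sqrt J * (2 * (\<kappa> powr (- r / 4) * sqrt J))"
    proof -
      have "real ?M \<le> \<kappa> powr (- r / 2) * J" using J by (intro of_nat_floor) auto
      then have "sqrt (real ?M) \<le> sqrt (\<kappa> powr (- r / 2) * J)" by simp
      also have "\<dots> = \<kappa> powr (- r / 4) * sqrt J"
        by (simp add: real_sqrt_mult powr_powr flip: powr_half_sqrt)
      finally show ?thesis using nonneg by (intro mult_left_mono) auto
    qed
    also have "\<dots> = 2 * q * b * \<kappa> powr (- r / 4) * J" using J by simp
    finally show ?thesis .
  qed
  finally show ?thesis unfolding L_def[symmetric] b_def[symmetric] by (simp add: algebra_simps)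
qed

text \<open>The smoothness restriction enters here. With \<open>w\<close> the eigenvalue relative to
  the cut, the left side is at most \<open>w powr p\<close>. As \<open>w / 2 \<le> 1\<close>, the
  exponent \<open>p\<close> may be lowered to \<open>\<beta>\<close>, which yields the weight of the
  Sobolev norm.\<close>

lemma inverse_scale_square_low:
  assumes j: "j \<in> low" and c: "J \<le> c" and \<beta>: "0 < \<beta>" "\<beta> \<le> p"
  shows "1 / (scale c j)\<^sup>2 \<le> 2 powr p"
    and "1 / (scale c j)\<^sup>2 \<le> 2 powr (p + \<beta>) * J powr (- 2 * \<beta> / r) * (1 + x j powr \<beta>)"
proof -
  have jn: "j < n" and xj: "x j \<le> J powr (2 / r)" using j by (auto simp: low_def)
  have c0: "0 < c" using c J by simp
  define w where "w = J powr (- 2 / r) * (x j + 1)"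
  have w0: "0 < w" using J x_nonneg[OF jn] by (simp add: w_def add_nonneg_pos)
  have "w \<le> 2"
  proof -
    have "1 \<le> J powr (2 / r)" using J r by (intro ge_one_powr_ge_zero) auto
    then have "w \<le> J powr (- 2 / r) * (2 * J powr (2 / r))"
      unfolding w_def using xj by (intro mult_left_mono) auto
    also have "\<dots> = 2 * (J powr (- 2 / r) * J powr (2 / r))" by simp
    also have "J powr (- 2 / r) * J powr (2 / r) = 1" using J by (simp flip: powr_add)
    finally show ?thesis by simp
  qed
  have "1 / (scale c j)\<^sup>2 = c powr (- q) * (x j + \<delta>) powr p"
    using x\<delta>_pos[OF jn] c0 by (simp add: scale_square jn powr_minus_divide)
  also have "\<dots> \<le> J powr (- q) * (x j + 1) powr p"
    using J c q p_pos \<delta> x_nonneg[OF jn] by (intro mult_mono powr_mono2 powr_mono2') auto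
  also have "\<dots> = w powr p"
    using x_nonneg[OF jn] by (simp add: w_def powr_mult powr_powr q_def)
  finally have le: "1 / (scale c j)\<^sup>2 \<le> w powr p" .
  also have "w powr p \<le> 2 powr p"
    using w0 \<open>w \<le> 2\<close> p_pos by (intro powr_mono2) auto
  finally show "1 / (scale c j)\<^sup>2 \<le> 2 powr p" .
  have "w powr p = 2 powr p * (w / 2) powr p"
    using w0 by (simp add: powr_divide)
  also have "\<dots> \<le> 2 powr p * (w / 2) powr \<beta>"
    using w0 \<open>w \<le> 2\<close> \<beta> by (intro mult_left_mono powr_mono') auto
  also have "\<dots> \<le> 2 powr p * w powr \<beta>"
    using w0 \<beta> by (intro mult_left_mono powr_mono2) auto
  also have "w powr \<beta> = J powr (- 2 * \<beta> / r) * (x j + 1) powr \<beta>"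
    using x_nonneg[OF jn] by (simp add: w_def powr_mult powr_powr)
  also have "(x j + 1) powr \<beta> \<le> 2 powr \<beta> * (1 + x j powr \<beta>)"
  proof (cases "x j \<le> 1")
    case True
    then have "(x j + 1) powr \<beta> \<le> 2 powr \<beta>"
      using x_nonneg[OF jn] \<beta> by (intro powr_mono2) auto
    also have "\<dots> \<le> 2 powr \<beta> * (1 + x j powr \<beta>)" by simp
    finally show ?thesis .
  next
    case False
    then have "(x j + 1) powr \<beta> \<le> (2 * x j) powr \<beta>"
      using \<beta> by (intro powr_mono2) auto
    also have "\<dots> \<le> 2 powr \<beta> * (1 + x j powr \<beta>)"
      using False by (simp add: powr_mult)
    finally show ?thesis .
  qed
  finally have "w powr p \<le> 2 powr p * (J powr (- 2 * \<beta> / r) * (2 powr \<beta> * (1 + x j powr \<beta>)))"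
    by (simp add: mult_left_mono)
  with le show "1 / (scale c j)\<^sup>2 \<le> 2 powr (p + \<beta>) * J powr (- 2 * \<beta> / r) * (1 + x j powr \<beta>)"
    by (simp add: powr_add mult_ac)
qed

text \<open>The first term is the Cameron-Martin cost of shifting the low coefficients to
  \<open>g\<close>; the second is the cost of the unit width of the intervals around them, one per
  low index.\<close>

lemma sum_inverse_scale_low:
  assumes c: "J \<le> c" and \<beta>: "0 < \<beta>" "\<beta> \<le> p"
    and V: "(\<Sum>j<n. (g j)\<^sup>2 * (1 + x j powr \<beta>)) \<le> V"
  shows "(\<Sum>j\<in>low. ((g j)\<^sup>2 + 1) / (scale c j)\<^sup>2)
    \<le> 2 powr (p + \<beta>) * J powr (- 2 * \<beta> / r) * V + 2 powr p * (real i0 + 1 + \<kappa> powr (- r / 2)) * J"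
proof -
  let ?D = "2 powr (p + \<beta>) * J powr (- 2 * \<beta> / r)"
  have "(\<Sum>j\<in>low. (g j)\<^sup>2 * (1 / (scale c j)\<^sup>2)) \<le> (\<Sum>j\<in>low. ?D * ((g j)\<^sup>2 * (1 + x j powr \<beta>)))"
  proof (rule sum_mono)
    fix j assume "j \<in> low"
    from mult_left_mono[OF inverse_scale_square_low(2)[OF this c \<beta>], of "(g j)\<^sup>2"]
    show "(g j)\<^sup>2 * (1 / (scale c j)\<^sup>2) \<le> ?D * ((g j)\<^sup>2 * (1 + x j powr \<beta>))"
      by (simp only: mult_ac zero_le_power2)
  qed
  also have "\<dots> = ?D * (\<Sum>j\<in>low. (g j)\<^sup>2 * (1 + x j powr \<beta>))"
    by (rule sum_distrib_left[symmetric])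
  also have "\<dots> \<le> ?D * V"
  proof (rule mult_left_mono)
    have "(\<Sum>j\<in>low. (g j)\<^sup>2 * (1 + x j powr \<beta>)) \<le> (\<Sum>j<n. (g j)\<^sup>2 * (1 + x j powr \<beta>))"
      using low_subset by (intro sum_mono2) auto
    then show "(\<Sum>j\<in>low. (g j)\<^sup>2 * (1 + x j powr \<beta>)) \<le> V" using V by simp
  qed simp
  finally have 1: "(\<Sum>j\<in>low. (g j)\<^sup>2 * (1 / (scale c j)\<^sup>2)) \<le> ?D * V" .
  have "(\<Sum>j\<in>low. 1 / (scale c j)\<^sup>2) \<le> (\<Sum>j\<in>low. 2 powr p)"
    by (intro sum_mono inverse_scale_square_low(1)[OF _ c \<beta>])
  also have "\<dots> = 2 powr p * real (card low)" by simp
  also have "\<dots> \<le> 2 powr p * ((real i0 + 1 + \<kappa> powr (- r / 2)) * J)"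
    using card_low_le by (intro mult_left_mono) auto
  finally have 2: "(\<Sum>j\<in>low. 1 / (scale c j)\<^sup>2) \<le> 2 powr p * (real i0 + 1 + \<kappa> powr (- r / 2)) * J"
    by (simp only: mult.assoc)
  have "(\<Sum>j\<in>low. ((g j)\<^sup>2 + 1) / (scale c j)\<^sup>2)
      = (\<Sum>j\<in>low. (g j)\<^sup>2 * (1 / (scale c j)\<^sup>2)) + (\<Sum>j\<in>low. 1 / (scale c j)\<^sup>2)"
    by (simp add: add_divide_distrib sum.distrib)
  with add_mono[OF 1 2] show ?thesis by simp
qed

text \<open>Truncation error of a Sobolev function: for high \<open>j\<close> the weight
  \<open>1 + x j powr \<beta>\<close> is at least \<open>J powr (2 * \<beta> / r)\<close>.\<close>

lemma sum_square_high:
  assumes \<beta>: "0 < \<beta>" and V: "(\<Sum>j<n. (g j)\<^sup>2 * (1 + x j powr \<beta>)) \<le> V"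
  shows "(\<Sum>j\<in>{..<n} - low. (g j)\<^sup>2) \<le> J powr (- 2 * \<beta> / r) * V"
proof -
  have "1 \<le> J powr (- 2 * \<beta> / r) * (1 + x j powr \<beta>)" if j: "j \<in> {..<n} - low" for j
  proof -
    have "J powr (2 / r) \<le> x j" using j by (auto simp: low_def)
    then have "(J powr (2 / r)) powr \<beta> \<le> x j powr \<beta>"
      using \<beta> by (intro powr_mono2) auto
    then have "J powr (2 * \<beta> / r) \<le> 1 + x j powr \<beta>" by (simp add: powr_powr)
    then have "J powr (- 2 * \<beta> / r) * J powr (2 * \<beta> / r) \<le> J powr (- 2 * \<beta> / r) * (1 + x j powr \<beta>)"
      by (intro mult_left_mono) auto
    then show ?thesis using J by (simp flip: powr_add)
  qed
  then have "(\<Sum>j\<in>{..<n} - low. (g j)\<^sup>2) \<le> (\<Sum>j\<in>{..<n} - low. (g j)\<^sup>2 * (J powr (- 2 * \<beta> / r) * (1 + x j powr \<beta>)))"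
    by (intro sum_mono) (simp add: mult_le_cancel_left1)
  also have "\<dots> \<le> (\<Sum>j<n. (g j)\<^sup>2 * (J powr (- 2 * \<beta> / r) * (1 + x j powr \<beta>)))"
    by (intro sum_mono2) auto
  also have "\<dots> = J powr (- 2 * \<beta> / r) * (\<Sum>j<n. (g j)\<^sup>2 * (1 + x j powr \<beta>))"
    by (simp add: sum_distrib_left mult_ac)
  also have "\<dots> \<le> J powr (- 2 * \<beta> / r) * V" using V by (intro mult_left_mono) auto
  finally show ?thesis .
qed

end

section \<open>Small balls and the sieve under the conditional prior\<close>

definition spectral_law :: "nat \<Rightarrow> (nat \<Rightarrow> nat \<Rightarrow> real) \<Rightarrow> (nat \<Rightarrow> real) \<Rightarrow> (nat \<Rightarrow> real) measure" where
  "spectral_law n u s = distr (std_normal_PiM n) (Rn n) (\<lambda>z. lin_map n u (\<lambda>k. s k * z k))"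

lemma measurable_scaled_lin_map:
  "(\<lambda>z. lin_map n u (\<lambda>k. s k * z k)) \<in> std_normal_PiM n \<rightarrow>\<^sub>M Rn n"
proof -
  have "(\<lambda>z. lin_map n u (\<lambda>k. s k * z k)) = lin_map n (\<lambda>i j. u i j * s j)"
    by (auto simp: fun_eq_iff lin_map_def mult.assoc)
  then show ?thesis
    using measurable_lin_map
    by (simp add: Rn_def measurable_cong_sets[OF sets_std_normal_PiM refl])
qed

lemma emeasure_spectral_law:
  assumes "B \<in> sets (Rn n)"
  shows "emeasure (spectral_law n u s) B
    = emeasure (std_normal_PiM n) {z \<in> space (std_normal_PiM n). lin_map n u (\<lambda>k. s k * z k) \<in> B}"
  unfolding spectral_law_def using assms measurable_scaled_lin_map
  by (subst emeasure_distr) (auto intro!: arg_cong2[where f = emeasure])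

lemma emeasure_spectral_law_le_1: "B \<in> sets (Rn n) \<Longrightarrow> emeasure (spectral_law n u s) B \<le> 1"
  by (simp add: emeasure_spectral_law std_normal_PiM.emeasure_le_1)

text \<open>All operations in \<open>prior_covariance\<close> are diagonal in the eigenbasis of the
  Laplacian. Splitting \<open>n / c\<close> leaves \<open>x\<^sub>j + \<delta>\<close> times a power
  of \<open>c\<close>; the inverse and the square root turn the exponent \<open>p\<close> into
  \<open>- p / 2\<close>.\<close>

lemma centered_gaussian_prior_covariance:
  assumes dec: "spectral_decomposition n (laplacian n G) U lam" and lam: "\<And>i. i < n \<Longrightarrow> 0 \<le> lam i"
    and n: "0 < n" and c: "0 < c"
  shows "centered_gaussian n (prior_covariance n G r \<alpha> c)
    = spectral_law n (entries U) (\<lambda>k. c powr (2 * (\<alpha> + r / 2) / r / 2) *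
        (real n powr (2 / r) * lam k + real n powr (2 / r) / (real n)\<^sup>2) powr (- (\<alpha> + r / 2) / 2))"
proof -
  define p where "p = \<alpha> + r / 2"
  define y where "y = (\<lambda>k. real n powr (2 / r) * lam k + real n powr (2 / r) / (real n)\<^sup>2)"
  let ?e = "\<lambda>k. (real n / c) powr (2 / r) * (lam k + 1 / (real n)\<^sup>2 * 1)"
  have y_pos: "0 < y k" if "k < n" for k
    using lam[OF that] n by (simp add: y_def add_nonneg_pos)
  have e: "?e k = c powr (- 2 / r) * y k" for k
    using n c by (simp add: y_def powr_divide powr_minus_divide field_simps)
  have e_pos: "0 < ?e k" if "k < n" for k
    using y_pos[OF that] c unfolding e by simp
  have "spectral_decomposition n (((real n / c) powr (2 / r)) \<cdot>\<^sub>m (laplacian n G + (1 / (real n)\<^sup>2) \<cdot>\<^sub>m 1\<^sub>m n)) U ?e"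
    by (intro spectral_decomposition_smult spectral_decomposition_add dec spectral_decomposition_one[OF dec])
  from spectral_decomposition_mat_powr[OF this, of p]
  have "spectral_decomposition n (prior_covariance n G r \<alpha> c) U (\<lambda>k. inverse (?e k powr p))"
    unfolding prior_covariance_def p_def[symmetric]
    by (rule spectral_decomposition_inverse) (use e_pos in force)
  from centered_gaussian_spectral[OF this]
  have "centered_gaussian n (prior_covariance n G r \<alpha> c) = distr (std_normal_PiM n) (Rn n)
    (\<lambda>z. lin_map n (entries U) (\<lambda>k. inverse (?e k powr p) powr (1 / 2) * z k))" .
  also have "(\<lambda>z. lin_map n (entries U) (\<lambda>k. inverse (?e k powr p) powr (1 / 2) * z k))
      = (\<lambda>z. lin_map n (entries U) (\<lambda>k. c powr (2 * p / r / 2) * y k powr (- p / 2) * z k))"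
  proof (rule ext, rule lin_map_cong)
    fix z :: "nat \<Rightarrow> real" and k assume k: "k < n"
    have "inverse (?e k powr p) powr (1 / 2) = (?e k powr (- p)) powr (1 / 2)"
      by (simp only: powr_minus)
    also have "\<dots> = ?e k powr (- p / 2)" by (simp only: powr_powr) simp
    also have "\<dots> = c powr (2 * p / r / 2) * y k powr (- p / 2)"
      unfolding e using y_pos[OF k] c by (simp add: powr_mult powr_powr)
    finally show "inverse (?e k powr p) powr (1 / 2) * z k = c powr (2 * p / r / 2) * y k powr (- p / 2) * z k"
      by simp
  qed
  finally show ?thesis by (simp add: spectral_law_def p_def y_def)
qed

lemma sobolev_ball_spectral:
  assumes dec: "spectral_decomposition n (laplacian n G) U lam"
    and n: "0 < n" and h: "h \<in> sobolev_ball n G r \<beta> C"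
  shows "(\<Sum>j<n. (lin_map n (\<lambda>i j. entries U j i) h j)\<^sup>2 * (1 + (real n powr (2 / r) * lam j) powr \<beta>)) \<le> real n * C\<^sup>2"
proof -
  let ?g = "lin_map n (\<lambda>i j. entries U j i) h"
  let ?d = "\<lambda>j. 1 + (real n powr (2 / r) * lam j) powr \<beta>"
  have "spectral_decomposition n (1\<^sub>m n + mat_powr ((real n powr (2 / r)) \<cdot>\<^sub>m laplacian n G) \<beta>) U ?d"
    by (intro spectral_decomposition_smult spectral_decomposition_add spectral_decomposition_mat_powr dec
        spectral_decomposition_one[OF dec])
  note ap = mat_apply_spectral_decomposition[OF this, of h]
  have "(\<Sum>i<n. h i * lin_map n (entries U) (\<lambda>k. ?d k * ?g k) i)
      = (\<Sum>i<n. \<Sum>k<n. h i * (entries U i k * (?d k * ?g k)))"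
    by (intro sum.cong refl) (simp add: lin_map_def[of n "entries U"] sum_distrib_left)
  also have "\<dots> = (\<Sum>k<n. \<Sum>i<n. h i * (entries U i k * (?d k * ?g k)))"
    by (rule sum.swap)
  also have "\<dots> = (\<Sum>k<n. (\<Sum>i<n. entries U i k * h i) * (?d k * ?g k))"
    unfolding sum_distrib_right by (intro sum.cong refl) (simp only: mult_ac)
  also have "\<dots> = (\<Sum>k<n. (?g k)\<^sup>2 * ?d k)"
    by (intro sum.cong refl) (simp add: lin_map_def power2_eq_square mult_ac)
  finally have "inner_n n h (lin_map n (entries U) (\<lambda>k. ?d k * ?g k)) = (\<Sum>k<n. (?g k)\<^sup>2 * ?d k) / real n"
    by (simp add: inner_n_def)
  moreover have "inner_n n h (lin_map n (entries U) (\<lambda>k. ?d k * ?g k)) \<le> C\<^sup>2"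
    using h unfolding sobolev_ball_def ap[symmetric] by simp
  ultimately have "(\<Sum>k<n. (?g k)\<^sup>2 * ?d k) / real n \<le> C\<^sup>2" by (simp only:)
  then show ?thesis using n by (subst (asm) pos_divide_le_eq) (auto simp only: mult.commute of_nat_0_less_iff)
qed

text \<open>Here \<open>h\<close> is an arbitrary function such as \<open>f0 n\<close>, perhaps not
  extensional. Its coefficients determine its values below \<open>n\<close>, which are all that the
  norm sees.\<close>

lemma norm_n_lin_map_diff_coeffs:
  assumes u: "orthonormal_cols n u" "orthonormal_cols n (\<lambda>i j. u j i)"
  shows "(norm_n n (\<lambda>i. lin_map n u y i - h i))\<^sup>2 = (\<Sum>j<n. (y j - lin_map n (\<lambda>i j. u j i) h j)\<^sup>2) / real n"
proof -
  let ?g = "lin_map n (\<lambda>i j. u j i) h"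
  have "(norm_n n (\<lambda>i. lin_map n u y i - h i))\<^sup>2 = (norm_n n (\<lambda>i. lin_map n u y i - lin_map n u ?g i))\<^sup>2"
    unfolding norm_n_square using lin_map_transpose_lin_map[OF u(2)]
    by (intro arg_cong2[where f = "(/)"] sum.cong) auto
  then show ?thesis by (simp only: norm_n_lin_map_diff[OF u(1)])
qed

lemma norm_n_ball_measurable: "{h \<in> space (Rn n). norm_n n (\<lambda>i. h i - h0 i) < \<epsilon>} \<in> sets (Rn n)"
proof -
  have "(\<lambda>h. norm_n n (\<lambda>i. h i - h0 i)) \<in> borel_measurable (Rn n)"
    unfolding norm_n_def inner_n_def Rn_def by measurable
  then show ?thesis by measurable
qed

context polynomial_spectrum
begin

text \<open>This and the next two constants involve only \<open>i0\<close>, \<open>r\<close>,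
  \<open>p\<close> and \<open>\<kappa>\<close>, besides \<open>T\<close>, but not \<open>n\<close>,
  \<open>J\<close>, \<open>\<delta>\<close> or \<open>x\<close>; they can therefore be fixed before
  \<open>n\<close> tends to infinity.\<close>

definition card_const :: real where
  "card_const = real i0 + 1 + \<kappa> powr (- r / 2)"

definition tail_const :: real where
  "tail_const = real i0 + 2 + \<kappa> powr (- p) * (2 powr q / (q - 1))"

definition log_const :: "real \<Rightarrow> real" where
  "log_const T = real i0 * (ln (1 + 2 * T powr (q / 2)) + (q / 2 + p)) + card_const
     + 2 * q * (2 * T powr (q / 2) * \<kappa> powr (- p / 2)) powr (1 / q) * \<kappa> powr (- r / 4)"

lemma consts_pos: "0 < card_const" "0 < tail_const"
  using q i0 by (auto simp: card_const_def tail_const_def intro!: add_pos_nonneg)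

text \<open>The error budget is \<open>card_const * J\<close> for unit errors of the low
  coefficients, \<open>4 * S\<close> for the high part of the sample and \<open>2 * C * J\<close>
  for the high part of \<open>h0\<close>, the last two through
  \<open>(a - b)\<^sup>2 \<le> 2 * a\<^sup>2 + 2 * b\<^sup>2\<close>. The bound
  \<open>J \<le> c\<close> limits the cost of the shift, and \<open>c \<le> 2 * J\<close> limits the
  logarithms and \<open>S\<close>. Here \<open>C\<close> plays the role of a squared Sobolev
  radius.\<close>

lemma small_ball:
  assumes u: "orthonormal_cols n u" "orthonormal_cols n (\<lambda>i j. u j i)"
    and lnn: "ln (real n) \<le> J" and \<beta>: "0 < \<beta>" "\<beta> \<le> p" and c: "J \<le> c" "c \<le> 2 * J"
    and V: "(\<Sum>j<n. (lin_map n (\<lambda>i j. u j i) h0 j)\<^sup>2 * (1 + x j powr \<beta>)) \<le> V"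
      "J powr (- 2 * \<beta> / r) * V \<le> C * J"
    and \<epsilon>: "0 < \<epsilon>" "(card_const + 4 * (tail_const * 2 powr q) + 2 * C) * J < real n * \<epsilon>\<^sup>2"
  shows "ennreal (exp (- ((log_const 2 + 2 powr (p + \<beta>) * C + 2 powr p * card_const) * J)) / 2)
    \<le> emeasure (spectral_law n u (scale c)) {h \<in> space (Rn n). norm_n n (\<lambda>i. h i - h0 i) < \<epsilon>}"
proof -
  define g where "g = lin_map n (\<lambda>i j. u j i) h0"
  define S where "S = tail_const * 2 powr q * J"
  let ?P = "std_normal_PiM n"
  have c0: "0 < c" using c J by simp
  have S: "(\<Sum>j\<in>{..<n} - low. (scale c j)\<^sup>2) \<le> S" "0 < S"
  proof -
    have "(\<Sum>j\<in>{..<n} - low. (scale c j)\<^sup>2) \<le> tail_const * (c / J) powr q * J"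
      using sum_scale_square_high[OF c0] by (simp add: tail_const_def)
    also have "\<dots> \<le> S"
      unfolding S_def using consts_pos J q c c0
      by (intro mult_right_mono mult_left_mono powr_mono2) (auto simp: field_simps)
    finally show "(\<Sum>j\<in>{..<n} - low. (scale c j)\<^sup>2) \<le> S" .
    show "0 < S" using consts_pos J by (simp add: S_def)
  qed
  have "(\<Sum>j\<in>low. ln (1 + 2 * scale c j)) \<le> (\<Sum>j\<in>low. ln (1 + 2 * scale (2 * J) j))"
  proof (rule sum_mono)
    fix j assume "j \<in> low"
    then have "0 < scale c j" using scale_pos[OF c0] low_subset by auto
    moreover have "scale c j \<le> scale (2 * J) j" using c c0 by (intro scale_mono) auto
    ultimately show "ln (1 + 2 * scale c j) \<le> ln (1 + 2 * scale (2 * J) j)" by simp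
  qed
  also have "\<dots> \<le> log_const 2 * J"
    using sum_ln_scale_low[OF _ lnn, of 2] by (simp add: log_const_def card_const_def)
  finally have ln: "(\<Sum>j\<in>low. ln (1 + 2 * scale c j)) \<le> log_const 2 * J" .
  have "(\<Sum>j\<in>low. ((g j)\<^sup>2 + 1) / (scale c j)\<^sup>2)
      \<le> 2 powr (p + \<beta>) * (J powr (- 2 * \<beta> / r) * V) + 2 powr p * card_const * J"
    using sum_inverse_scale_low[OF c(1) \<beta>, of g V] V(1) by (simp add: g_def card_const_def mult.assoc)
  also have "\<dots> \<le> 2 powr (p + \<beta>) * (C * J) + 2 powr p * card_const * J"
    using V(2) by (intro add_right_mono mult_left_mono) auto
  finally have "(\<Sum>j\<in>low. ln (1 + 2 * scale c j) + ((g j)\<^sup>2 + 1) / (scale c j)\<^sup>2)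
      \<le> (log_const 2 + 2 powr (p + \<beta>) * C + 2 powr p * card_const) * J"
    using ln by (simp add: sum.distrib algebra_simps)
  then have "ennreal (exp (- ((log_const 2 + 2 powr (p + \<beta>) * C + 2 powr p * card_const) * J)) / 2)
      \<le> ennreal (exp (- (\<Sum>j\<in>low. ln (1 + 2 * scale c j) + ((g j)\<^sup>2 + 1) / (scale c j)\<^sup>2)) / 2)"
    by (intro ennreal_leI divide_right_mono) auto
  also have "\<dots> \<le> emeasure ?P {z \<in> space ?P. (\<forall>j\<in>low. \<bar>scale c j * z j - g j\<bar> \<le> 1) \<and>
      (\<Sum>j\<in>{..<n} - low. (scale c j * z j)\<^sup>2) \<le> 2 * S}"
    using low_subset S scale_pos[OF c0] by (intro std_normal_PiM_small_ball) auto
  also have "\<dots> \<le> emeasure ?P {z \<in> space ?P. lin_map n u (\<lambda>k. scale c k * z k)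
      \<in> {h \<in> space (Rn n). norm_n n (\<lambda>i. h i - h0 i) < \<epsilon>}}"
  proof (rule emeasure_mono)
    show "{z \<in> space ?P. lin_map n u (\<lambda>k. scale c k * z k) \<in> {h \<in> space (Rn n). norm_n n (\<lambda>i. h i - h0 i) < \<epsilon>}} \<in> sets ?P"
      using measurable_sets[OF measurable_scaled_lin_map norm_n_ball_measurable]
      by (simp add: vimage_def Int_def conj_commute)
    show "{z \<in> space ?P. (\<forall>j\<in>low. \<bar>scale c j * z j - g j\<bar> \<le> 1) \<and>
        (\<Sum>j\<in>{..<n} - low. (scale c j * z j)\<^sup>2) \<le> 2 * S}
      \<subseteq> {z \<in> space ?P. lin_map n u (\<lambda>k. scale c k * z k) \<in> {h \<in> space (Rn n). norm_n n (\<lambda>i. h i - h0 i) < \<epsilon>}}"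
    proof safe
      fix z assume z1: "\<forall>j\<in>low. \<bar>scale c j * z j - g j\<bar> \<le> 1"
        and z2: "(\<Sum>j\<in>{..<n} - low. (scale c j * z j)\<^sup>2) \<le> 2 * S"
      show "lin_map n u (\<lambda>k. scale c k * z k) \<in> space (Rn n)" by (rule lin_map_in_space)
      have "(\<Sum>j<n. (scale c j * z j - g j)\<^sup>2)
          = (\<Sum>j\<in>low. (scale c j * z j - g j)\<^sup>2) + (\<Sum>j\<in>{..<n} - low. (scale c j * z j - g j)\<^sup>2)"
        by (subst sum.subset_diff[OF low_subset]) auto
      moreover have "(\<Sum>j\<in>low. (scale c j * z j - g j)\<^sup>2) \<le> card_const * J"
      proof -
        have "(\<Sum>j\<in>low. (scale c j * z j - g j)\<^sup>2) \<le> (\<Sum>j\<in>low. 1)"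
          using z1 by (intro sum_mono) (auto simp: abs_square_le_1)
        then show ?thesis using card_low_le by (simp add: card_const_def)
      qed
      moreover have "(\<Sum>j\<in>{..<n} - low. (scale c j * z j - g j)\<^sup>2) \<le> 4 * S + 2 * (C * J)"
      proof -
        have sq: "(a - b)\<^sup>2 \<le> 2 * a\<^sup>2 + 2 * b\<^sup>2" for a b :: real
          using zero_le_power2[of "a + b"] by (simp add: power2_eq_square algebra_simps)
        have "(\<Sum>j\<in>{..<n} - low. (scale c j * z j - g j)\<^sup>2)
            \<le> (\<Sum>j\<in>{..<n} - low. 2 * (scale c j * z j)\<^sup>2 + 2 * (g j)\<^sup>2)"
          by (intro sum_mono sq)
        also have "\<dots> = 2 * (\<Sum>j\<in>{..<n} - low. (scale c j * z j)\<^sup>2) + 2 * (\<Sum>j\<in>{..<n} - low. (g j)\<^sup>2)"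
          by (simp add: sum.distrib sum_distrib_left)
        finally show ?thesis
          using z2 sum_square_high[OF \<beta>(1), of g V] V by (simp add: g_def)
      qed
      ultimately have "(\<Sum>j<n. (scale c j * z j - g j)\<^sup>2) < real n * \<epsilon>\<^sup>2"
        using \<epsilon>(2) by (simp add: S_def algebra_simps)
      then have "(norm_n n (\<lambda>i. lin_map n u (\<lambda>k. scale c k * z k) i - h0 i))\<^sup>2 < \<epsilon>\<^sup>2"
        unfolding norm_n_lin_map_diff_coeffs[OF u] using n_pos by (simp add: g_def field_simps)
      then show "norm_n n (\<lambda>i. lin_map n u (\<lambda>k. scale c k * z k) i - h0 i) < \<epsilon>"
        using \<epsilon>(1) by (simp add: power_less_imp_less_base)
    qed
  qed
  also have "\<dots> = emeasure (spectral_law n u (scale c)) {h \<in> space (Rn n). norm_n n (\<lambda>i. h i - h0 i) < \<epsilon>}"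
    by (rule emeasure_spectral_law[OF norm_n_ball_measurable, symmetric])
  finally show ?thesis .
qed

text \<open>Scales increase with \<open>c\<close>, so one sieve built with \<open>T * J\<close>
  serves all smaller \<open>c\<close>: the weighted sum is at most the sum of
  \<open>\<bar>z j\<bar>\<close>. In the high part the condition on \<open>t\<close> gives
  \<open>t * (scale c j)\<^sup>2 \<le> 1 / 4\<close>, the range where the exponential moment of the
  square is controlled.\<close>

lemma sieve_complement:
  assumes u: "orthonormal_cols n u"
    and c: "0 < c" "c \<le> T * J" and t: "0 < t" "t * T powr q \<le> 1 / 4"
  shows "emeasure (spectral_law n u (scale c)) (space (Rn n) - sieve n u low (scale (T * J)) R)
    \<le> ennreal (exp (- R + 2 * card_const * J) + exp (- t * R + tail_const / 2 * J))"
proof -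
  let ?P = "std_normal_PiM n"
  let ?y = "\<lambda>z k. scale c k * z k"
  have T: "c / J \<le> T" using c J by (simp add: field_simps)
  have T0: "0 < T * J" using c by simp
  have ts: "t * (scale c j)\<^sup>2 \<le> 1 / 4" if "j \<in> {..<n} - low" for j
  proof -
    have "(scale c j)\<^sup>2 \<le> (c / J) powr q" using that c by (intro scale_square_high) auto
    also have "\<dots> \<le> T powr q" using T c J q by (intro powr_mono2) auto
    finally have "t * (scale c j)\<^sup>2 \<le> t * T powr q" using t by (intro mult_left_mono) auto
    then show ?thesis using t(2) by (rule order_trans)
  qed
  let ?E1 = "{z \<in> space ?P. R < (\<Sum>j\<in>low. \<bar>z j\<bar>)}"
  let ?E2 = "{z \<in> space ?P. t * R < (\<Sum>j\<in>{..<n} - low. t * (scale c j)\<^sup>2 * (z j)\<^sup>2)}"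
  have comp: "(\<lambda>z. z j) \<in> borel_measurable ?P" if "j < n" for j
    using measurable_component_singleton[of j "{..<n}" "\<lambda>_. std_normal"] that by simp
  have "(\<lambda>z. \<Sum>j\<in>low. \<bar>z j\<bar>) \<in> borel_measurable ?P"
    using low_subset by (intro borel_measurable_sum borel_measurable_abs comp) auto
  then have E1: "?E1 \<in> sets ?P" by measurable
  have "(\<lambda>z. \<Sum>j\<in>{..<n} - low. t * (scale c j)\<^sup>2 * (z j)\<^sup>2) \<in> borel_measurable ?P"
    by (intro borel_measurable_sum borel_measurable_times borel_measurable_power comp) auto
  then have E2: "?E2 \<in> sets ?P" by measurable
  have sieve: "sieve n u low (scale (T * J)) R \<in> sets (Rn n)"
    by (rule sieve_measurable[OF low_subset])
  have "emeasure (spectral_law n u (scale c)) (space (Rn n) - sieve n u low (scale (T * J)) R)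
      = emeasure ?P {z \<in> space ?P. lin_map n u (?y z) \<in> space (Rn n) - sieve n u low (scale (T * J)) R}"
    using sieve by (intro emeasure_spectral_law) auto
  also have "\<dots> \<le> emeasure ?P (?E1 \<union> ?E2)"
  proof (rule emeasure_mono)
    show "{z \<in> space ?P. lin_map n u (?y z) \<in> space (Rn n) - sieve n u low (scale (T * J)) R} \<subseteq> ?E1 \<union> ?E2"
    proof
      fix z assume z: "z \<in> {z \<in> space ?P. lin_map n u (?y z) \<in> space (Rn n) - sieve n u low (scale (T * J)) R}"
      have coef: "lin_map n (\<lambda>i j. u j i) (lin_map n u (?y z)) j = ?y z j" if "j < n" for j
        by (rule lin_map_transpose_lin_map[OF u that])
      have "(\<Sum>j\<in>low. \<bar>lin_map n (\<lambda>i j. u j i) (lin_map n u (?y z)) j\<bar> / scale (T * J) j) \<le> (\<Sum>j\<in>low. \<bar>z j\<bar>)"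
      proof (rule sum_mono)
        fix j assume "j \<in> low"
        then have j: "j < n" using low_subset by auto
        have "\<bar>?y z j\<bar> \<le> scale (T * J) j * \<bar>z j\<bar>"
          using scale_pos[OF c(1) j] scale_mono[of c "T * J" j] c
          by (simp add: abs_mult mult_right_mono)
        then show "\<bar>lin_map n (\<lambda>i j. u j i) (lin_map n u (?y z)) j\<bar> / scale (T * J) j \<le> \<bar>z j\<bar>"
          unfolding coef[OF j] using scale_pos[OF T0 j] by (simp add: field_simps)
      qed
      moreover have "(\<Sum>j\<in>{..<n} - low. (lin_map n (\<lambda>i j. u j i) (lin_map n u (?y z)) j)\<^sup>2)
          = (\<Sum>j\<in>{..<n} - low. (scale c j)\<^sup>2 * (z j)\<^sup>2)"
        by (intro sum.cong refl) (auto simp: coef power_mult_distrib)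
      ultimately have "R < (\<Sum>j\<in>low. \<bar>z j\<bar>) \<or> R < (\<Sum>j\<in>{..<n} - low. (scale c j)\<^sup>2 * (z j)\<^sup>2)"
        using z lin_map_in_space[of n u "?y z"] unfolding sieve_def by auto
      moreover have "(\<Sum>j\<in>{..<n} - low. t * (scale c j)\<^sup>2 * (z j)\<^sup>2) = t * (\<Sum>j\<in>{..<n} - low. (scale c j)\<^sup>2 * (z j)\<^sup>2)"
        by (simp add: sum_distrib_left mult.assoc)
      ultimately show "z \<in> ?E1 \<union> ?E2" using z t(1) by auto
    qed
    show "?E1 \<union> ?E2 \<in> sets ?P" using E1 E2 by (rule sets.Un)
  qed
  also have "\<dots> \<le> emeasure ?P ?E1 + emeasure ?P ?E2"
    using E1 E2 by (rule emeasure_subadditive)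
  also have "\<dots> \<le> ennreal (exp (- R + 2 * card_const * J)) + ennreal (exp (- t * R + tail_const / 2 * J))"
  proof (rule add_mono)
    have "emeasure ?P ?E1 \<le> ennreal (exp (- R + (\<Sum>j\<in>low. 2)))"
      using nn_integral_std_normal_exp_abs low_subset by (intro std_normal_PiM_chernoff) auto
    also have "\<dots> \<le> ennreal (exp (- R + 2 * card_const * J))"
    proof -
      have "real (card low) \<le> card_const * J" using card_low_le by (simp add: card_const_def)
      then show ?thesis by (intro ennreal_leI) simp
    qed
    finally show "emeasure ?P ?E1 \<le> ennreal (exp (- R + 2 * card_const * J))" .
    have "emeasure ?P ?E2 \<le> ennreal (exp (- (t * R) + (\<Sum>j\<in>{..<n} - low. 2 * (t * (scale c j)\<^sup>2))))"
      using nn_integral_std_normal_exp_square ts t(1) by (intro std_normal_PiM_chernoff) auto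
    also have "(\<Sum>j\<in>{..<n} - low. 2 * (t * (scale c j)\<^sup>2)) = 2 * t * (\<Sum>j\<in>{..<n} - low. (scale c j)\<^sup>2)"
      by (simp add: sum_distrib_left mult.assoc)
    also have "ennreal (exp (- (t * R) + 2 * t * (\<Sum>j\<in>{..<n} - low. (scale c j)\<^sup>2))) \<le> ennreal (exp (- t * R + tail_const / 2 * J))"
    proof -
      have "2 * t * (\<Sum>j\<in>{..<n} - low. (scale c j)\<^sup>2) \<le> 2 * t * (tail_const * (c / J) powr q * J)"
        using sum_scale_square_high[OF c(1)] t by (intro mult_left_mono) (auto simp: tail_const_def)
      also have "\<dots> \<le> 2 * t * (tail_const * T powr q * J)"
        using t T c J q consts_pos by (intro mult_left_mono mult_right_mono powr_mono2) auto
      also have "\<dots> = 2 * (t * T powr q) * (tail_const * J)" by (simp only: mult_ac)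
      also have "\<dots> \<le> 2 * (1 / 4) * (tail_const * J)"
        using t J consts_pos by (intro mult_right_mono mult_left_mono) auto
      finally show ?thesis by (intro ennreal_leI) simp
    qed
    finally show "emeasure ?P ?E2 \<le> ennreal (exp (- t * R + tail_const / 2 * J))" .
  qed
  finally show ?thesis by simp
qed

end

section \<open>Mixing over the scale\<close>

lemma (in prob_space) exponential_1_tail:
  assumes c: "distributed M lborel c (exponential_density 1)" and a: "0 \<le> a"
  shows "emeasure (distr M borel c) {a<..} = ennreal (exp (- a))"
proof -
  have m: "c \<in> borel_measurable M" using distributed_measurable[OF c] by simp
  have "emeasure (distr M borel c) {a<..} = emeasure M {\<omega> \<in> space M. a < c \<omega>}"
    using m by (subst emeasure_distr) (auto intro!: arg_cong2[where f = emeasure])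
  also have "\<dots> = ennreal (exp (- a))"
    using exponential_distributedD_gt[OF c a] by (simp add: emeasure_eq_measure)
  finally show ?thesis .
qed

lemma hierarchical_prior_emeasure:
  assumes "hierarchical_prior n G r \<alpha> M c f" "B \<in> sets (Rn n)"
  shows "emeasure M {\<omega> \<in> space M. f \<omega> \<in> B}
    = (\<integral>\<^sup>+x. emeasure (centered_gaussian n (prior_covariance n G r \<alpha> x)) B \<partial>distr M borel c)"
proof -
  have "conditional_law M (Rn n) c f (\<lambda>x. centered_gaussian n (prior_covariance n G r \<alpha> x))"
    using assms(1) by (simp add: hierarchical_prior_def)
  from bspec[OF bspec[OF this[unfolded conditional_law_def], of UNIV], OF _ assms(2)]
  show ?thesis by simp
qed

text \<open>The kernel is only compared pointwise with a step function, which needs nothing but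
  monotonicity of the integral; \<open>conditional_law\<close> does not provide measurability of the
  kernel in \<open>x\<close>.\<close>

lemma hierarchical_prior_ge:
  assumes M: "prob_space M" and H: "hierarchical_prior n G r \<alpha> M c f" and B: "B \<in> sets (Rn n)"
    and a: "0 \<le> a" "a \<le> b" and m: "0 \<le> m"
    and K: "\<And>x. a < x \<Longrightarrow> x \<le> b \<Longrightarrow>
      ennreal m \<le> emeasure (centered_gaussian n (prior_covariance n G r \<alpha> x)) B"
  shows "m * (exp (- a) - exp (- b)) \<le> measure M {\<omega> \<in> space M. f \<omega> \<in> B}"
proof -
  interpret prob_space M by (rule M)
  have c: "distributed M lborel c (exponential_density 1)"
    using H by (simp add: hierarchical_prior_def)
  let ?N = "distr M borel c"
  have "emeasure ?N {a<..b} = emeasure ?N {a<..} - emeasure ?N {b<..}"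
  proof -
    have "{a<..b} = {a<..} - {b<..}" using a by auto
    then show ?thesis
      using exponential_1_tail[OF c, of b] a by (simp only:) (subst emeasure_Diff, auto)
  qed
  also have "\<dots> = ennreal (exp (- a) - exp (- b))"
    using a by (simp add: exponential_1_tail[OF c] ennreal_minus)
  finally have ab: "emeasure ?N {a<..b} = ennreal (exp (- a) - exp (- b))" .
  have "ennreal (m * (exp (- a) - exp (- b))) = (\<integral>\<^sup>+x. ennreal m * indicator {a<..b} x \<partial>?N)"
    using m a by (simp add: nn_integral_cmult_indicator ab ennreal_mult)
  also have "\<dots> \<le> (\<integral>\<^sup>+x. emeasure (centered_gaussian n (prior_covariance n G r \<alpha> x)) B \<partial>?N)"
    using K by (intro nn_integral_mono) (auto simp: indicator_def)
  also have "\<dots> = emeasure M {\<omega> \<in> space M. f \<omega> \<in> B}"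
    by (rule hierarchical_prior_emeasure[OF H B, symmetric])
  finally show ?thesis by (simp add: emeasure_eq_measure)
qed

lemma hierarchical_prior_le:
  assumes M: "prob_space M" and H: "hierarchical_prior n G r \<alpha> M c f" and B: "B \<in> sets (Rn n)"
    and b: "0 \<le> b" and m: "0 \<le> m"
    and K: "\<And>x. 0 < x \<Longrightarrow> x \<le> b \<Longrightarrow>
      emeasure (centered_gaussian n (prior_covariance n G r \<alpha> x)) B \<le> ennreal m"
    and K1: "\<And>x. 0 < x \<Longrightarrow> emeasure (centered_gaussian n (prior_covariance n G r \<alpha> x)) B \<le> 1"
  shows "measure M {\<omega> \<in> space M. f \<omega> \<in> B} \<le> m + exp (- b)"
proof -
  interpret prob_space M by (rule M)
  have c: "distributed M lborel c (exponential_density 1)"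
    using H by (simp add: hierarchical_prior_def)
  let ?N = "distr M borel c"
  have cm: "c \<in> borel_measurable M" using distributed_measurable[OF c] by simp
  interpret N: prob_space ?N by (rule prob_space_distr[OF cm])
  have "emeasure ?N {0<..} = 1"
    using exponential_1_tail[OF c, of 0] by simp
  \<comment> \<open>For \<open>x \<le> 0\<close> the kernel formula carries no information; these
    values form a null set of the exponential law.\<close>
  then have pos: "AE x in ?N. 0 < x"
    using N.AE_in_set_eq_1[of "{0<..}"] by (simp add: N.emeasure_eq_measure)
  have "emeasure M {\<omega> \<in> space M. f \<omega> \<in> B}
      = (\<integral>\<^sup>+x. emeasure (centered_gaussian n (prior_covariance n G r \<alpha> x)) B \<partial>?N)"
    by (rule hierarchical_prior_emeasure[OF H B])
  also have "\<dots> \<le> (\<integral>\<^sup>+x. ennreal m + indicator {b<..} x \<partial>?N)"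
  proof (rule nn_integral_mono_AE)
    show "AE x in ?N. emeasure (centered_gaussian n (prior_covariance n G r \<alpha> x)) B \<le> ennreal m + indicator {b<..} x"
      using pos
    proof eventually_elim
      case (elim x)
      show ?case
      proof (cases "x \<le> b")
        case False
        then show ?thesis using K1[OF elim] by (simp add: add_increasing)
      qed (use K[OF elim] in auto)
    qed
  qed
  also have "\<dots> = ennreal m + ennreal (exp (- b))"
    using b N.emeasure_space_1 by (simp add: nn_integral_add exponential_1_tail[OF c])
  also have "\<dots> = ennreal (m + exp (- b))" using m by simp
  finally have "ennreal (measure M {\<omega> \<in> space M. f \<omega> \<in> B}) \<le> ennreal (m + exp (- b))"
    by (simp only: emeasure_eq_measure)
  then show ?thesis using m by (subst (asm) ennreal_le_iff) auto
qed

text \<open>The condition speaks of indices up to a fraction \<open>k\<close> of \<open>n\<close>.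
  For larger \<open>j\<close> the eigenvalue at the last admissible index \<open>l\<close> is a
  lower bound by monotonicity, and \<open>l\<close> is still at least
  \<open>k / 2 * j\<close>.\<close>

lemma geometry_condition_lower_bound:
  assumes G: "\<And>n. 1 \<le> n \<Longrightarrow> connected_simple_graph n (G n)"
    and r: "0 < r" and geo: "geometry_condition G r"
  obtains i0 :: nat and \<kappa> :: real where "1 \<le> i0" "0 < \<kappa>"
    and "\<forall>\<^sub>F n in sequentially. \<forall>j. i0 \<le> j \<and> j < n \<longrightarrow>
      \<kappa> * real j powr (2 / r) \<le> real n powr (2 / r) * laplacian_eigenvalue n (G n) j"
proof -
  from geo obtain i1 :: nat and k C1 C2 :: real where k: "0 < k" "k \<le> 1" and C: "0 < C1"
    and ev: "\<forall>\<^sub>F n in sequentially. \<forall>i. i1 \<le> i \<and> real i \<le> k * real n \<and> i \<le> n - 1 \<longrightarrow>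
      C1 * (real i / real n) powr (2 / r) \<le> laplacian_eigenvalue n (G n) i \<and>
      laplacian_eigenvalue n (G n) i \<le> C2 * (real i / real n) powr (2 / r)"
    unfolding geometry_condition_def by blast
  have large: "\<forall>\<^sub>F n in sequentially. max 1 (2 * (real i1 + 1) / k) \<le> real n"
    using filterlim_real_sequentially unfolding filterlim_at_top by blast
  show thesis
  proof (rule that[of "max 1 i1" "C1 * (k / 2) powr (2 / r)"])
    show "\<forall>\<^sub>F n in sequentially. \<forall>j. max 1 i1 \<le> j \<and> j < n \<longrightarrow>
      C1 * (k / 2) powr (2 / r) * real j powr (2 / r) \<le> real n powr (2 / r) * laplacian_eigenvalue n (G n) j"
      using ev large
    proof eventually_elim
      case (elim n)
      have n: "1 \<le> n" "2 * (real i1 + 1) \<le> k * real n"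
      proof -
        have "1 \<le> real n" "2 * (real i1 + 1) / k \<le> real n" using elim(2) by auto
        then show "1 \<le> n" "2 * (real i1 + 1) \<le> k * real n" using k by (auto simp: field_simps)
      qed
      show ?case
      proof (intro allI impI)
        fix j assume j: "max 1 i1 \<le> j \<and> j < n"
        have "\<exists>l. l \<le> j \<and> i1 \<le> l \<and> real l \<le> k * real n \<and> k / 2 * real j \<le> real l"
        proof (cases "real j \<le> k * real n")
          case True
          then show ?thesis using j k by (intro exI[of _ j]) (auto simp: field_simps)
        next
          case False
          let ?l = "nat \<lfloor>k * real n\<rfloor>"
          \<comment> \<open>The loss of 1 by the floor is harmless:
            \<open>2 * (i1 + 1) \<le> k * n\<close> implies both \<open>i1 \<le> k * n - 1\<close>
            and \<open>k * n / 2 \<le> k * n - 1\<close>.\<close>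
          have l: "real ?l \<le> k * real n" "k * real n - 1 \<le> real ?l" using k by (auto simp: of_nat_nat)
          have "k * real j \<le> k * real n" using j k by (intro mult_left_mono) auto
          then have "k / 2 * real j \<le> real ?l" using l(2) n(2) by (simp add: field_simps)
          moreover have "real ?l \<le> real j" using l(1) False by linarith
          moreover have "real i1 \<le> k * real n - 1" using n(2) by simp
          then have "real i1 \<le> real ?l" using l(2) by (rule order_trans)
          ultimately show ?thesis using l by (intro exI[of _ ?l]) auto
        qed
        then obtain l where l: "l \<le> j" "i1 \<le> l" "real l \<le> k * real n" "k / 2 * real j \<le> real l" by blast
        have "C1 * (k / 2) powr (2 / r) * real j powr (2 / r) = C1 * (k / 2 * real j) powr (2 / r)"
          by (simp only: powr_mult mult.assoc)
        also have "\<dots> \<le> C1 * real l powr (2 / r)"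
          using l(4) C k r by (intro mult_left_mono powr_mono2) auto
        also have "\<dots> = real n powr (2 / r) * (C1 * (real l / real n) powr (2 / r))"
          using n by (simp add: powr_divide)
        also have "\<dots> \<le> real n powr (2 / r) * laplacian_eigenvalue n (G n) l"
          using elim(1) l j by (intro mult_left_mono) auto
        also have "\<dots> \<le> real n powr (2 / r) * laplacian_eigenvalue n (G n) j"
        proof (rule mult_left_mono)
          obtain U where "\<And>i j. i \<le> j \<Longrightarrow> j < n \<Longrightarrow> laplacian_eigenvalue n (G n) i \<le> laplacian_eigenvalue n (G n) j"
            using spectral_decomposition_laplacian[OF G[OF n(1)]] by blast
          then show "laplacian_eigenvalue n (G n) l \<le> laplacian_eigenvalue n (G n) j"
            using l(1) j by blast
        qed simp
        finally show "C1 * (k / 2) powr (2 / r) * real j powr (2 / r) \<le> real n powr (2 / r) * laplacian_eigenvalue n (G n) j" .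
      qed
    qed
  qed (use C k in auto)
qed

text \<open>The estimates for a single \<open>n\<close>, with constants \<open>D\<close>,
  \<open>H\<close> and \<open>L\<close> that do not depend on \<open>n\<close>; the limit then only
  has to supply its eventual hypotheses.\<close>

lemma prior_bounds_at:
  fixes n i0 :: nat and G :: "nat pair_pre_digraph" and r \<alpha> \<beta> \<kappa> C :: real
    and h0 :: "nat \<Rightarrow> real" and M :: "'w measure" and c :: "'w \<Rightarrow> real" and f :: "'w \<Rightarrow> nat \<Rightarrow> real"
  defines "p \<equiv> \<alpha> + r / 2" and "J \<equiv> real n powr (r / (2 * \<beta> + r))"
  defines "D \<equiv> polynomial_spectrum.card_const i0 r \<kappa>"
    and "H \<equiv> polynomial_spectrum.tail_const i0 r p \<kappa>"
    and "L \<equiv> polynomial_spectrum.log_const i0 r p \<kappa>"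
  assumes G: "connected_simple_graph n G" and r: "1 \<le> r" and \<alpha>: "0 < \<alpha>"
    and \<beta>: "0 < \<beta>" "\<beta> \<le> p" and h0: "h0 \<in> sobolev_ball n G r \<beta> C"
    and M: "prob_space M" and prior: "hierarchical_prior n G r \<alpha> M c f"
    and n: "1 \<le> n" and i0: "1 \<le> i0" and \<kappa>: "0 < \<kappa>"
    and ge: "\<forall>j. i0 \<le> j \<and> j < n \<longrightarrow>
      \<kappa> * real j powr (2 / r) \<le> real n powr (2 / r) * laplacian_eigenvalue n G j"
    and lnn: "ln (real n) \<le> J"
  shows "\<And>\<epsilon>. 0 < \<epsilon> \<Longrightarrow> (D + 4 * (H * 2 powr (2 * p / r)) + 2 * C\<^sup>2) * J < real n * \<epsilon>\<^sup>2 \<Longrightarrow>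
      exp (- (L 2 + 2 powr (p + \<beta>) * C\<^sup>2 + 2 powr p * D + 3) * J)
        \<le> measure M {\<omega> \<in> space M. norm_n n (\<lambda>i. f \<omega> i - h0 i) < \<epsilon>}"
    and "\<And>K t Q. 0 < K \<Longrightarrow> 0 < t \<Longrightarrow> t * (K + 2) powr (2 * p / r) \<le> 1 / 4 \<Longrightarrow>
      K + 2 + 2 * D \<le> Q \<Longrightarrow> K + 2 + H / 2 \<le> t * Q \<Longrightarrow>
      \<exists>B\<in>sets (Rn n). measure M {\<omega> \<in> space M. f \<omega> \<notin> B} \<le> exp (- K * J) \<and>
        (\<forall>\<epsilon>>0. (D + Q) * J < real n * \<epsilon>\<^sup>2 \<longrightarrow>
          ln_enat (covering_number n \<epsilon> B) \<le> ereal ((Q + L (K + 2)) * J))"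
proof -
  define x where "x = (\<lambda>j. real n powr (2 / r) * laplacian_eigenvalue n G j)"
  define \<delta> where "\<delta> = real n powr (2 / r) / (real n)\<^sup>2"
  obtain U where dec: "spectral_decomposition n (laplacian n G) U (laplacian_eigenvalue n G)"
    and nonneg: "\<And>i. i < n \<Longrightarrow> 0 \<le> laplacian_eigenvalue n G i"
    by (rule spectral_decomposition_laplacian[OF G]) (rule that, assumption+)
  have n1: "1 \<le> real n" using n by simp
  interpret spec: polynomial_spectrum n i0 r p \<kappa> J \<delta> x
  proof
    show "0 < r" "r < 2 * p" using r \<alpha> by (auto simp: p_def)
    show "1 \<le> J" unfolding J_def using n1 r \<beta> by (intro ge_one_powr_ge_zero) auto
    have "J \<le> real n powr 1" unfolding J_def using n1 r \<beta> by (intro powr_mono) (auto simp: field_simps)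
    then show "J \<le> real n" using n1 by simp
    show "0 < \<delta>" using n1 by (simp add: \<delta>_def)
    have "real n powr (2 / r) \<le> real n powr 2" using n1 r by (intro powr_mono) (auto simp: field_simps)
    then show "\<delta> \<le> 1" using n1 by (simp add: \<delta>_def)
    have "1 \<le> real n powr (2 / r)" using n1 r by (intro ge_one_powr_ge_zero) auto
    then show "1 / (real n)\<^sup>2 \<le> \<delta>" unfolding \<delta>_def by (intro divide_right_mono) auto
    show "\<And>j. j < n \<Longrightarrow> 0 \<le> x j" using nonneg by (simp add: x_def)
    show "\<And>j. i0 \<le> j \<Longrightarrow> j < n \<Longrightarrow> \<kappa> * real j powr (2 / r) \<le> x j" using ge by (simp add: x_def)
  qed (use \<kappa> i0 in auto)
  let ?u = "entries U" and ?K = "\<lambda>x. centered_gaussian n (prior_covariance n G r \<alpha> x)"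
  note u = spectral_decomposition_orthonormal[OF dec]
  have J: "1 \<le> J" by (rule spec.J)
  have law: "?K y = spectral_law n ?u (spec.scale y)" if "0 < y" for y
  proof -
    have n0: "0 < n" using n by simp
    have "?K y = spectral_law n ?u (\<lambda>k. y powr (2 * p / r / 2) * (x k + \<delta>) powr (- p / 2))"
      unfolding x_def \<delta>_def p_def by (rule centered_gaussian_prior_covariance[OF dec nonneg n0 that])
    then show ?thesis by (simp only: spec.scale_def[abs_def] spec.q_def)
  qed
  have fM: "f \<omega> \<in> space (Rn n)" if "\<omega> \<in> space M" for \<omega>
    using prior that by (auto simp: hierarchical_prior_def dest: measurable_space)
  have exp2: "exp (- J) \<le> 1 / 2" "exp (- 2 * J) \<le> 1 / 3"
  proof -
    have "2 \<le> exp J" "3 \<le> exp (2 * J)"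
      using exp_ge_add_one_self[of J] exp_ge_add_one_self[of "2 * J"] J by linarith+
    then show "exp (- J) \<le> 1 / 2" "exp (- 2 * J) \<le> 1 / 3"
      by (simp_all add: exp_minus field_simps)
  qed
  show "exp (- (L 2 + 2 powr (p + \<beta>) * C\<^sup>2 + 2 powr p * D + 3) * J)
        \<le> measure M {\<omega> \<in> space M. norm_n n (\<lambda>i. f \<omega> i - h0 i) < \<epsilon>}"
    if \<epsilon>: "0 < \<epsilon>" "(D + 4 * (H * 2 powr (2 * p / r)) + 2 * C\<^sup>2) * J < real n * \<epsilon>\<^sup>2" for \<epsilon>
  proof -
    let ?B = "{h \<in> space (Rn n). norm_n n (\<lambda>i. h i - h0 i) < \<epsilon>}"
    define m where "m = exp (- ((L 2 + 2 powr (p + \<beta>) * C\<^sup>2 + 2 powr p * D) * J)) / 2"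
    have V: "(\<Sum>j<n. (lin_map n (\<lambda>i j. ?u j i) h0 j)\<^sup>2 * (1 + x j powr \<beta>)) \<le> real n * C\<^sup>2"
      using sobolev_ball_spectral[OF dec _ h0] n by (simp add: x_def)
    \<comment> \<open>The exponent in \<open>J\<close> is the solution of
      \<open>n * J powr (- 2 * \<beta> / r) = J\<close>.\<close>
    have JV: "J powr (- 2 * \<beta> / r) * (real n * C\<^sup>2) \<le> C\<^sup>2 * J"
    proof -
      have "J powr (- 2 * \<beta> / r) * real n = real n * real n powr (r / (2 * \<beta> + r) * (- 2 * \<beta> / r))"
        by (simp only: J_def powr_powr mult.commute)
      also have "\<dots> = real n powr (1 + r / (2 * \<beta> + r) * (- 2 * \<beta> / r))"
        by (simp only: powr_mult_base of_nat_0_le_iff)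
      also have "1 + r / (2 * \<beta> + r) * (- 2 * \<beta> / r) = r / (2 * \<beta> + r)"
        using r \<beta> by (simp add: field_simps)
      finally have "J powr (- 2 * \<beta> / r) * real n = J" by (simp add: J_def)
      then have "J powr (- 2 * \<beta> / r) * (real n * C\<^sup>2) = J * C\<^sup>2" by (simp only: mult.assoc[symmetric])
      then show ?thesis by (simp only: mult.commute order_refl)
    qed
    have K: "ennreal m \<le> emeasure (?K y) ?B" if y: "J < y" "y \<le> 2 * J" for y
    proof -
      have y0: "0 < y" using y J by simp
      show ?thesis unfolding law[OF y0] m_def L_def D_def
        by (rule spec.small_ball[OF u lnn \<beta> _ y(2) V JV \<epsilon>(1)])
           (use y \<epsilon>(2) in \<open>simp_all add: D_def H_def spec.q_def\<close>)
    qed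
    \<comment> \<open>The summand 3 pays \<open>J\<close> for the factor \<open>1 / 2\<close> in
      \<open>m\<close> and \<open>2 * J\<close> for the probability of
      \<open>J < c \<le> 2 * J\<close>, which is at least \<open>exp (- 2 * J)\<close>.\<close>
    have "exp (- (L 2 + 2 powr (p + \<beta>) * C\<^sup>2 + 2 powr p * D + 3) * J)
        = exp (- ((L 2 + 2 powr (p + \<beta>) * C\<^sup>2 + 2 powr p * D) * J)) * (exp (- J) * exp (- (2 * J)))"
      by (simp add: algebra_simps flip: exp_add)
    also have "\<dots> \<le> exp (- ((L 2 + 2 powr (p + \<beta>) * C\<^sup>2 + 2 powr p * D) * J)) * (1 / 2 * (exp (- J) - exp (- (2 * J))))"
    proof (intro mult_left_mono mult_mono exp2)
      have "exp (- (2 * J)) = exp (- J) * exp (- J)" by (simp flip: exp_add)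
      also have "\<dots> \<le> 1 / 2 * exp (- J)" by (intro mult_right_mono exp2) simp
      finally show "exp (- (2 * J)) \<le> exp (- J) - exp (- (2 * J))" by simp
    qed auto
    also have "\<dots> = m * (exp (- J) - exp (- (2 * J)))" by (simp add: m_def)
    also have "\<dots> \<le> measure M {\<omega> \<in> space M. f \<omega> \<in> ?B}"
      using J K by (intro hierarchical_prior_ge[OF M prior norm_n_ball_measurable]) (auto simp: m_def)
    also have "{\<omega> \<in> space M. f \<omega> \<in> ?B} = {\<omega> \<in> space M. norm_n n (\<lambda>i. f \<omega> i - h0 i) < \<epsilon>}"
      using fM by auto
    finally show ?thesis .
  qed
  show "\<exists>B\<in>sets (Rn n). measure M {\<omega> \<in> space M. f \<omega> \<notin> B} \<le> exp (- K * J) \<and>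
        (\<forall>\<epsilon>>0. (D + Q) * J < real n * \<epsilon>\<^sup>2 \<longrightarrow>
          ln_enat (covering_number n \<epsilon> B) \<le> ereal ((Q + L (K + 2)) * J))"
    if K: "0 < K" and t: "0 < t" "t * (K + 2) powr (2 * p / r) \<le> 1 / 4"
      and Q: "K + 2 + 2 * D \<le> Q" "K + 2 + H / 2 \<le> t * Q" for K t Q
  proof (intro bexI conjI allI impI)
    \<comment> \<open>Large \<open>c\<close> and the two violations of the sieve each have
      probability at most \<open>exp (- (K + 2) * J)\<close>; the surplus 2 absorbs their number, as
      \<open>3 * exp (- 2 * J) \<le> 1\<close>.\<close>
    define T where "T = K + 2"
    let ?B = "sieve n ?u spec.low (spec.scale (T * J)) (Q * J)"
    have T0: "0 < T * J" using K J by (simp add: T_def)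
    show B: "?B \<in> sets (Rn n)" by (rule sieve_measurable[OF spec.low_subset])
    then have B': "space (Rn n) - ?B \<in> sets (Rn n)" by auto
    define m where "m = exp (- (Q * J) + 2 * D * J) + exp (- t * (Q * J) + H / 2 * J)"
    have Km: "emeasure (?K y) (space (Rn n) - ?B) \<le> ennreal m" if y: "0 < y" "y \<le> T * J" for y
      unfolding law[OF y(1)] m_def D_def H_def
      by (rule spec.sieve_complement[OF u(1) y t(1)]) (use t in \<open>simp add: spec.q_def T_def\<close>)
    have "measure M {\<omega> \<in> space M. f \<omega> \<in> space (Rn n) - ?B} \<le> m + exp (- (T * J))"
      using T0 Km law emeasure_spectral_law_le_1[OF B']
      by (intro hierarchical_prior_le[OF M prior B']) (auto simp: m_def)
    also have "m \<le> exp (- (T * J)) + exp (- (T * J))"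
    proof -
      have "(K + 2 + 2 * D) * J \<le> Q * J" "(K + 2 + H / 2) * J \<le> t * Q * J"
        using Q J by (intro mult_right_mono; simp)+
      then show ?thesis unfolding m_def T_def by (intro add_mono) (simp_all add: algebra_simps)
    qed
    also have "exp (- (T * J)) + exp (- (T * J)) + exp (- (T * J)) = exp (- K * J) * (3 * exp (- 2 * J))"
      by (simp add: T_def algebra_simps flip: exp_add)
    also have "\<dots> \<le> exp (- K * J) * 1"
      using exp2(2) by (intro mult_left_mono) auto
    also have "{\<omega> \<in> space M. f \<omega> \<in> space (Rn n) - ?B} = {\<omega> \<in> space M. f \<omega> \<notin> ?B}"
      using fM by auto
    finally show "measure M {\<omega> \<in> space M. f \<omega> \<notin> ?B} \<le> exp (- K * J)" by simp
    fix \<epsilon> :: real assume \<epsilon>: "0 < \<epsilon>" "(D + Q) * J < real n * \<epsilon>\<^sup>2"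
    have "real (card spec.low) + Q * J < real n * \<epsilon>\<^sup>2"
      using spec.card_low_le \<epsilon>(2) by (simp add: D_def spec.card_const_def algebra_simps)
    moreover have "\<And>j. j \<in> spec.low \<Longrightarrow> 0 < spec.scale (T * J) j"
      using spec.scale_pos[OF T0] spec.low_subset by auto
    ultimately have "ln_enat (covering_number n \<epsilon> ?B) \<le> ereal (Q * J + (\<Sum>j\<in>spec.low. ln (1 + 2 * spec.scale (T * J) j)))"
      using n \<epsilon>(1) by (intro sieve_entropy u spec.low_subset) auto
    also have "(\<Sum>j\<in>spec.low. ln (1 + 2 * spec.scale (T * J) j)) \<le> L T * J"
      using spec.sum_ln_scale_low[OF _ lnn, of T] K
      by (simp add: L_def spec.log_const_def spec.card_const_def T_def)
    finally show "ln_enat (covering_number n \<epsilon> ?B) \<le> ereal ((Q + L (K + 2)) * J)"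
      by (simp add: T_def algebra_simps)
  qed
qed

text \<open>What remains beyond \<open>prior_bounds_at\<close> is the order of the constants:
  \<open>a\<close> and \<open>K1\<close> come before \<open>K2\<close>, and \<open>b\<close>, which
  depends on \<open>K2\<close> through \<open>Q\<close> and \<open>L (K + 2)\<close>, comes after
  it.\<close>

theorem theorem3p2:
  fixes G :: "nat \<Rightarrow> nat pair_pre_digraph"
    and r \<alpha> \<beta> C :: real
    and f0 :: "nat \<Rightarrow> nat \<Rightarrow> real"
    and M :: "nat \<Rightarrow> 'w measure"
    and c :: "nat \<Rightarrow> 'w \<Rightarrow> real"
    and f :: "nat \<Rightarrow> 'w \<Rightarrow> nat \<Rightarrow> real"
  assumes "\<And>n. 1 \<le> n \<Longrightarrow> connected_simple_graph n (G n)"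
    and "1 \<le> r" and "geometry_condition G r"
    and "0 < \<alpha>" and "0 < C" and "0 < \<beta>" and "\<beta> \<le> \<alpha> + r / 2"
    and "\<And>n. 1 \<le> n \<Longrightarrow> f0 n \<in> sobolev_ball n (G n) r \<beta> C"
    and "\<And>n. 1 \<le> n \<Longrightarrow> prob_space (M n)"
    and "\<And>n. 1 \<le> n \<Longrightarrow> hierarchical_prior n (G n) r \<alpha> (M n) (c n) (f n)"
  shows "\<exists>K1>0. \<exists>a>0. \<forall>K2>1. \<exists>b>0. \<exists>B :: nat \<Rightarrow> (nat \<Rightarrow> real) set.
    (\<forall>n. B n \<in> sets (Rn n)) \<and>
    (\<forall>\<^sub>F n in sequentially.
      (let \<epsilon> = a * rate r \<beta> n; \<epsilon>' = b * rate r \<beta> n in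
        measure (M n) {\<omega> \<in> space (M n). norm_n n (\<lambda>i. f n \<omega> i - f0 n i) < \<epsilon>}
          \<ge> exp (- K1 * real n * \<epsilon>\<^sup>2) \<and>
        measure (M n) {\<omega> \<in> space (M n). f n \<omega> \<notin> B n} \<le> exp (- K2 * real n * \<epsilon>\<^sup>2) \<and>
        ln_enat (covering_number n \<epsilon>' (B n)) \<le> ereal (real n * \<epsilon>'\<^sup>2)))"
proof -
  define p where "p = \<alpha> + r / 2"
  define J where "J = (\<lambda>n :: nat. real n powr (r / (2 * \<beta> + r)))"
  have J_eq: "J n = real n powr (r / (2 * \<beta> + r))" for n by (simp add: J_def)
  have r: "0 < r" using assms(2) by simp
  obtain i0 :: nat and \<kappa> :: real where i0: "1 \<le> i0" and \<kappa>: "0 < \<kappa>"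
    and ge: "\<forall>\<^sub>F n in sequentially. \<forall>j. i0 \<le> j \<and> j < n \<longrightarrow>
      \<kappa> * real j powr (2 / r) \<le> real n powr (2 / r) * laplacian_eigenvalue n (G n) j"
    using geometry_condition_lower_bound[OF assms(1) r assms(3)] by blast
  define D where "D = polynomial_spectrum.card_const i0 r \<kappa>"
  define H where "H = polynomial_spectrum.tail_const i0 r p \<kappa>"
  define L where "L = polynomial_spectrum.log_const i0 r p \<kappa>"
  define E where "E = D + 4 * (H * 2 powr (2 * p / r)) + 2 * C\<^sup>2"
  define F where "F = L 2 + 2 powr (p + \<beta>) * C\<^sup>2 + 2 powr p * D + 3"
  \<comment> \<open>The absolute values and the summand 1 make \<open>a\<close> and
    \<open>K1\<close> positive and the required inequalities strict, whatever the signs of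
    \<open>E\<close> and \<open>F\<close>.\<close>
  define a where "a = sqrt (\<bar>E\<bar> + 1)"
  define K1 where "K1 = (\<bar>F\<bar> + 1) / a\<^sup>2"
  have a: "0 < a" "E < a\<^sup>2" by (auto simp: a_def add_nonneg_pos)
  have K1: "0 < K1" "F \<le> K1 * a\<^sup>2" using a by (auto simp: K1_def add_nonneg_pos)
  have lnn: "\<forall>\<^sub>F n in sequentially. ln (real n) \<le> J n"
    unfolding J_def using r assms(6) by real_asymp
  have good: "\<forall>\<^sub>F n in sequentially. 1 \<le> n \<and> ln (real n) \<le> J n \<and> (\<forall>j. i0 \<le> j \<and> j < n \<longrightarrow>
      \<kappa> * real j powr (2 / r) \<le> real n powr (2 / r) * laplacian_eigenvalue n (G n) j)"
    using eventually_ge_at_top[of 1] lnn ge by eventually_elim blast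
  have rate: "real n * (y * rate r \<beta> n)\<^sup>2 = y\<^sup>2 * J n" if "1 \<le> n" for n y
  proof -
    have "(rate r \<beta> n)\<^sup>2 = real n powr (2 * (- \<beta> / (2 * \<beta> + r)))"
      using that by (simp add: rate_def powr_powr mult.commute flip: powr_numeral)
    then have "real n * (rate r \<beta> n)\<^sup>2 = real n powr (1 + 2 * (- \<beta> / (2 * \<beta> + r)))"
      by (simp only: powr_mult_base of_nat_0_le_iff)
    also have "1 + 2 * (- \<beta> / (2 * \<beta> + r)) = r / (2 * \<beta> + r)"
      using r assms(6) by (simp add: field_simps)
    finally show ?thesis by (simp add: J_def power_mult_distrib)
  qed
  have J1: "0 < J n" "0 < rate r \<beta> n" if "1 \<le> n" for n
    using that by (simp_all add: J_def rate_def)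
  show ?thesis
  proof (rule exI[of _ K1], rule conjI[OF K1(1)], rule exI[of _ a], rule conjI[OF a(1)], intro allI impI)
    fix K2 :: real assume K2: "1 < K2"
    \<comment> \<open>Since \<open>n * \<epsilon>\<^sup>2 = a\<^sup>2 * J n\<close>, the exponent
      \<open>K2 * n * \<epsilon>\<^sup>2\<close> is \<open>K * J n\<close>. The next line takes the
      largest \<open>t\<close> that \<open>prior_bounds_at\<close> admits.\<close>
    define K where "K = K2 * a\<^sup>2"
    define t where "t = (K + 2) powr (- (2 * p / r)) / 4"
    define Q where "Q = max (K + 2 + 2 * D) ((K + 2 + H / 2) / t)"
    define b where "b = sqrt (\<bar>D\<bar> + \<bar>Q\<bar> + \<bar>L (K + 2)\<bar> + 1)"
    have K: "0 < K" using K2 a by (simp add: K_def)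
    have t: "0 < t" "t * (K + 2) powr (2 * p / r) \<le> 1 / 4"
      using K by (auto simp: t_def simp flip: powr_add)
    have Q: "K + 2 + 2 * D \<le> Q" "K + 2 + H / 2 \<le> t * Q"
    proof -
      show "K + 2 + 2 * D \<le> Q" by (simp add: Q_def)
      have "(K + 2 + H / 2) / t \<le> Q" by (simp add: Q_def)
      then show "K + 2 + H / 2 \<le> t * Q" using t(1) by (simp add: field_simps)
    qed
    have b: "0 < b" "D + Q < b\<^sup>2" "Q + L (K + 2) \<le> b\<^sup>2" by (auto simp: b_def add_nonneg_pos)
    let ?P = "\<lambda>n B. B \<in> sets (Rn n) \<and>
      measure (M n) {\<omega> \<in> space (M n). f n \<omega> \<notin> B} \<le> exp (- K * J n) \<and>
      (\<forall>\<epsilon>>0. (D + Q) * J n < real n * \<epsilon>\<^sup>2 \<longrightarrow>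
          ln_enat (covering_number n \<epsilon> B) \<le> ereal ((Q + L (K + 2)) * J n))"
    \<comment> \<open>Measurability is claimed for every \<open>n\<close>, while the bounds hold
      only eventually; the empty set serves the exceptional \<open>n\<close>.\<close>
    define B where "B = (\<lambda>n. if \<exists>B. ?P n B then SOME B. ?P n B else {})"
    have B: "?P n (B n)" if "\<exists>B. ?P n B" for n
      using someI_ex[OF that] that by (simp add: B_def)
    show "\<exists>b>0. \<exists>B :: nat \<Rightarrow> (nat \<Rightarrow> real) set. (\<forall>n. B n \<in> sets (Rn n)) \<and>
      (\<forall>\<^sub>F n in sequentially.
      (let \<epsilon> = a * rate r \<beta> n; \<epsilon>' = b * rate r \<beta> n in
        measure (M n) {\<omega> \<in> space (M n). norm_n n (\<lambda>i. f n \<omega> i - f0 n i) < \<epsilon>}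
          \<ge> exp (- K1 * real n * \<epsilon>\<^sup>2) \<and>
        measure (M n) {\<omega> \<in> space (M n). f n \<omega> \<notin> B n} \<le> exp (- K2 * real n * \<epsilon>\<^sup>2) \<and>
        ln_enat (covering_number n \<epsilon>' (B n)) \<le> ereal (real n * \<epsilon>'\<^sup>2)))"
    proof (intro exI[of _ b] exI[of _ B] conjI b(1) allI)
      fix n show "B n \<in> sets (Rn n)"
        using B[of n] by (cases "\<exists>B. ?P n B") (auto simp: B_def)
    next
      show "\<forall>\<^sub>F n in sequentially.
      (let \<epsilon> = a * rate r \<beta> n; \<epsilon>' = b * rate r \<beta> n in
        measure (M n) {\<omega> \<in> space (M n). norm_n n (\<lambda>i. f n \<omega> i - f0 n i) < \<epsilon>}
          \<ge> exp (- K1 * real n * \<epsilon>\<^sup>2) \<and>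
        measure (M n) {\<omega> \<in> space (M n). f n \<omega> \<notin> B n} \<le> exp (- K2 * real n * \<epsilon>\<^sup>2) \<and>
        ln_enat (covering_number n \<epsilon>' (B n)) \<le> ereal (real n * \<epsilon>'\<^sup>2))"
        using good
      proof eventually_elim
        case (elim n)
        then have n: "1 \<le> n" and ln: "ln (real n) \<le> J n" and gen: "\<forall>j. i0 \<le> j \<and> j < n \<longrightarrow>
          \<kappa> * real j powr (2 / r) \<le> real n powr (2 / r) * laplacian_eigenvalue n (G n) j" by auto
        note bounds = prior_bounds_at[OF assms(1)[OF n] assms(2,4,6,7) assms(8)[OF n] assms(9)[OF n]
            assms(10)[OF n] n i0 \<kappa> gen ln[unfolded J_eq],
            folded p_def, folded J_eq D_def H_def L_def]
        have 1: "exp (- K1 * real n * (a * rate r \<beta> n)\<^sup>2)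
            \<le> measure (M n) {\<omega> \<in> space (M n). norm_n n (\<lambda>i. f n \<omega> i - f0 n i) < a * rate r \<beta> n}"
        proof -
          have "- K1 * real n * (a * rate r \<beta> n)\<^sup>2 = - ((K1 * a\<^sup>2) * J n)"
            using rate[OF n, of a] by (simp only: mult.assoc minus_mult_left[symmetric])
          also have "\<dots> \<le> - F * J n"
            using mult_right_mono[OF K1(2), of "J n"] J1[OF n] by simp
          finally have "exp (- K1 * real n * (a * rate r \<beta> n)\<^sup>2) \<le> exp (- F * J n)" by simp
          also have "\<dots> \<le> measure (M n) {\<omega> \<in> space (M n). norm_n n (\<lambda>i. f n \<omega> i - f0 n i) < a * rate r \<beta> n}"
            unfolding F_def
          proof (rule bounds(1))
            show "0 < a * rate r \<beta> n" using a J1[OF n] by simp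
            show "(D + 4 * (H * 2 powr (2 * p / r)) + 2 * C\<^sup>2) * J n < real n * (a * rate r \<beta> n)\<^sup>2"
              unfolding rate[OF n] E_def[symmetric] using a(2) J1[OF n] by (intro mult_strict_right_mono)
          qed
          finally show ?thesis .
        qed
        have "\<exists>B. ?P n B" using bounds(2)[OF K t Q] by blast
        note Bn = B[OF this]
        have 2: "measure (M n) {\<omega> \<in> space (M n). f n \<omega> \<notin> B n} \<le> exp (- K2 * real n * (a * rate r \<beta> n)\<^sup>2)"
        proof -
          have "- K2 * real n * (a * rate r \<beta> n)\<^sup>2 = - K * J n"
            using rate[OF n, of a] by (simp only: K_def mult.assoc minus_mult_left[symmetric])
          then show ?thesis using Bn by (simp only:)
        qed
        have "ln_enat (covering_number n (b * rate r \<beta> n) (B n)) \<le> ereal ((Q + L (K + 2)) * J n)"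
        proof -
          have "0 < b * rate r \<beta> n" using b J1[OF n] by simp
          moreover have "(D + Q) * J n < real n * (b * rate r \<beta> n)\<^sup>2"
            unfolding rate[OF n] using b(2) J1[OF n] by (intro mult_strict_right_mono)
          ultimately show ?thesis using Bn by blast
        qed
        also have "\<dots> \<le> ereal (real n * (b * rate r \<beta> n)\<^sup>2)"
          unfolding rate[OF n] using b(3) J1[OF n] by (simp add: mult_right_mono)
        finally have 3: "ln_enat (covering_number n (b * rate r \<beta> n) (B n)) \<le> ereal (real n * (b * rate r \<beta> n)\<^sup>2)" .
        show ?case unfolding Let_def using 1 2 3 by blast
      qed
    qed
  qed
qed

end
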